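(* Let $A$ be an Auslander regular ring and let $$M_{\bullet} := 0 \to M_{m} \to M_{m-1} \to \cdots \to M_{1} \to M_{0}$$ be a complex of finitely generated left $A$-modules such that $\operatorname{pdim}(M_{q}) \leq m-q$ for each $q$. Denote by $H_{q}$ the homology of $M_\bullet$ at slot $q$. Let $i > 0$ be the largest index such that $H_{i} \neq 0$. Then $j(H_{i}) \leq m - i < m$.
   Context: Rings are associative with unit and not necessarily commutative. $\operatorname{pdim}(M)$ denotes the projective dimension of a left $A$-module $M$. A ring $A$ (left and right Noetherian) has finite global homological dimension if there is $\mu\in\mathbb{N}$ with $\operatorname{pdim}(M)\le\mu$ for every finitely generated left $A$-module $M$ (for left and right Noetherian rings the left and right versions of global dimension agree). Grade: for $A$ left and right Noetherian of finite global homological dimension and $M$ a finitely generated left (or right) $A$-module, the grade $j(M)$ is the smallest integer $k$ such that $\operatorname{Ext}_A^{k}(M,A)\neq 0$. For $M$ a left module, $\operatorname{Ext}_A^k(M,A)$ is a right $A$-module, and vice versa. (By convention $j(0)=\infty$.) A ring $A$ is Auslander regular if: (a) $A$ is left and right Noetherian; (b) $A$ has finite global homological dimension; (c) (Auslander's condition) for any finitely generated left $A$-module $M$, any $k$, and any submodule $N\subseteq \operatorname{Ext}_A^k(M,A)$, one has $j(N)\ge k$. *)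

theory Defs
  imports "HOL-Algebra.Module" "HOL-Algebra.AbelCoset" "HOL-Library.FuncSet" "HOL-Library.Extended_Nat"
begin

section \<open>Modules over noncommutative rings\<close>

text \<open>The locale \<^locale>\<open>module\<close> of HOL-Algebra requires a commutative ring of scalars. The following
  is the same list of axioms over an arbitrary ring; \<^locale>\<open>submodule\<close> needs no commutativity
  and is reused. The fields \<open>mult\<close> and \<open>one\<close> of the module record
  play no role and are filled arbitrarily below.\<close>

locale left_module = R?: ring R + M?: abelian_group M for R (structure) and M (structure) +
  assumes smult_closed [simp, intro]:
      "\<lbrakk>a \<in> carrier R; x \<in> carrier M\<rbrakk> \<Longrightarrow> a \<odot>\<^bsub>M\<^esub> x \<in> carrier M"
    and smult_l_distr:
      "\<lbrakk>a \<in> carrier R; b \<in> carrier R; x \<in> carrier M\<rbrakk> \<Longrightarrow>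
        (a \<oplus> b) \<odot>\<^bsub>M\<^esub> x = a \<odot>\<^bsub>M\<^esub> x \<oplus>\<^bsub>M\<^esub> b \<odot>\<^bsub>M\<^esub> x"
    and smult_r_distr:
      "\<lbrakk>a \<in> carrier R; x \<in> carrier M; y \<in> carrier M\<rbrakk> \<Longrightarrow>
        a \<odot>\<^bsub>M\<^esub> (x \<oplus>\<^bsub>M\<^esub> y) = a \<odot>\<^bsub>M\<^esub> x \<oplus>\<^bsub>M\<^esub> a \<odot>\<^bsub>M\<^esub> y"
    and smult_assoc1:
      "\<lbrakk>a \<in> carrier R; b \<in> carrier R; x \<in> carrier M\<rbrakk> \<Longrightarrow>
        (a \<otimes> b) \<odot>\<^bsub>M\<^esub> x = a \<odot>\<^bsub>M\<^esub> (b \<odot>\<^bsub>M\<^esub> x)"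
    and smult_one [simp]: "x \<in> carrier M \<Longrightarrow> \<one> \<odot>\<^bsub>M\<^esub> x = x"

text \<open>Right \<open>R\<close>-modules are left modules over the opposite ring, \<open>x \<cdot> a\<close> being written
  \<open>a \<odot> x\<close>. Every notion below is therefore stated for left modules and used for right
  modules through \<open>opp_ring\<close>.\<close>

definition opp_ring :: "('a, 'r) ring_scheme \<Rightarrow> ('a, 'r) ring_scheme" where
  "opp_ring R = R\<lparr>mult := (\<lambda>x y. y \<otimes>\<^bsub>R\<^esub> x)\<rparr>"

lemma opp_ring_opp_ring: "opp_ring (opp_ring R) = R"
  by (simp add: opp_ring_def)

definition regular_module :: "('a, 'r) ring_scheme \<Rightarrow> ('a, 'a) module" where
  "regular_module R =
    \<lparr>carrier = carrier R, mult = mult R, one = one R, zero = zero R, add = add R, smult = mult R\<rparr>"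

definition trivial_module :: "('a, 'b, 'm) module_scheme \<Rightarrow> bool" where
  "trivial_module M \<longleftrightarrow> carrier M = {\<zero>\<^bsub>M\<^esub>}"

definition finitely_generated :: "('a, 'r) ring_scheme \<Rightarrow> ('a, 'b, 'm) module_scheme \<Rightarrow> bool" where
  "finitely_generated R M \<longleftrightarrow>
    (\<exists>S. finite S \<and> S \<subseteq> carrier M \<and> (\<forall>H. submodule H R M \<longrightarrow> S \<subseteq> H \<longrightarrow> H = carrier M))"

definition linear_maps ::
  "('a, 'r) ring_scheme \<Rightarrow> ('a, 'b, 'm) module_scheme \<Rightarrow> ('a, 'c, 'n) module_scheme \<Rightarrow> ('b \<Rightarrow> 'c) set"
where
  "linear_maps R M N = {f \<in> carrier M \<rightarrow> carrier N.
     (\<forall>x\<in>carrier M. \<forall>y\<in>carrier M. f (x \<oplus>\<^bsub>M\<^esub> y) = f x \<oplus>\<^bsub>N\<^esub> f y) \<and>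
     (\<forall>a\<in>carrier R. \<forall>x\<in>carrier M. f (a \<odot>\<^bsub>M\<^esub> x) = a \<odot>\<^bsub>N\<^esub> f x)}"

text \<open>The module \<open>Z / B\<close> for submodules \<open>B \<subseteq> Z\<close> of \<open>M\<close>; its elements are the cosets of \<open>B\<close>.\<close>

definition subquotient :: "('a, 'b, 'm) module_scheme \<Rightarrow> 'b set \<Rightarrow> 'b set \<Rightarrow> ('a, 'b set) module" where
  "subquotient M Z B =
    \<lparr>carrier = a_rcosets\<^bsub>M\<lparr>carrier := Z\<rparr>\<^esub> B, mult = (\<lambda>X Y. B), one = B, zero = B,
     add = set_add M, smult = (\<lambda>a X. \<Union>x\<in>X. B +>\<^bsub>M\<^esub> (a \<odot>\<^bsub>M\<^esub> x))\<rparr>"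

section \<open>Complexes and homology\<close>

text \<open>Complexes \<open>\<dots> \<rightarrow> M 2 \<rightarrow> M 1 \<rightarrow> M 0\<close> with differentials \<open>d q : M (Suc q) \<rightarrow> M q\<close>.
  At slot 0 the outgoing map is taken to be zero.\<close>

definition module_complex ::
  "('a, 'r) ring_scheme \<Rightarrow> (nat \<Rightarrow> ('a, 'b, 'm) module_scheme) \<Rightarrow> (nat \<Rightarrow> 'b \<Rightarrow> 'b) \<Rightarrow> bool"
where
  "module_complex R M d \<longleftrightarrow>
    (\<forall>q. left_module R (M q)) \<and>
    (\<forall>q. d q \<in> linear_maps R (M (Suc q)) (M q)) \<and>
    (\<forall>q. \<forall>x\<in>carrier (M (Suc (Suc q))). d q (d (Suc q) x) = \<zero>\<^bsub>M q\<^esub>)"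

definition cycles :: "(nat \<Rightarrow> ('a, 'b, 'm) module_scheme) \<Rightarrow> (nat \<Rightarrow> 'b \<Rightarrow> 'b) \<Rightarrow> nat \<Rightarrow> 'b set" where
  "cycles M d q =
    (case q of 0 \<Rightarrow> carrier (M 0) | Suc p \<Rightarrow> a_kernel (M (Suc p)) (M p) (d p))"

definition homology ::
  "(nat \<Rightarrow> ('a, 'b, 'm) module_scheme) \<Rightarrow> (nat \<Rightarrow> 'b \<Rightarrow> 'b) \<Rightarrow> nat \<Rightarrow> ('a, 'b set) module"
where
  "homology M d q = subquotient (M q) (cycles M d q) (d q ` carrier (M (Suc q)))"

section \<open>Projective modules, resolutions, projective dimension\<close>

text \<open>HOL cannot quantify over carrier types inside a definition. The type \<open>('a + 'b) list\<close> is
  infinite and at least as large as \<open>'a\<close> and \<open>'b\<close>. For \<open>P\<close> with carrier in \<open>'b\<close>, it therefore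
  accommodates isomorphic copies of \<open>P\<close> and of the free module on the set \<open>carrier P\<close>; lifting
  against modules carried by it already makes \<open>P\<close> a direct summand of that free module, so the
  definition agrees with the lifting property against all modules.\<close>

definition projective_module :: "('a, 'r) ring_scheme \<Rightarrow> ('a, 'b, 'm) module_scheme \<Rightarrow> bool" where
  "projective_module R P \<longleftrightarrow> left_module R P \<and>
    (\<forall>(N :: ('a, ('a + 'b) list) module) (L :: ('a, ('a + 'b) list) module).
      \<forall>g\<in>linear_maps R N L. \<forall>f\<in>linear_maps R P L.
        left_module R N \<longrightarrow> left_module R L \<longrightarrow> g ` carrier N = carrier L \<longrightarrow>
        (\<exists>h\<in>linear_maps R P N. \<forall>x\<in>carrier P. g (h x) = f x))"

text \<open>\<open>\<dots> \<rightarrow> P 1 \<rightarrow> P 0 \<rightarrow> M \<rightarrow> 0\<close> is exact, with augmentation \<open>e : P 0 \<rightarrow> M\<close>.\<close>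

definition projective_resolution ::
  "('a, 'r) ring_scheme \<Rightarrow> ('a, 'b, 'm) module_scheme \<Rightarrow>
   (nat \<Rightarrow> ('a, 'p, 'n) module_scheme) \<Rightarrow> (nat \<Rightarrow> 'p \<Rightarrow> 'p) \<Rightarrow> ('p \<Rightarrow> 'b) \<Rightarrow> bool"
where
  "projective_resolution R M P d e \<longleftrightarrow>
    (\<forall>n. projective_module R (P n)) \<and>
    (\<forall>n. d n \<in> linear_maps R (P (Suc n)) (P n)) \<and>
    e \<in> linear_maps R (P 0) M \<and>
    e ` carrier (P 0) = carrier M \<and>
    d 0 ` carrier (P (Suc 0)) = a_kernel (P 0) M e \<and>
    (\<forall>n. d (Suc n) ` carrier (P (Suc (Suc n))) = a_kernel (P (Suc n)) (P n) (d n))"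

text \<open>Syzygies and free covers of modules carried by \<open>'b\<close> can again be carried by
  \<open>('a + 'b) list\<close>, so restricting resolutions to this type loses nothing. The value is \<open>\<infinity>\<close> if there
  is no finite resolution, and \<open>0\<close> for the zero module.\<close>

definition pdim :: "('a, 'r) ring_scheme \<Rightarrow> ('a, 'b, 'm) module_scheme \<Rightarrow> enat" where
  "pdim R M = Inf (enat ` {n. \<exists>(P :: nat \<Rightarrow> ('a, ('a + 'b) list) module) d e.
     projective_resolution R M P d e \<and> (\<forall>q>n. trivial_module (P q))})"

section \<open>Ext into the ring, and grade\<close>

text \<open>For a left \<open>R\<close>-module \<open>P\<close>, the right \<open>R\<close>-module of linear maps \<open>P \<rightarrow> R\<close>, with
  \<open>(f \<cdot> a) x = f x \<otimes> a\<close>, as a module over \<open>opp_ring R\<close>.\<close>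

definition dual_module :: "('a, 'r) ring_scheme \<Rightarrow> ('a, 'p, 'm) module_scheme \<Rightarrow> ('a, 'p \<Rightarrow> 'a) module" where
  "dual_module R P =
    \<lparr>carrier = linear_maps R P (regular_module R) \<inter> extensional (carrier P),
     mult = (\<lambda>f g. \<lambda>x\<in>carrier P. \<zero>\<^bsub>R\<^esub>), one = (\<lambda>x\<in>carrier P. \<zero>\<^bsub>R\<^esub>),
     zero = (\<lambda>x\<in>carrier P. \<zero>\<^bsub>R\<^esub>),
     add = (\<lambda>f g. \<lambda>x\<in>carrier P. f x \<oplus>\<^bsub>R\<^esub> g x),
     smult = (\<lambda>a f. \<lambda>x\<in>carrier P. f x \<otimes>\<^bsub>R\<^esub> a)\<rparr>"

definition dual_map ::
  "(nat \<Rightarrow> ('a, 'p, 'm) module_scheme) \<Rightarrow> (nat \<Rightarrow> 'p \<Rightarrow> 'p) \<Rightarrow> nat \<Rightarrow> ('p \<Rightarrow> 'a) \<Rightarrow> ('p \<Rightarrow> 'a)"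
where
  "dual_map P d k f = (\<lambda>x\<in>carrier (P (Suc k)). f (d k x))"

definition dual_cohomology ::
  "('a, 'r) ring_scheme \<Rightarrow> (nat \<Rightarrow> ('a, 'p, 'm) module_scheme) \<Rightarrow> (nat \<Rightarrow> 'p \<Rightarrow> 'p) \<Rightarrow> nat \<Rightarrow>
   ('a, ('p \<Rightarrow> 'a) set) module"
where
  "dual_cohomology R P d k =
    subquotient (dual_module R (P k))
      (a_kernel (dual_module R (P k)) (dual_module R (P (Suc k))) (dual_map P d k))
      (case k of 0 \<Rightarrow> {\<zero>\<^bsub>dual_module R (P 0)\<^esub>}
       | Suc j \<Rightarrow> dual_map P d j ` carrier (dual_module R (P j)))"

text \<open>\<open>Ext\<^sup>k(M, R)\<close>, a module over \<open>opp_ring R\<close>. It is computed from a chosen projective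
  resolution; up to isomorphism the result does not depend on the choice.\<close>

definition ext_module ::
  "('a, 'r) ring_scheme \<Rightarrow> ('a, 'b, 'm) module_scheme \<Rightarrow> nat \<Rightarrow>
   ('a, (('a + 'b) list \<Rightarrow> 'a) set) module"
where
  "ext_module R M k =
    (let (P, d) = (SOME (P :: nat \<Rightarrow> ('a, ('a + 'b) list) module, d).
        \<exists>e. projective_resolution R M P d e)
     in dual_cohomology R P d k)"

definition grade :: "('a, 'r) ring_scheme \<Rightarrow> ('a, 'b, 'm) module_scheme \<Rightarrow> enat" where
  "grade R M = Inf (enat ` {k. \<not> trivial_module (ext_module R M k)})"

section \<open>Auslander regular rings\<close>

definition left_noetherian :: "('a, 'r) ring_scheme \<Rightarrow> bool" where
  "left_noetherian R \<longleftrightarrow> ring R \<and>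
    (\<forall>I. submodule I R (regular_module R) \<longrightarrow>
       finitely_generated R ((regular_module R)\<lparr>carrier := I\<rparr>))"

definition right_noetherian :: "('a, 'r) ring_scheme \<Rightarrow> bool" where
  "right_noetherian R \<longleftrightarrow> left_noetherian (opp_ring R)"

text \<open>Every finitely generated left module is isomorphic to a quotient of a free module \<open>R\<^sup>n\<close>,
  realised on lists of length \<open>n\<close>. Hence modules carried by \<open>'a list set\<close> represent
  all finitely generated modules.\<close>

definition finite_global_dimension :: "('a, 'r) ring_scheme \<Rightarrow> bool" where
  "finite_global_dimension R \<longleftrightarrow>
    (\<exists>\<mu>::nat. \<forall>M :: ('a, 'a list set) module.
       left_module R M \<longrightarrow> finitely_generated R M \<longrightarrow> pdim R M \<le> enat \<mu>)"

definition auslander_condition :: "('a, 'r) ring_scheme \<Rightarrow> bool" where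
  "auslander_condition R \<longleftrightarrow>
    (\<forall>(M :: ('a, 'a list set) module) k N.
       left_module R M \<longrightarrow> finitely_generated R M \<longrightarrow>
       submodule N (opp_ring R) (ext_module R M k) \<longrightarrow>
       enat k \<le> grade (opp_ring R) ((ext_module R M k)\<lparr>carrier := N\<rparr>))"

definition auslander_regular :: "('a, 'r) ring_scheme \<Rightarrow> bool" where
  "auslander_regular R \<longleftrightarrow>
    left_noetherian R \<and> right_noetherian R \<and> finite_global_dimension R \<and> auslander_condition R"

end

theory Submission
  imports Defs
begin

text \<open>Let \<open>B\<close> be the boundaries in slot \<open>i\<close> and \<open>C = M i / B\<close>, so that \<open>H = H i\<close> is a submodule
  of \<open>C\<close>. Since the complex is exact above \<open>i\<close>, the sequence \<open>0 \<rightarrow> M m \<rightarrow> \<dots> \<rightarrow> M i \<rightarrow> C \<rightarrow> 0\<close> is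
  exact, and the bounds on projective dimensions give \<open>Ext k (C, A) = 0\<close> for \<open>k > m - i\<close>
  (\<open>boundaries_resolution\<close>, \<open>cokernel_of_boundaries_resolution\<close>).

  Suppose that the grade of \<open>H\<close> exceeds \<open>m - i\<close>. Then \<open>Ext k (Ext k (H, A), A) = 0\<close> for every \<open>k\<close>.
  For \<open>k \<le> m - i\<close> already \<open>Ext k (H, A) = 0\<close>. For \<open>k > m - i\<close> the long exact sequence of
  \<open>0 \<rightarrow> H \<rightarrow> C \<rightarrow> C / H \<rightarrow> 0\<close> identifies \<open>Ext k (H, A)\<close> with \<open>Ext (k + 1) (C / H, A)\<close>, whose grade
  is at least \<open>k + 1\<close> by Auslander's condition (\<open>ext_of_submodule_ext_vanishes\<close>). But a finitely
  generated module with this property is zero: dualize a resolution \<open>F\<close> of \<open>H\<close>, and let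
  \<open>Z k \<supseteq> I k\<close> be the cocycles and coboundaries of the dual. The sequences
  \<open>0 \<rightarrow> I k \<rightarrow> Z k \<rightarrow> Ext k (H, A) \<rightarrow> 0\<close> and \<open>0 \<rightarrow> Z k \<rightarrow> F k* \<rightarrow> I (k + 1) \<rightarrow> 0\<close> give
  \<open>Ext k (I (k + 1), A) = 0\<close> for \<open>k \<ge> 1\<close> by downward induction from degrees where finite global
  dimension makes \<open>I (k + 1)\<close> projective. In degree 0 this says that every functional on \<open>F 0*\<close>, that is,
  every element of \<open>F 0\<close>, comes from \<open>F 1\<close>; so \<open>F 1 \<rightarrow> F 0\<close> is onto and \<open>H = 0\<close>
  (\<open>augmented_module_zero\<close>).

  Over a Noetherian ring all modules that occur have resolutions by free modules of finite rank,
  here lists of fixed length. For these, dualizing is transposing with respect to a bilinear pairing,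
  and the double dual is the original complex, with no canonical isomorphism to carry along.
  The vanishing of an Ext module is handled as a statement about functionals (\<open>ext_vanishes\<close>): every
  cocycle is a coboundary. Long exact sequences are replaced by mapping cones. The Ext modules of the
  statement, which are computed from arbitrary projective resolutions, enter only through
  \<open>comparison_cohomology\<close>.\<close>

section \<open>Modules, submodules and linear maps\<close>

lemma left_module_ring: "left_module R M \<Longrightarrow> ring R"
  and left_module_group: "left_module R M \<Longrightarrow> abelian_group M"
  by (auto simp: left_module_def)

lemma left_moduleI:
  assumes "ring R" "abelian_group M"
    and "\<And>a x. a \<in> carrier R \<Longrightarrow> x \<in> carrier M \<Longrightarrow> a \<odot>\<^bsub>M\<^esub> x \<in> carrier M"
    and "\<And>a b x. a \<in> carrier R \<Longrightarrow> b \<in> carrier R \<Longrightarrow> x \<in> carrier M \<Longrightarrow>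
      (a \<oplus>\<^bsub>R\<^esub> b) \<odot>\<^bsub>M\<^esub> x = a \<odot>\<^bsub>M\<^esub> x \<oplus>\<^bsub>M\<^esub> b \<odot>\<^bsub>M\<^esub> x"
    and "\<And>a x y. a \<in> carrier R \<Longrightarrow> x \<in> carrier M \<Longrightarrow> y \<in> carrier M \<Longrightarrow>
      a \<odot>\<^bsub>M\<^esub> (x \<oplus>\<^bsub>M\<^esub> y) = a \<odot>\<^bsub>M\<^esub> x \<oplus>\<^bsub>M\<^esub> a \<odot>\<^bsub>M\<^esub> y"
    and "\<And>a b x. a \<in> carrier R \<Longrightarrow> b \<in> carrier R \<Longrightarrow> x \<in> carrier M \<Longrightarrow>
      (a \<otimes>\<^bsub>R\<^esub> b) \<odot>\<^bsub>M\<^esub> x = a \<odot>\<^bsub>M\<^esub> (b \<odot>\<^bsub>M\<^esub> x)"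
    and "\<And>x. x \<in> carrier M \<Longrightarrow> \<one>\<^bsub>R\<^esub> \<odot>\<^bsub>M\<^esub> x = x"
  shows "left_module R M"
  by (intro left_module.intro left_module_axioms.intro assms)

lemma left_module_smult_zero:
  assumes "left_module R M"
  shows "x \<in> carrier M \<Longrightarrow> \<zero>\<^bsub>R\<^esub> \<odot>\<^bsub>M\<^esub> x = \<zero>\<^bsub>M\<^esub>"
    and "a \<in> carrier R \<Longrightarrow> a \<odot>\<^bsub>M\<^esub> \<zero>\<^bsub>M\<^esub> = \<zero>\<^bsub>M\<^esub>"
proof -
  interpret left_module R M by fact
  show "\<zero>\<^bsub>R\<^esub> \<odot>\<^bsub>M\<^esub> x = \<zero>\<^bsub>M\<^esub>" if "x \<in> carrier M"
    using smult_l_distr[of "\<zero>\<^bsub>R\<^esub>" "\<zero>\<^bsub>R\<^esub>" x] that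
    by (metis M.add.r_cancel_one' R.l_zero R.zero_closed smult_closed)
  show "a \<odot>\<^bsub>M\<^esub> \<zero>\<^bsub>M\<^esub> = \<zero>\<^bsub>M\<^esub>" if "a \<in> carrier R"
    using smult_r_distr[of a "\<zero>\<^bsub>M\<^esub>" "\<zero>\<^bsub>M\<^esub>"] that
    by (metis M.add.r_cancel_one' M.l_zero M.zero_closed smult_closed)
qed

lemma left_module_smult_minus:
  assumes "left_module R M" "x \<in> carrier M" "a \<in> carrier R"
  shows "a \<odot>\<^bsub>M\<^esub> (\<ominus>\<^bsub>M\<^esub> x) = \<ominus>\<^bsub>M\<^esub> (a \<odot>\<^bsub>M\<^esub> x)"
    and "(\<ominus>\<^bsub>R\<^esub> a) \<odot>\<^bsub>M\<^esub> x = \<ominus>\<^bsub>M\<^esub> (a \<odot>\<^bsub>M\<^esub> x)"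
proof -
  interpret left_module R M by fact
  have "a \<odot>\<^bsub>M\<^esub> (\<ominus>\<^bsub>M\<^esub> x) \<oplus>\<^bsub>M\<^esub> a \<odot>\<^bsub>M\<^esub> x = \<zero>\<^bsub>M\<^esub>"
    using assms left_module_smult_zero[OF assms(1)] by (simp flip: smult_r_distr add: M.l_neg)
  then show "a \<odot>\<^bsub>M\<^esub> (\<ominus>\<^bsub>M\<^esub> x) = \<ominus>\<^bsub>M\<^esub> (a \<odot>\<^bsub>M\<^esub> x)"
    using assms by (intro M.minus_equality[symmetric]) auto
  have "(\<ominus>\<^bsub>R\<^esub> a) \<odot>\<^bsub>M\<^esub> x \<oplus>\<^bsub>M\<^esub> a \<odot>\<^bsub>M\<^esub> x = \<zero>\<^bsub>M\<^esub>"
    using assms left_module_smult_zero[OF assms(1)] by (simp flip: smult_l_distr add: R.l_neg)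
  then show "(\<ominus>\<^bsub>R\<^esub> a) \<odot>\<^bsub>M\<^esub> x = \<ominus>\<^bsub>M\<^esub> (a \<odot>\<^bsub>M\<^esub> x)"
    using assms by (intro M.minus_equality[symmetric]) auto
qed

lemma left_module_submoduleI:
  assumes M: "left_module R M" and "H \<subseteq> carrier M" "\<zero>\<^bsub>M\<^esub> \<in> H"
    and "\<And>a b. a \<in> H \<Longrightarrow> b \<in> H \<Longrightarrow> a \<oplus>\<^bsub>M\<^esub> b \<in> H"
    and s: "\<And>a x. a \<in> carrier R \<Longrightarrow> x \<in> H \<Longrightarrow> a \<odot>\<^bsub>M\<^esub> x \<in> H"
  shows "submodule H R M"
proof -
  interpret left_module R M by fact
  have "\<ominus>\<^bsub>M\<^esub> x \<in> H" if "x \<in> H" for x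
    using s[of "\<ominus>\<^bsub>R\<^esub> \<one>\<^bsub>R\<^esub>" x] that assms(2) left_module_smult_minus(2)[OF M, of x "\<one>\<^bsub>R\<^esub>"] by auto
  then show ?thesis
    using assms by (intro submodule.intro subgroup.intro submodule_axioms.intro)
      (auto simp: a_inv_def)
qed

lemma submodule_abelian_subgroup:
  assumes "left_module R M" "submodule H R M"
  shows "abelian_subgroup H M"
  using assms by (intro abelian_subgroupI3 additive_subgroup.intro)
    (auto simp: submodule_def left_module_def)

lemma submoduleD:
  assumes "left_module R M" "submodule H R M"
  shows "H \<subseteq> carrier M" "\<zero>\<^bsub>M\<^esub> \<in> H"
    "x \<in> H \<Longrightarrow> y \<in> H \<Longrightarrow> x \<oplus>\<^bsub>M\<^esub> y \<in> H" "x \<in> H \<Longrightarrow> \<ominus>\<^bsub>M\<^esub> x \<in> H"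
    "x \<in> H \<Longrightarrow> y \<in> H \<Longrightarrow> x \<ominus>\<^bsub>M\<^esub> y \<in> H"
    "a \<in> carrier R \<Longrightarrow> x \<in> H \<Longrightarrow> a \<odot>\<^bsub>M\<^esub> x \<in> H"
proof -
  interpret abelian_subgroup H M by (rule submodule_abelian_subgroup[OF assms])
  show "H \<subseteq> carrier M" "\<zero>\<^bsub>M\<^esub> \<in> H"
    "x \<in> H \<Longrightarrow> y \<in> H \<Longrightarrow> x \<oplus>\<^bsub>M\<^esub> y \<in> H" "x \<in> H \<Longrightarrow> \<ominus>\<^bsub>M\<^esub> x \<in> H"
    "x \<in> H \<Longrightarrow> y \<in> H \<Longrightarrow> x \<ominus>\<^bsub>M\<^esub> y \<in> H"
    by (auto simp: minus_eq)
  show "a \<in> carrier R \<Longrightarrow> x \<in> H \<Longrightarrow> a \<odot>\<^bsub>M\<^esub> x \<in> H"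
    using submodule.smult_closed[OF assms(2)] .
qed

lemma submodule_carrier: "left_module R M \<Longrightarrow> submodule (carrier M) R M"
  by (rule left_module_submoduleI) (auto simp: left_module_def left_module_axioms_def
      abelian_group_def abelian_monoid.a_closed abelian_monoid.zero_closed)

text \<open>Subquotients and renamed copies are images of known modules under maps that respect the
  operations; this transports the axioms to them.\<close>

lemma left_module_image:
  assumes M: "left_module R M"
    and im: "p ` carrier M = carrier N"
    and ad: "\<And>x y. x \<in> carrier M \<Longrightarrow> y \<in> carrier M \<Longrightarrow> p (x \<oplus>\<^bsub>M\<^esub> y) = p x \<oplus>\<^bsub>N\<^esub> p y"
    and sm: "\<And>a x. a \<in> carrier R \<Longrightarrow> x \<in> carrier M \<Longrightarrow> p (a \<odot>\<^bsub>M\<^esub> x) = a \<odot>\<^bsub>N\<^esub> p x"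
    and ze: "p \<zero>\<^bsub>M\<^esub> = \<zero>\<^bsub>N\<^esub>"
  shows "left_module R N"
proof -
  interpret left_module R M by fact
  have ex: "\<exists>x\<in>carrier M. p x = y" if "y \<in> carrier N" for y
    using that unfolding im[symmetric] by blast
  have cl: "p x \<in> carrier N" if "x \<in> carrier M" for x using im that by blast
  have ab: "abelian_group N"
  proof (rule abelian_groupI)
    fix x y assume xy: "x \<in> carrier N" "y \<in> carrier N"
    then obtain u v where uv: "u \<in> carrier M" "v \<in> carrier M" "p u = x" "p v = y" using ex by metis
    show "x \<oplus>\<^bsub>N\<^esub> y \<in> carrier N" using uv ad cl by (metis M.a_closed)
    show "x \<oplus>\<^bsub>N\<^esub> y = y \<oplus>\<^bsub>N\<^esub> x" using uv ad by (metis M.a_comm)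
    fix z assume "z \<in> carrier N"
    then obtain w where w: "w \<in> carrier M" "p w = z" using ex by metis
    show "(x \<oplus>\<^bsub>N\<^esub> y) \<oplus>\<^bsub>N\<^esub> z = x \<oplus>\<^bsub>N\<^esub> (y \<oplus>\<^bsub>N\<^esub> z)"
      using uv w M.a_assoc[of u v w] by (auto simp flip: ad)
  next
    show "\<zero>\<^bsub>N\<^esub> \<in> carrier N" using ze cl by (metis M.zero_closed)
    fix x assume "x \<in> carrier N"
    then obtain u where u: "u \<in> carrier M" "p u = x" using ex by metis
    show "\<zero>\<^bsub>N\<^esub> \<oplus>\<^bsub>N\<^esub> x = x" using u ze ad by (metis M.l_zero M.zero_closed)
    show "\<exists>y\<in>carrier N. y \<oplus>\<^bsub>N\<^esub> x = \<zero>\<^bsub>N\<^esub>"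
      using u ze ad[of "\<ominus>\<^bsub>M\<^esub> u" u] by (metis M.a_inv_closed M.l_neg cl)
  qed
  show ?thesis
  proof (rule left_moduleI[OF left_module_ring[OF M] ab])
    fix a x assume a: "a \<in> carrier R" and "x \<in> carrier N"
    then obtain u where u: "u \<in> carrier M" "p u = x" using ex by metis
    show "a \<odot>\<^bsub>N\<^esub> x \<in> carrier N" using a u sm cl by (metis smult_closed)
    fix b assume b: "b \<in> carrier R"
    show "(a \<oplus>\<^bsub>R\<^esub> b) \<odot>\<^bsub>N\<^esub> x = a \<odot>\<^bsub>N\<^esub> x \<oplus>\<^bsub>N\<^esub> b \<odot>\<^bsub>N\<^esub> x"
      using a b u smult_l_distr[of a b u] by (auto simp flip: sm ad)
    show "(a \<otimes>\<^bsub>R\<^esub> b) \<odot>\<^bsub>N\<^esub> x = a \<odot>\<^bsub>N\<^esub> (b \<odot>\<^bsub>N\<^esub> x)"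
      using a b u smult_assoc1[of a b u] by (auto simp flip: sm)
  next
    fix a x y assume a: "a \<in> carrier R" and "x \<in> carrier N" "y \<in> carrier N"
    then obtain u v where u: "u \<in> carrier M" "p u = x" "v \<in> carrier M" "p v = y" using ex by metis
    show "a \<odot>\<^bsub>N\<^esub> (x \<oplus>\<^bsub>N\<^esub> y) = a \<odot>\<^bsub>N\<^esub> x \<oplus>\<^bsub>N\<^esub> a \<odot>\<^bsub>N\<^esub> y"
      using a u smult_r_distr[of a u v] by (auto simp flip: sm ad)
  next
    fix x assume "x \<in> carrier N"
    then obtain u where u: "u \<in> carrier M" "p u = x" using ex by metis
    show "\<one>\<^bsub>R\<^esub> \<odot>\<^bsub>N\<^esub> x = x" using u by (auto simp flip: sm)
  qed
qed

lemma left_module_restrict: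
  assumes M: "left_module R M" and H: "submodule H R M"
  shows "left_module R (M\<lparr>carrier := H\<rparr>)"
proof -
  interpret left_module R M by fact
  note D = submoduleD[OF M H]
  have ab: "abelian_group (M\<lparr>carrier := H\<rparr>)"
  proof (rule abelian_groupI)
    show "\<exists>y\<in>carrier (M\<lparr>carrier := H\<rparr>). y \<oplus>\<^bsub>M\<lparr>carrier := H\<rparr>\<^esub> x = \<zero>\<^bsub>M\<lparr>carrier := H\<rparr>\<^esub>"
      if "x \<in> carrier (M\<lparr>carrier := H\<rparr>)" for x
      using that D by (auto intro!: bexI[of _ "\<ominus>\<^bsub>M\<^esub> x"] simp: M.l_neg subset_iff)
  qed (use D in \<open>auto simp: M.a_ac subset_iff\<close>)
  show ?thesis
    by (rule left_moduleI[OF left_module_ring[OF M] ab])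
      (use D in \<open>auto simp: smult_l_distr smult_r_distr smult_assoc1 subset_iff\<close>)
qed

lemma linear_mapsI:
  assumes "\<And>x. x \<in> carrier M \<Longrightarrow> f x \<in> carrier N"
    and "\<And>x y. x \<in> carrier M \<Longrightarrow> y \<in> carrier M \<Longrightarrow> f (x \<oplus>\<^bsub>M\<^esub> y) = f x \<oplus>\<^bsub>N\<^esub> f y"
    and "\<And>a x. a \<in> carrier R \<Longrightarrow> x \<in> carrier M \<Longrightarrow> f (a \<odot>\<^bsub>M\<^esub> x) = a \<odot>\<^bsub>N\<^esub> f x"
  shows "f \<in> linear_maps R M N"
  using assms by (auto simp: linear_maps_def)

lemma linear_mapsD:
  assumes "f \<in> linear_maps R M N"
  shows "x \<in> carrier M \<Longrightarrow> f x \<in> carrier N"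
    and "x \<in> carrier M \<Longrightarrow> y \<in> carrier M \<Longrightarrow> f (x \<oplus>\<^bsub>M\<^esub> y) = f x \<oplus>\<^bsub>N\<^esub> f y"
    and "a \<in> carrier R \<Longrightarrow> x \<in> carrier M \<Longrightarrow> f (a \<odot>\<^bsub>M\<^esub> x) = a \<odot>\<^bsub>N\<^esub> f x"
  using assms by (auto simp: linear_maps_def)

lemma linear_maps_zero:
  assumes "left_module R M" "left_module R N" "f \<in> linear_maps R M N"
  shows "f \<zero>\<^bsub>M\<^esub> = \<zero>\<^bsub>N\<^esub>"
proof -
  interpret M: left_module R M by fact
  interpret N: left_module R N by fact
  show ?thesis
    using linear_mapsD(1,2)[OF assms(3), of "\<zero>\<^bsub>M\<^esub>"] linear_mapsD(2)[OF assms(3), of "\<zero>\<^bsub>M\<^esub>" "\<zero>\<^bsub>M\<^esub>"]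
    by (metis M.M.l_zero M.M.zero_closed N.M.add.r_cancel_one')
qed

lemma linear_maps_minus:
  assumes "left_module R M" "left_module R N" "f \<in> linear_maps R M N" "x \<in> carrier M"
  shows "f (\<ominus>\<^bsub>M\<^esub> x) = \<ominus>\<^bsub>N\<^esub> f x"
    and "y \<in> carrier M \<Longrightarrow> f (y \<ominus>\<^bsub>M\<^esub> x) = f y \<ominus>\<^bsub>N\<^esub> f x"
proof -
  interpret M: left_module R M by fact
  interpret N: left_module R N by fact
  note f = linear_mapsD[OF assms(3)]
  show 1: "f (\<ominus>\<^bsub>M\<^esub> x) = \<ominus>\<^bsub>N\<^esub> f x"
    using linear_maps_zero[OF assms(1-3)] f(1) assms(4)
    by (intro N.M.minus_equality[symmetric]) (auto simp flip: f(2) simp: M.M.l_neg)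
  show "f (y \<ominus>\<^bsub>M\<^esub> x) = f y \<ominus>\<^bsub>N\<^esub> f x" if "y \<in> carrier M"
    using that assms(4) 1 by (simp add: M.M.minus_eq N.M.minus_eq f(2))
qed

lemma linear_maps_comp:
  "f \<in> linear_maps R M N \<Longrightarrow> g \<in> linear_maps R N L \<Longrightarrow> (\<lambda>x. g (f x)) \<in> linear_maps R M L"
  by (simp add: linear_maps_def Pi_iff)

lemma linear_maps_ident: "(\<lambda>x. x) \<in> linear_maps R M M"
  by (auto simp: linear_maps_def)

lemma linear_maps_const_zero:
  assumes "left_module R N"
  shows "(\<lambda>x. \<zero>\<^bsub>N\<^esub>) \<in> linear_maps R M N"
proof -
  interpret left_module R N by fact
  show ?thesis by (intro linear_mapsI) (auto simp: left_module_smult_zero[OF assms])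
qed

lemma linear_maps_plus:
  assumes "left_module R N" "f \<in> linear_maps R M N" "g \<in> linear_maps R M N"
  shows "(\<lambda>x. f x \<oplus>\<^bsub>N\<^esub> g x) \<in> linear_maps R M N"
proof -
  interpret left_module R N by fact
  show ?thesis
    using linear_mapsD[OF assms(2)] linear_mapsD[OF assms(3)]
    by (intro linear_mapsI) (auto simp: smult_r_distr M.a_ac)
qed

lemma linear_maps_neg:
  assumes "left_module R N" "f \<in> linear_maps R M N"
  shows "(\<lambda>x. \<ominus>\<^bsub>N\<^esub> f x) \<in> linear_maps R M N"
proof -
  interpret left_module R N by fact
  show ?thesis
    using linear_mapsD[OF assms(2)]
    by (intro linear_mapsI) (auto simp: M.minus_add left_module_smult_minus(1)[OF assms(1)])
qed

lemma linear_maps_diff: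
  assumes "left_module R N" "f \<in> linear_maps R M N" "g \<in> linear_maps R M N"
  shows "(\<lambda>x. f x \<ominus>\<^bsub>N\<^esub> g x) \<in> linear_maps R M N"
proof -
  interpret left_module R N by fact
  show ?thesis
    using linear_maps_plus[OF assms(1,2) linear_maps_neg[OF assms(1,3)]] by (simp add: M.minus_eq)
qed

lemma submodule_image:
  assumes "left_module R M" "left_module R N" "f \<in> linear_maps R M N" "submodule H R M"
  shows "submodule (f ` H) R N"
proof -
  interpret M: left_module R M by fact
  note f = linear_mapsD[OF assms(3)] and D = submoduleD[OF assms(1,4)]
  show ?thesis
  proof (rule left_module_submoduleI[OF assms(2)])
    show "f ` H \<subseteq> carrier N" using f D by blast
    show "\<zero>\<^bsub>N\<^esub> \<in> f ` H" using linear_maps_zero[OF assms(1-3)] D(2) by (metis imageI)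
    show "a \<oplus>\<^bsub>N\<^esub> b \<in> f ` H" if "a \<in> f ` H" "b \<in> f ` H" for a b
      using that D by (auto simp: subset_iff simp flip: f(2))
    show "a \<odot>\<^bsub>N\<^esub> x \<in> f ` H" if "a \<in> carrier R" "x \<in> f ` H" for a x
      using that D by (auto simp: subset_iff simp flip: f(3))
  qed
qed

lemma submodule_vimage:
  assumes "left_module R M" "left_module R N" "f \<in> linear_maps R M N" "submodule H R N"
  shows "submodule {x \<in> carrier M. f x \<in> H} R M"
proof -
  interpret M: left_module R M by fact
  note f = linear_mapsD[OF assms(3)] and D = submoduleD[OF assms(2,4)]
  show ?thesis
    by (rule left_module_submoduleI[OF assms(1)])
      (use f D linear_maps_zero[OF assms(1-3)] in auto)
qed

lemma submodule_zero: "left_module R M \<Longrightarrow> submodule {\<zero>\<^bsub>M\<^esub>} R M"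
proof -
  assume M: "left_module R M"
  then interpret left_module R M .
  show ?thesis by (rule left_module_submoduleI[OF M]) (auto simp: left_module_smult_zero[OF M])
qed

lemma submodule_kernel:
  assumes "left_module R M" "left_module R N" "f \<in> linear_maps R M N"
  shows "submodule {x \<in> carrier M. f x = \<zero>\<^bsub>N\<^esub>} R M"
  using submodule_vimage[OF assms submodule_zero[OF assms(2)]] by simp

lemma opp_ring_simps [simp]:
  "carrier (opp_ring R) = carrier R" "zero (opp_ring R) = zero R" "one (opp_ring R) = one R"
  "add (opp_ring R) = add R" "mult (opp_ring R) x y = y \<otimes>\<^bsub>R\<^esub> x"
  by (auto simp: opp_ring_def)

lemma ring_opp_ring: assumes "ring R" shows "ring (opp_ring R)"
proof -
  interpret ring R by fact
  show ?thesis
  proof (rule ringI)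
    show "abelian_group (opp_ring R)"
      by (rule abelian_groupI) (auto simp: a_ac intro: l_neg)
    show "Group.monoid (opp_ring R)"
      by (rule monoidI) (auto simp: m_assoc)
  qed (auto simp: l_distr r_distr)
qed

lemma regular_module_simps [simp]:
  "carrier (regular_module R) = carrier R" "zero (regular_module R) = zero R"
  "add (regular_module R) = add R" "smult (regular_module R) = mult R"
  by (auto simp: regular_module_def)

abbreviation functionals ::
  "('a, 'r) ring_scheme \<Rightarrow> ('a, 'b, 'm) module_scheme \<Rightarrow> ('b \<Rightarrow> 'a) set" where
  "functionals R M \<equiv> linear_maps R M (regular_module R)"

lemma left_module_regular: assumes "ring R" shows "left_module R (regular_module R)"
proof -
  interpret ring R by fact
  have "abelian_group (regular_module R)"
    by (rule abelian_groupI) (auto simp: a_ac intro: l_neg)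
  then show ?thesis
    by (rule left_moduleI[OF assms]) (auto simp: l_distr r_distr m_assoc)
qed

lemma a_inv_regular_module [simp]: "a_inv (regular_module R) x = a_inv R x"
  by (simp add: a_inv_def m_inv_def regular_module_def)

lemma a_minus_regular_module [simp]: "a_minus (regular_module R) x y = a_minus R x y"
  by (simp add: a_minus_def)

section \<open>Subquotients\<close>

lemma coset_eq_iff:
  assumes "left_module R M" "submodule B R M" "x \<in> carrier M" "y \<in> carrier M"
  shows "B +>\<^bsub>M\<^esub> x = B +>\<^bsub>M\<^esub> y \<longleftrightarrow> x \<ominus>\<^bsub>M\<^esub> y \<in> B"
proof -
  interpret abelian_subgroup B M by (rule submodule_abelian_subgroup[OF assms(1,2)])
  have "B +>\<^bsub>M\<^esub> x = B +>\<^bsub>M\<^esub> y \<longleftrightarrow> x \<in> B +>\<^bsub>M\<^esub> y"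
    using assms a_repr_independence' a_repr_independenceD by metis
  then show ?thesis using a_rcos_module assms by (simp add: minus_eq)
qed

lemma coset_eq_self_iff:
  assumes "left_module R M" "submodule B R M" "x \<in> carrier M"
  shows "B +>\<^bsub>M\<^esub> x = B \<longleftrightarrow> x \<in> B"
proof -
  interpret abelian_subgroup B M by (rule submodule_abelian_subgroup[OF assms(1,2)])
  show ?thesis
    using a_rcos_const a_rcos_self assms(3) by metis
qed

lemma subquotient_simps:
  "carrier (subquotient M Z B) = (\<lambda>x. B +>\<^bsub>M\<^esub> x) ` Z"
  "zero (subquotient M Z B) = B"
  by (auto simp: subquotient_def A_RCOSETS_def' a_r_coset_def')

lemma subquotient_add:
  assumes "left_module R M" "submodule B R M" "x \<in> carrier M" "y \<in> carrier M"
  shows "(B +>\<^bsub>M\<^esub> x) \<oplus>\<^bsub>subquotient M Z B\<^esub> (B +>\<^bsub>M\<^esub> y) = B +>\<^bsub>M\<^esub> (x \<oplus>\<^bsub>M\<^esub> y)"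
proof -
  interpret abelian_subgroup B M by (rule submodule_abelian_subgroup[OF assms(1,2)])
  show ?thesis using a_rcos_sum assms by (simp add: subquotient_def)
qed

lemma subquotient_smult:
  assumes "left_module R M" "submodule B R M" "x \<in> carrier M" "a \<in> carrier R"
  shows "a \<odot>\<^bsub>subquotient M Z B\<^esub> (B +>\<^bsub>M\<^esub> x) = B +>\<^bsub>M\<^esub> (a \<odot>\<^bsub>M\<^esub> x)"
proof -
  interpret M: left_module R M by fact
  interpret abelian_subgroup B M by (rule submodule_abelian_subgroup[OF assms(1,2)])
  have self: "x \<in> B +>\<^bsub>M\<^esub> x" using a_rcos_self assms by auto
  have *: "B +>\<^bsub>M\<^esub> (a \<odot>\<^bsub>M\<^esub> y) = B +>\<^bsub>M\<^esub> (a \<odot>\<^bsub>M\<^esub> x)" if y: "y \<in> B +>\<^bsub>M\<^esub> x" for y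
  proof -
    have "y \<in> carrier M" using a_elemrcos_carrier that assms by blast
    moreover have "y \<oplus>\<^bsub>M\<^esub> \<ominus>\<^bsub>M\<^esub> x \<in> B" using a_rcos_module_imp y assms by auto
    ultimately have "a \<odot>\<^bsub>M\<^esub> y \<oplus>\<^bsub>M\<^esub> \<ominus>\<^bsub>M\<^esub> (a \<odot>\<^bsub>M\<^esub> x) \<in> B"
      using submoduleD(6)[OF assms(1,2,4)] assms
      by (metis M.smult_r_distr a_inv_closed left_module_smult_minus(1) M.M.a_inv_closed)
    then show ?thesis
      using coset_eq_iff[OF assms(1,2)] assms \<open>y \<in> carrier M\<close> by (simp add: M.M.minus_eq)
  qed
  then have "(\<Union>y\<in>B +>\<^bsub>M\<^esub> x. B +>\<^bsub>M\<^esub> (a \<odot>\<^bsub>M\<^esub> y)) = B +>\<^bsub>M\<^esub> (a \<odot>\<^bsub>M\<^esub> x)"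
    using self by (metis (no_types, lifting) SUP_eq_const empty_iff)
  then show ?thesis by (simp add: subquotient_def)
qed

lemma coset_of_zero:
  assumes "left_module R M" "submodule B R M"
  shows "B +>\<^bsub>M\<^esub> \<zero>\<^bsub>M\<^esub> = B"
  using coset_eq_self_iff[OF assms] submoduleD[OF assms] by blast

lemma left_module_subquotient:
  assumes "left_module R M" "submodule B R M" "submodule Z R M"
  shows "left_module R (subquotient M Z B)"
proof (rule left_module_image[OF left_module_restrict[OF assms(1,3)]])
  show "(\<lambda>x. B +>\<^bsub>M\<^esub> x) ` carrier (M\<lparr>carrier := Z\<rparr>) = carrier (subquotient M Z B)"
    by (simp add: subquotient_simps)
qed (use submoduleD[OF assms(1,3)] subquotient_add[OF assms(1,2)] subquotient_smult[OF assms(1,2)]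
    coset_of_zero[OF assms(1,2)]
     in \<open>auto simp: subset_iff subquotient_simps\<close>)

lemma coset_map_linear:
  assumes "left_module R M" "submodule B R M" "submodule Z R M"
  shows "(\<lambda>x. B +>\<^bsub>M\<^esub> x) \<in> linear_maps R (M\<lparr>carrier := Z\<rparr>) (subquotient M Z B)"
  using subquotient_add[OF assms(1,2)] subquotient_smult[OF assms(1,2)] submoduleD(1)[OF assms(1,3)]
  by (intro linear_mapsI) (auto simp: subquotient_simps subset_iff)

section \<open>Finitely generated free modules\<close>

definition free_module :: "('a, 'r) ring_scheme \<Rightarrow> nat \<Rightarrow> ('a, 'a list) module" where
  "free_module R n =
    \<lparr>carrier = {xs. length xs = n \<and> set xs \<subseteq> carrier R}, mult = (\<lambda>xs ys. []), one = [],
     zero = replicate n \<zero>\<^bsub>R\<^esub>, add = map2 (add R), smult = (\<lambda>a. map (mult R a))\<rparr>"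

abbreviation vectors :: "('a, 'r) ring_scheme \<Rightarrow> nat \<Rightarrow> 'a list set" where
  "vectors R n \<equiv> carrier (free_module R n)"

abbreviation free_maps :: "('a, 'r) ring_scheme \<Rightarrow> nat \<Rightarrow> nat \<Rightarrow> ('a list \<Rightarrow> 'a list) set" where
  "free_maps R m n \<equiv> linear_maps R (free_module R m) (free_module R n)"

lemma free_module_simps [simp]:
  "zero (free_module R n) = replicate n \<zero>\<^bsub>R\<^esub>" "add (free_module R n) = map2 (add R)"
  "smult (free_module R n) a = map (mult R a)"
  "vectors (opp_ring R) n = vectors R n"
  by (auto simp: free_module_def)

lemma free_module_carrier:
  "xs \<in> vectors R n \<longleftrightarrow> length xs = n \<and> set xs \<subseteq> carrier R"
  by (auto simp: free_module_def)

lemma free_module_carrier_nth: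
  "xs \<in> vectors R n \<longleftrightarrow> length xs = n \<and> (\<forall>i<n. xs ! i \<in> carrier R)"
  by (auto simp: free_module_carrier set_conv_nth subset_iff)

lemma free_module_carrier_Suc:
  "xs \<in> vectors R (Suc n) \<longleftrightarrow>
    (\<exists>y ys. xs = y # ys \<and> y \<in> carrier R \<and> ys \<in> vectors R n)"
  by (cases xs) (auto simp: free_module_carrier)

lemma free_module_carrier_0 [simp]: "vectors R 0 = {[]}"
  by (auto simp: free_module_carrier)

lemma left_module_free: assumes "ring R" shows "left_module R (free_module R n)"
proof -
  interpret ring R by fact
  have "abelian_group (free_module R n)"
  proof (rule abelian_groupI)
    show "\<exists>y\<in>vectors R n. y \<oplus>\<^bsub>free_module R n\<^esub> x = \<zero>\<^bsub>free_module R n\<^esub>"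
      if "x \<in> vectors R n" for x
      using that
      by (intro bexI[of _ "map (a_inv R) x"])
        (auto simp: free_module_carrier_nth l_neg intro!: nth_equalityI)
  qed (auto simp: free_module_carrier_nth a_ac intro!: nth_equalityI)
  then show ?thesis
    by (rule left_moduleI[OF assms])
      (auto simp: free_module_carrier_nth l_distr r_distr m_assoc in_set_conv_nth intro!: nth_equalityI)
qed

fun lincomb :: "('a, 'b, 'm) module_scheme \<Rightarrow> 'a list \<Rightarrow> 'b list \<Rightarrow> 'b" where
  "lincomb M (x # xs) (m # ms) = x \<odot>\<^bsub>M\<^esub> m \<oplus>\<^bsub>M\<^esub> lincomb M xs ms"
| "lincomb M _ _ = \<zero>\<^bsub>M\<^esub>"

lemma lincomb_mem:
  assumes "left_module R M" "submodule H R M" "set xs \<subseteq> carrier R" "set ms \<subseteq> H"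
  shows "lincomb M xs ms \<in> H"
  using assms(3,4)
  by (induction xs ms rule: list_induct2')
    (use submoduleD[OF assms(1,2)] in \<open>auto simp: subset_iff\<close>)

lemma lincomb_closed:
  assumes "left_module R M" "set xs \<subseteq> carrier R" "set ms \<subseteq> carrier M"
  shows "lincomb M xs ms \<in> carrier M"
  using lincomb_mem[OF assms(1) submodule_carrier] assms by auto

lemma lincomb_restrict: "lincomb (M\<lparr>carrier := H\<rparr>) xs ms = lincomb M xs ms"
  by (induction M xs ms rule: lincomb.induct) auto

lemma lincomb_add:
  assumes "left_module R M" "set ms \<subseteq> carrier M"
  shows "xs \<in> vectors R (length ms) \<Longrightarrow> ys \<in> vectors R (length ms) \<Longrightarrow>
    lincomb M (map2 (add R) xs ys) ms = lincomb M xs ms \<oplus>\<^bsub>M\<^esub> lincomb M ys ms"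
  using assms(2)
proof (induction ms arbitrary: xs ys)
  case Nil
  interpret left_module R M by fact
  show ?case using Nil by simp
next
  case (Cons m ms)
  interpret left_module R M by fact
  obtain x xs' y ys' where *: "xs = x # xs'" "ys = y # ys'" "x \<in> carrier R" "y \<in> carrier R"
    "xs' \<in> vectors R (length ms)" "ys' \<in> vectors R (length ms)"
    using Cons.prems by (auto simp: free_module_carrier_Suc)
  have "lincomb M xs' ms \<in> carrier M" "lincomb M ys' ms \<in> carrier M"
    using * Cons.prems lincomb_closed[OF assms(1)] by (auto simp: free_module_carrier)
  then show ?case using * Cons by (simp add: smult_l_distr M.a_ac)
qed

lemma lincomb_smult:
  assumes "left_module R M" "set ms \<subseteq> carrier M" "a \<in> carrier R"
  shows "xs \<in> vectors R (length ms) \<Longrightarrow>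
    lincomb M (map (mult R a) xs) ms = a \<odot>\<^bsub>M\<^esub> lincomb M xs ms"
  using assms(2)
proof (induction ms arbitrary: xs)
  case Nil
  then show ?case using left_module_smult_zero[OF assms(1)] assms(3) by simp
next
  case (Cons m ms)
  interpret left_module R M by fact
  obtain x xs' where *: "xs = x # xs'" "x \<in> carrier R" "xs' \<in> vectors R (length ms)"
    using Cons.prems by (auto simp: free_module_carrier_Suc)
  have "lincomb M xs' ms \<in> carrier M"
    using * Cons.prems lincomb_closed[OF assms(1)] by (auto simp: free_module_carrier)
  then show ?case using * Cons assms(3) by (simp add: smult_r_distr smult_assoc1)
qed

lemma lincomb_linear:
  assumes "left_module R M" "set ms \<subseteq> carrier M" "length ms = n"
  shows "(\<lambda>xs. lincomb M xs ms) \<in> linear_maps R (free_module R n) M"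
  using assms lincomb_closed[OF assms(1)]
  by (intro linear_mapsI) (auto simp: lincomb_add lincomb_smult free_module_carrier)

lemma map_lincomb:
  assumes "left_module R M" "left_module R N" "f \<in> linear_maps R M N"
  shows "set xs \<subseteq> carrier R \<Longrightarrow> set ms \<subseteq> carrier M \<Longrightarrow> f (lincomb M xs ms) = lincomb N xs (map f ms)"
proof (induction xs ms rule: list_induct2')
qed (use assms in \<open>auto simp: linear_maps_zero linear_mapsD lincomb_closed left_module.smult_closed\<close>)

lemma lincomb_append:
  assumes "left_module R M" "set xs \<subseteq> carrier R" "set ys \<subseteq> carrier R"
    "set ms \<subseteq> carrier M" "set ns \<subseteq> carrier M" "length xs = length ms"
  shows "lincomb M (xs @ ys) (ms @ ns) = lincomb M xs ms \<oplus>\<^bsub>M\<^esub> lincomb M ys ns"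
proof -
  interpret left_module R M by fact
  show ?thesis
    using assms(6,2,4)
    by (induction xs ms rule: list_induct2)
      (use lincomb_closed[OF assms(1)] assms(3,5) in \<open>auto simp: M.a_assoc\<close>)
qed

primrec unit_vectors :: "('a, 'r) ring_scheme \<Rightarrow> nat \<Rightarrow> 'a list list" where
  "unit_vectors R 0 = []"
| "unit_vectors R (Suc n) = (\<one>\<^bsub>R\<^esub> # replicate n \<zero>\<^bsub>R\<^esub>) # map ((#) \<zero>\<^bsub>R\<^esub>) (unit_vectors R n)"

lemma length_unit_vectors [simp]: "length (unit_vectors R n) = n"
  by (induction n) auto

lemma unit_vectors_carrier:
  assumes "ring R" shows "set (unit_vectors R n) \<subseteq> vectors R n"
proof -
  interpret ring R by fact
  show ?thesis by (induction n) (auto simp: free_module_carrier)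
qed

lemma Cons_zero_linear:
  assumes "ring R"
  shows "(#) \<zero>\<^bsub>R\<^esub> \<in> free_maps R n (Suc n)"
proof -
  interpret ring R by fact
  show ?thesis by (intro linear_mapsI) (auto simp: free_module_carrier)
qed

lemma lincomb_unit_vectors:
  assumes "ring R"
  shows "xs \<in> vectors R n \<Longrightarrow> lincomb (free_module R n) xs (unit_vectors R n) = xs"
proof (induction n arbitrary: xs)
  case (Suc n)
  interpret ring R by fact
  obtain y ys where *: "xs = y # ys" "y \<in> carrier R" "ys \<in> vectors R n"
    using Suc.prems by (auto simp: free_module_carrier_Suc)
  have "lincomb (free_module R (Suc n)) ys (map ((#) \<zero>\<^bsub>R\<^esub>) (unit_vectors R n)) = \<zero>\<^bsub>R\<^esub> # ys"
    using map_lincomb[OF left_module_free[OF assms] left_module_free[OF assms] Cons_zero_linear[OF assms, of n],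
        of ys "unit_vectors R n"]
      unit_vectors_carrier[OF assms, of n] * Suc.IH[OF *(3)] assms
    by (simp add: free_module_carrier)
  moreover have "map2 (add R) (replicate n \<zero>\<^bsub>R\<^esub>) ys = ys"
    using * by (auto simp: free_module_carrier_nth intro!: nth_equalityI)
  ultimately show ?case using * by simp
qed simp

lemma linear_map_free_eq:
  assumes "left_module R M" "f \<in> linear_maps R (free_module R n) M" "xs \<in> vectors R n"
  shows "f xs = lincomb M xs (map f (unit_vectors R n))"
proof -
  have R: "ring R" using left_module_ring[OF assms(1)] .
  have "f xs = f (lincomb (free_module R n) xs (unit_vectors R n))"
    using lincomb_unit_vectors[OF R assms(3)] by simp
  also have "\<dots> = lincomb M xs (map f (unit_vectors R n))"
    using assms unit_vectors_carrier[OF R]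
    by (intro map_lincomb[OF left_module_free[OF R] assms(1,2)]) (auto simp: free_module_carrier)
  finally show ?thesis .
qed

text \<open>Free modules are projective: choose preimages of the images of the unit vectors.\<close>

lemma free_module_lift:
  assumes "left_module R N" "left_module R L" "f \<in> linear_maps R (free_module R n) L"
    "g \<in> linear_maps R N L" "f ` vectors R n \<subseteq> g ` carrier N"
  shows "\<exists>h\<in>linear_maps R (free_module R n) N. \<forall>x\<in>vectors R n. g (h x) = f x"
proof -
  have R: "ring R" using left_module_ring[OF assms(1)] .
  have "\<forall>u\<in>set (unit_vectors R n). \<exists>y. y \<in> carrier N \<and> g y = f u"
    using assms(5) unit_vectors_carrier[OF R, of n] by (fastforce simp: image_iff subset_iff)
  then obtain c where c: "\<And>u. u \<in> set (unit_vectors R n) \<Longrightarrow> c u \<in> carrier N \<and> g (c u) = f u"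
    by metis
  define h where "h xs = lincomb N xs (map c (unit_vectors R n))" for xs
  have "h \<in> linear_maps R (free_module R n) N"
    unfolding h_def using c by (intro lincomb_linear[OF assms(1)]) auto
  moreover have "g (h x) = f x" if x: "x \<in> vectors R n" for x
  proof -
    have "g (h x) = lincomb L x (map g (map c (unit_vectors R n)))"
      unfolding h_def using x c by (intro map_lincomb[OF assms(1,2,4)]) (auto simp: free_module_carrier)
    also have "map g (map c (unit_vectors R n)) = map f (unit_vectors R n)" using c by auto
    finally show ?thesis using linear_map_free_eq[OF assms(2,3) x] by simp
  qed
  ultimately show ?thesis by blast
qed

section \<open>The pairing and transposed maps\<close>

text \<open>Over \<open>R\<close> the pairing is linear in its first argument, over \<open>opp_ring R\<close> in its second. It makes
  free left and free right modules of the same rank dual to each other.\<close>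

abbreviation pairing :: "('a, 'r) ring_scheme \<Rightarrow> 'a list \<Rightarrow> 'a list \<Rightarrow> 'a" where
  "pairing R \<equiv> lincomb (regular_module R)"

lemma pairing_opp: "pairing (opp_ring R) ys xs = pairing R xs ys"
  by (induction xs ys rule: list_induct2') simp_all

lemma pairing_linear:
  assumes "ring R" "v \<in> vectors R n"
  shows "(\<lambda>x. pairing R x v) \<in> functionals R (free_module R n)"
  using lincomb_linear[OF left_module_regular[OF assms(1)], of v n] assms(2)
  by (simp add: free_module_carrier)

lemma pairing_linear_right:
  assumes "ring R" "x \<in> vectors R n"
  shows "pairing R x \<in> functionals (opp_ring R) (free_module (opp_ring R) n)"
  using pairing_linear[OF ring_opp_ring[OF assms(1)], of x n] assms(2) by (simp add: pairing_opp)

lemma pairing_closed: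
  assumes "ring R" "x \<in> vectors R n" "v \<in> vectors R n"
  shows "pairing R x v \<in> carrier R"
  using linear_mapsD(1)[OF pairing_linear[OF assms(1,3)] assms(2)] by simp

lemma pairing_unit_vectors:
  assumes "ring R"
  shows "v \<in> vectors R n \<Longrightarrow> map (\<lambda>u. pairing R u v) (unit_vectors R n) = v"
proof (induction n arbitrary: v)
  case (Suc n)
  interpret ring R by fact
  obtain y ys where *: "v = y # ys" "y \<in> carrier R" "ys \<in> vectors R n"
    using Suc.prems by (auto simp: free_module_carrier_Suc)
  have "pairing R (replicate n \<zero>\<^bsub>R\<^esub>) ys = \<zero>\<^bsub>R\<^esub>"
    using linear_maps_zero[OF left_module_free[OF assms] left_module_regular[OF assms]
        pairing_linear[OF assms *(3)]] by simp
  moreover have "map (\<lambda>u. pairing R (\<zero>\<^bsub>R\<^esub> # u) v) (unit_vectors R n) = ys"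
  proof -
    have "map (\<lambda>u. pairing R (\<zero>\<^bsub>R\<^esub> # u) v) (unit_vectors R n) = map (\<lambda>u. pairing R u ys) (unit_vectors R n)"
      using pairing_closed[OF assms _ *(3)] unit_vectors_carrier[OF assms, of n] * by (auto simp: subset_iff)
    then show ?thesis using Suc.IH[OF *(3)] by simp
  qed
  ultimately show ?case using * by (simp add: comp_def)
qed simp

lemma pairing_nondegenerate:
  assumes "ring R" "v \<in> vectors R n" "w \<in> vectors R n"
    "\<And>x. x \<in> vectors R n \<Longrightarrow> pairing R x v = pairing R x w"
  shows "v = w"
proof -
  have "map (\<lambda>u. pairing R u v) (unit_vectors R n) = map (\<lambda>u. pairing R u w) (unit_vectors R n)"
    using assms(4) unit_vectors_carrier[OF assms(1), of n] by auto
  then show ?thesis using pairing_unit_vectors[OF assms(1)] assms(2,3) by metis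
qed

lemma functional_eq_pairing:
  assumes "ring R" "f \<in> functionals R (free_module R n)"
  obtains v where "v \<in> vectors R n"
    "\<And>x. x \<in> vectors R n \<Longrightarrow> f x = pairing R x v"
proof
  show "map f (unit_vectors R n) \<in> vectors R n"
    using linear_mapsD(1)[OF assms(2)] unit_vectors_carrier[OF assms(1), of n]
    by (auto simp: free_module_carrier)
qed (rule linear_map_free_eq[OF left_module_regular[OF assms(1)] assms(2)])

text \<open>The functional \<open>\<lambda>x. pairing R (f x) v\<close> on the source of \<open>f\<close>, written again as a vector; its
  entries are the values at the unit vectors.\<close>

definition transpose_map ::
  "('a, 'r) ring_scheme \<Rightarrow> nat \<Rightarrow> ('a list \<Rightarrow> 'a list) \<Rightarrow> 'a list \<Rightarrow> 'a list" where
  "transpose_map R m f v = map (\<lambda>u. pairing R (f u) v) (unit_vectors R m)"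

lemma transpose_map_carrier:
  assumes "ring R" "f \<in> free_maps R m n"
    "v \<in> vectors R n"
  shows "transpose_map R m f v \<in> vectors R m"
  using pairing_closed[OF assms(1) _ assms(3)] linear_mapsD(1)[OF assms(2)] unit_vectors_carrier[OF assms(1), of m]
  by (auto simp: transpose_map_def free_module_carrier subset_iff)

lemma transpose_map_adjoint:
  assumes "ring R" "f \<in> free_maps R m n"
    "v \<in> vectors R n" "x \<in> vectors R m"
  shows "pairing R x (transpose_map R m f v) = pairing R (f x) v"
  unfolding transpose_map_def
  using linear_map_free_eq[OF left_module_regular[OF assms(1)]
      linear_maps_comp[OF assms(2) pairing_linear[OF assms(1,3)]] assms(4)] by simp

lemma transpose_map_eqI:
  assumes "ring R" "f \<in> free_maps R m n"
    "v \<in> vectors R n" "w \<in> vectors R m"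
    "\<And>x. x \<in> vectors R m \<Longrightarrow> pairing R (f x) v = pairing R x w"
  shows "transpose_map R m f v = w"
  using assms by (intro pairing_nondegenerate[OF assms(1), of _ m])
    (auto simp: transpose_map_adjoint[OF assms(1,2)] intro!: transpose_map_carrier)

lemma transpose_map_linear:
  assumes "ring R" "f \<in> free_maps R m n"
  shows "transpose_map R m f \<in>
    free_maps (opp_ring R) n m"
proof (rule linear_mapsI)
  interpret Sn: left_module "opp_ring R" "free_module (opp_ring R) n" by (intro left_module_free ring_opp_ring assms)
  interpret Sm: left_module "opp_ring R" "free_module (opp_ring R) m" by (intro left_module_free ring_opp_ring assms)
  note tc = transpose_map_carrier[OF assms]
  show "transpose_map R m f v \<in> vectors (opp_ring R) m"
    if "v \<in> vectors (opp_ring R) n" for v using that tc by simp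
  show "transpose_map R m f (v \<oplus>\<^bsub>free_module (opp_ring R) n\<^esub> w) =
    transpose_map R m f v \<oplus>\<^bsub>free_module (opp_ring R) m\<^esub> transpose_map R m f w"
    if "v \<in> vectors (opp_ring R) n" "w \<in> vectors (opp_ring R) n" for v w
    using that linear_mapsD(1)[OF assms(2)] tc[of v] tc[of w] Sn.M.a_closed[of v w] Sm.M.a_closed
      linear_mapsD(2)[OF pairing_linear_right[OF assms(1), of _ n]]
      linear_mapsD(2)[OF pairing_linear_right[OF assms(1), of _ m]]
    by (intro transpose_map_eqI[OF assms]) (auto simp: transpose_map_adjoint[OF assms])
  show "transpose_map R m f (a \<odot>\<^bsub>free_module (opp_ring R) n\<^esub> v) =
    a \<odot>\<^bsub>free_module (opp_ring R) m\<^esub> transpose_map R m f v"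
    if "a \<in> carrier (opp_ring R)" "v \<in> vectors (opp_ring R) n" for a v
    using that linear_mapsD(1)[OF assms(2)] tc[of v] Sn.smult_closed[of a v] Sm.smult_closed[of a]
      linear_mapsD(3)[OF pairing_linear_right[OF assms(1), of _ n]]
      linear_mapsD(3)[OF pairing_linear_right[OF assms(1), of _ m]]
    by (intro transpose_map_eqI[OF assms]) (auto simp: transpose_map_adjoint[OF assms])
qed

section \<open>Finite generation over Noetherian rings\<close>

definition spans ::
  "('a, 'r) ring_scheme \<Rightarrow> ('a, 'b, 'm) module_scheme \<Rightarrow> 'b list \<Rightarrow> 'b set \<Rightarrow> bool" where
  "spans R M ms H \<longleftrightarrow> set ms \<subseteq> carrier M \<and>
    (\<lambda>xs. lincomb M xs ms) ` vectors R (length ms) = H"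

lemma in_span:
  assumes "left_module R M" "set ms \<subseteq> carrier M" "m \<in> set ms"
  shows "\<exists>xs\<in>vectors R (length ms). lincomb M xs ms = m"
  using assms(2,3)
proof (induction ms)
  case (Cons n ms)
  interpret left_module R M by fact
  have z: "lincomb M (replicate (length ms) \<zero>\<^bsub>R\<^esub>) ms = \<zero>\<^bsub>M\<^esub>"
    using linear_maps_zero[OF left_module_free assms(1) lincomb_linear[OF assms(1), of ms]]
      Cons.prems left_module_ring[OF assms(1)] by auto
  show ?case
  proof (cases "m = n")
    case True
    with z Cons.prems show ?thesis
      by (intro bexI[of _ "\<one>\<^bsub>R\<^esub> # replicate (length ms) \<zero>\<^bsub>R\<^esub>"]) (auto simp: free_module_carrier)
  next
    case False
    then obtain xs where xs: "xs \<in> vectors R (length ms)" "lincomb M xs ms = m"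
      using Cons by auto
    then have "lincomb M (\<zero>\<^bsub>R\<^esub> # xs) (n # ms) = m"
      using Cons.prems left_module_smult_zero[OF assms(1)] by (auto simp: subset_iff)
    with xs show ?thesis
      by (intro bexI[of _ "\<zero>\<^bsub>R\<^esub> # xs"]) (auto simp: free_module_carrier)
  qed
qed simp

lemma finitely_generated_iff_spans:
  assumes "left_module R M"
  shows "finitely_generated R M \<longleftrightarrow> (\<exists>ms. spans R M ms (carrier M))"
proof
  assume "finitely_generated R M"
  then obtain S where S: "finite S" "S \<subseteq> carrier M"
    "\<And>H. submodule H R M \<Longrightarrow> S \<subseteq> H \<Longrightarrow> H = carrier M"
    unfolding finitely_generated_def by blast
  obtain ms where ms: "set ms = S" using finite_list[OF S(1)] by blast
  have F: "left_module R (free_module R (length ms))"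
    by (rule left_module_free[OF left_module_ring[OF assms]])
  have "submodule ((\<lambda>xs. lincomb M xs ms) ` vectors R (length ms)) R M"
    using ms S(2) by (intro submodule_image[OF F assms lincomb_linear[OF assms]] submodule_carrier[OF F]) auto
  moreover have "S \<subseteq> (\<lambda>xs. lincomb M xs ms) ` vectors R (length ms)"
    using in_span[OF assms, of ms] ms S(2) by (auto simp: image_iff subset_iff)
  ultimately show "\<exists>ms. spans R M ms (carrier M)"
    using S(2,3) ms unfolding spans_def by metis
next
  assume "\<exists>ms. spans R M ms (carrier M)"
  then obtain ms where ms: "set ms \<subseteq> carrier M"
    "(\<lambda>xs. lincomb M xs ms) ` vectors R (length ms) = carrier M"
    by (auto simp: spans_def)
  have "H = carrier M" if "submodule H R M" "set ms \<subseteq> H" for H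
    using lincomb_mem[OF assms that(1) _ that(2)] submoduleD(1)[OF assms that(1)] ms(2)
    by (force simp: free_module_carrier)
  then show "finitely_generated R M" using ms(1) unfolding finitely_generated_def by blast
qed

lemma finitely_generated_free_image:
  assumes "left_module R M" "e \<in> linear_maps R (free_module R n) M"
    "e ` vectors R n = carrier M"
  shows "finitely_generated R M"
proof -
  have R: "ring R" using left_module_ring[OF assms(1)] .
  have "set (map e (unit_vectors R n)) \<subseteq> carrier M"
    using linear_mapsD(1)[OF assms(2)] unit_vectors_carrier[OF R, of n] by auto
  moreover have "(\<lambda>xs. lincomb M xs (map e (unit_vectors R n))) ` vectors R n = carrier M"
    using assms(3) linear_map_free_eq[OF assms(1,2)] by auto
  ultimately show ?thesis
    using finitely_generated_iff_spans[OF assms(1)] unfolding spans_def by fastforce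
qed

lemma hd_linear:
  "hd \<in> functionals R (free_module R (Suc n))"
  by (intro linear_mapsI) (auto simp: free_module_carrier_Suc)

text \<open>Induction on the rank: the leading entries form a left ideal, and the elements with leading
  entry zero form a submodule of a free module of smaller rank.\<close>

lemma noetherian_free_submodule:
  assumes "left_noetherian R"
  shows "submodule I R (free_module R n) \<Longrightarrow> \<exists>ms. spans R (free_module R n) ms I"
proof (induction n arbitrary: I)
  case 0
  have R: "ring R" using assms by (simp add: left_noetherian_def)
  have "I = {[]}"
    using submoduleD(1,2)[OF left_module_free[OF R] 0] by auto
  then show ?case by (intro exI[of _ "[]"]) (auto simp: spans_def)
next
  case (Suc n)
  have R: "ring R" using assms by (simp add: left_noetherian_def)
  interpret ring R by fact
  let ?F = "free_module R (Suc n)"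
  interpret F: left_module R ?F by (rule left_module_free[OF R])
  note FL = F.left_module_axioms and RL = left_module_regular[OF R]
  note I = submoduleD[OF FL Suc.prems]
  have J: "submodule (hd ` I) R (regular_module R)"
    by (rule submodule_image[OF FL RL hd_linear Suc.prems])
  then have "finitely_generated R ((regular_module R)\<lparr>carrier := hd ` I\<rparr>)"
    using assms by (auto simp: left_noetherian_def)
  then obtain js where js: "set js \<subseteq> hd ` I"
    "(\<lambda>xs. pairing R xs js) ` vectors R (length js) = hd ` I"
    using finitely_generated_iff_spans[OF left_module_restrict[OF RL J]]
    by (auto simp: spans_def lincomb_restrict)
  have "\<forall>j\<in>set js. \<exists>h. h \<in> I \<and> hd h = j" using js(1) by force
  then obtain c where c: "\<And>j. j \<in> set js \<Longrightarrow> c j \<in> I \<and> hd (c j) = j" by metis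
  define hs where "hs = map c js"
  have hs: "set hs \<subseteq> I" "map hd hs = js" unfolding hs_def using c by (auto intro: map_idI)
  have "submodule {xs \<in> vectors R n. \<zero>\<^bsub>R\<^esub> # xs \<in> I} R (free_module R n)"
    by (rule submodule_vimage[OF left_module_free[OF R] FL Cons_zero_linear[OF R] Suc.prems])
  then obtain ts where ts: "set ts \<subseteq> vectors R n"
    "(\<lambda>xs. lincomb (free_module R n) xs ts) ` vectors R (length ts) =
      {xs \<in> vectors R n. \<zero>\<^bsub>R\<^esub> # xs \<in> I}"
    using Suc.IH unfolding spans_def by blast
  have tsI: "\<zero>\<^bsub>R\<^esub> # t \<in> I" if "t \<in> set ts" for t
    using in_span[OF left_module_free[OF R] ts(1) that] ts(2) by auto
  let ?ms = "hs @ map ((#) \<zero>\<^bsub>R\<^esub>) ts"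
  have ms: "set ?ms \<subseteq> I" using hs(1) tsI by auto
  have "I \<subseteq> (\<lambda>xs. lincomb ?F xs ?ms) ` vectors R (length ?ms)"
  proof
    fix x assume x: "x \<in> I"
    then obtain xs where xs: "xs \<in> vectors R (length js)" "hd x = pairing R xs js"
      using js(2) by (metis (no_types, lifting) imageE imageI)
    define y where "y = lincomb ?F xs hs"
    have yI: "y \<in> I" unfolding y_def
      using xs hs by (intro lincomb_mem[OF FL Suc.prems]) (auto simp: free_module_carrier)
    have xF: "x \<in> carrier ?F" and yF: "y \<in> carrier ?F" using x yI I(1) by auto
    have hdy: "hd y = hd x" unfolding y_def
      using map_lincomb[OF FL RL hd_linear, of xs hs] xs hs I(1) by (auto simp: free_module_carrier)
    have diff: "x \<ominus>\<^bsub>?F\<^esub> y \<in> I" using I(5) x yI .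
    have "hd (x \<ominus>\<^bsub>?F\<^esub> y) = hd x \<ominus>\<^bsub>R\<^esub> hd y"
      using linear_maps_minus(2)[OF FL RL hd_linear yF xF] by simp
    also have "\<dots> = \<zero>\<^bsub>R\<^esub>" using hdy linear_mapsD(1)[OF hd_linear xF] by (simp add: r_neg minus_eq)
    finally obtain z where z: "x \<ominus>\<^bsub>?F\<^esub> y = \<zero>\<^bsub>R\<^esub> # z" "z \<in> vectors R n"
      using diff I(1) by (force simp: free_module_carrier_Suc)
    then obtain zs where zs: "zs \<in> vectors R (length ts)" "z = lincomb (free_module R n) zs ts"
      using ts(2) diff by auto
    have tz: "lincomb ?F zs (map ((#) \<zero>\<^bsub>R\<^esub>) ts) = \<zero>\<^bsub>R\<^esub> # z"
      using map_lincomb[OF left_module_free[OF R] FL Cons_zero_linear[OF R], of zs ts] zs ts(1)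
      by (simp add: free_module_carrier)
    have hsF: "set hs \<subseteq> carrier ?F" and tsF: "set (map ((#) \<zero>\<^bsub>R\<^esub>) ts) \<subseteq> carrier ?F"
      using I(1) ms by auto
    have "lincomb ?F (xs @ zs) ?ms = y \<oplus>\<^bsub>?F\<^esub> lincomb ?F zs (map ((#) \<zero>\<^bsub>R\<^esub>) ts)"
      unfolding y_def using xs(1) zs(1) hs(2)
      by (intro lincomb_append[OF FL _ _ hsF tsF]) (auto simp: free_module_carrier)
    also have "\<dots> = y \<oplus>\<^bsub>?F\<^esub> (x \<ominus>\<^bsub>?F\<^esub> y)" by (simp only: z(1) tz)
    also have "\<dots> = x"
      using xF yF by (simp add: F.M.minus_eq F.M.a_ac F.M.r_neg F.M.r_neg1 F.M.r_neg2 del: free_module_simps)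
    finally show "x \<in> (\<lambda>xs. lincomb ?F xs ?ms) ` vectors R (length ?ms)"
      using xs zs hs by (intro image_eqI[of _ _ "xs @ zs"]) (auto simp: free_module_carrier)
  qed
  moreover have "(\<lambda>xs. lincomb ?F xs ?ms) ` vectors R (length ?ms) \<subseteq> I"
    using lincomb_mem[OF FL Suc.prems _ ms] by (auto simp: free_module_carrier)
  ultimately have "(\<lambda>xs. lincomb ?F xs ?ms) ` vectors R (length ?ms) = I" by blast
  moreover have "set ?ms \<subseteq> carrier ?F" using ms I(1) by (rule subset_trans)
  ultimately show ?case unfolding spans_def by blast
qed

lemma noetherian_cover:
  assumes "left_noetherian R" "submodule I R (free_module R n)"
  obtains r f where "f \<in> free_maps R r n"
    "f ` vectors R r = I"
proof -
  have R: "ring R" using assms by (simp add: left_noetherian_def)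
  obtain ms where "spans R (free_module R n) ms I" using noetherian_free_submodule[OF assms] by blast
  then show ?thesis
    using that[OF lincomb_linear[OF left_module_free[OF R] _ refl]] unfolding spans_def by blast
qed

section \<open>Exact complexes and free resolutions\<close>

definition exact_complex ::
  "('a, 'r) ring_scheme \<Rightarrow> (nat \<Rightarrow> ('a, 'p, 'n) module_scheme) \<Rightarrow> (nat \<Rightarrow> 'p \<Rightarrow> 'p) \<Rightarrow> bool" where
  "exact_complex R P d \<longleftrightarrow> (\<forall>k. left_module R (P k)) \<and>
    (\<forall>k. d k \<in> linear_maps R (P (Suc k)) (P k)) \<and>
    (\<forall>k. d (Suc k) ` carrier (P (Suc (Suc k))) = {x \<in> carrier (P (Suc k)). d k x = \<zero>\<^bsub>P k\<^esub>})"

text \<open>What \<open>P\<close> resolves is the submodule \<open>e ` carrier (P 0)\<close> of \<open>M\<close>. Submodules are resolved below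
  without leaving the ambient module.\<close>

definition resolves ::
  "('a, 'r) ring_scheme \<Rightarrow> (nat \<Rightarrow> ('a, 'p, 'n) module_scheme) \<Rightarrow> (nat \<Rightarrow> 'p \<Rightarrow> 'p) \<Rightarrow>
   ('a, 'b, 'm) module_scheme \<Rightarrow> ('p \<Rightarrow> 'b) \<Rightarrow> bool" where
  "resolves R P d M e \<longleftrightarrow> exact_complex R P d \<and> left_module R M \<and> e \<in> linear_maps R (P 0) M \<and>
    d 0 ` carrier (P (Suc 0)) = {x \<in> carrier (P 0). e x = \<zero>\<^bsub>M\<^esub>}"

abbreviation free_sequence :: "('a, 'r) ring_scheme \<Rightarrow> (nat \<Rightarrow> nat) \<Rightarrow> nat \<Rightarrow> ('a, 'a list) module" where
  "free_sequence R n \<equiv> \<lambda>k. free_module R (n k)"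

abbreviation "free_exact_complex R n \<equiv> exact_complex R (free_sequence R n)"

abbreviation "free_resolves R n \<equiv> resolves R (free_sequence R n)"

lemma exact_complexD:
  assumes "exact_complex R P d"
  shows "left_module R (P k)" "d k \<in> linear_maps R (P (Suc k)) (P k)"
    "d (Suc k) ` carrier (P (Suc (Suc k))) = {x \<in> carrier (P (Suc k)). d k x = \<zero>\<^bsub>P k\<^esub>}"
    "x \<in> carrier (P (Suc (Suc k))) \<Longrightarrow> d k (d (Suc k) x) = \<zero>\<^bsub>P k\<^esub>"
proof -
  show 1: "left_module R (P k)" "d k \<in> linear_maps R (P (Suc k)) (P k)" for k
    using assms unfolding exact_complex_def by auto
  show 2: "d (Suc k) ` carrier (P (Suc (Suc k))) = {x \<in> carrier (P (Suc k)). d k x = \<zero>\<^bsub>P k\<^esub>}"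
    using assms unfolding exact_complex_def by (elim conjE) (rule spec)
  show "d k (d (Suc k) x) = \<zero>\<^bsub>P k\<^esub>" if "x \<in> carrier (P (Suc (Suc k)))"
    using imageI[OF that, of "d (Suc k)"] unfolding 2 by simp
qed

lemma resolvesD:
  assumes "resolves R P d M e"
  shows "exact_complex R P d" "left_module R M" "e \<in> linear_maps R (P 0) M"
    "d 0 ` carrier (P (Suc 0)) = {x \<in> carrier (P 0). e x = \<zero>\<^bsub>M\<^esub>}"
    "x \<in> carrier (P (Suc 0)) \<Longrightarrow> e (d 0 x) = \<zero>\<^bsub>M\<^esub>"
proof -
  show "exact_complex R P d" "left_module R M" "e \<in> linear_maps R (P 0) M"
    using assms unfolding resolves_def by auto
  show 2: "d 0 ` carrier (P (Suc 0)) = {x \<in> carrier (P 0). e x = \<zero>\<^bsub>M\<^esub>}"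
    using assms unfolding resolves_def by (elim conjE)
  show "e (d 0 x) = \<zero>\<^bsub>M\<^esub>" if "x \<in> carrier (P (Suc 0))"
    using imageI[OF that, of "d 0"] unfolding 2 by simp
qed

lemma free_resolution_exists:
  assumes R: "left_noetherian R" and M: "left_module R M" and e: "e \<in> linear_maps R (free_module R r) M"
  obtains n d where "n 0 = r" "free_resolves R n d M e"
proof -
  have rR: "ring R" using R by (simp add: left_noetherian_def)
  note L = left_module_free[OF rR]
  define start where "start k x \<longleftrightarrow>
    snd (snd x) \<in> free_maps R (fst x) (fst (snd x)) \<and>
    (k = 0 \<longrightarrow> fst (snd x) = r \<and>
      snd (snd x) ` vectors R (fst x) = {x \<in> vectors R r. e x = \<zero>\<^bsub>M\<^esub>})"
    for k :: nat and x :: "nat \<times> nat \<times> ('a list \<Rightarrow> 'a list)"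
  define link where "link x y \<longleftrightarrow> fst (snd y) = fst x \<and>
      snd (snd y) ` vectors R (fst y) =
        {z \<in> vectors R (fst x). snd (snd x) z = \<zero>\<^bsub>free_module R (fst (snd x))\<^esub>}"
    for x y :: "nat \<times> nat \<times> ('a list \<Rightarrow> 'a list)"
  have "\<exists>p. \<forall>k. start k (p k) \<and> link (p k) (p (Suc k))"
  proof (rule dependent_nat_choice)
    obtain a f where "f \<in> free_maps R a r"
      "f ` vectors R a = {x \<in> vectors R r. e x = \<zero>\<^bsub>M\<^esub>}"
      by (rule noetherian_cover[OF R submodule_kernel[OF L M e]])
    then have "start 0 (a, r, f)" by (simp add: start_def)
    then show "\<exists>x. start 0 x" by blast
  next
    fix x k
    assume "start k x"
    then obtain a b f where x: "x = (a, b, f)" "f \<in> free_maps R a b"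
      by (cases x) (auto simp: start_def)
    obtain c g where "g \<in> free_maps R c a"
      "g ` vectors R c = {x \<in> vectors R a. f x = \<zero>\<^bsub>free_module R b\<^esub>}"
      by (rule noetherian_cover[OF R submodule_kernel[OF L L x(2)]])
    then have "start (Suc k) (c, a, g) \<and> link x (c, a, g)" using x(1) by (simp add: start_def link_def)
    then show "\<exists>y. start (Suc k) y \<and> link x y" by blast
  qed
  then obtain p where p: "\<And>k. start k (p k)" "\<And>k. link (p k) (p (Suc k))" by blast
  define n where "n k = fst (snd (p k))" for k
  define d where "d k = snd (snd (p k))" for k
  have p_eq: "p k = (n (Suc k), n k, d k)" for k
    using p(2)[of k] by (auto simp: link_def n_def d_def case_prod_unfold prod_eq_iff)
  have "free_exact_complex R n d"
    unfolding exact_complex_def using p L by (auto simp: p_eq start_def link_def simp del: free_module_simps)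
  moreover have n0: "n 0 = r" and
    "d 0 ` vectors R (n (Suc 0)) = {x \<in> vectors R r. e x = \<zero>\<^bsub>M\<^esub>}"
    using p(1)[of 0] by (auto simp: p_eq start_def)
  ultimately have "free_resolves R n d M e"
    unfolding resolves_def using M e by simp
  with n0 show ?thesis by (rule that)
qed

lemma free_resolution_submodule:
  assumes R: "left_noetherian R" and M: "left_module R M" and Z: "submodule Z R M"
    and e: "e \<in> linear_maps R (free_module R r) M" "Z \<subseteq> e ` vectors R r"
  obtains n d e' where "free_resolves R n d M e'" "e' ` vectors R (n 0) = Z"
proof -
  have rR: "ring R" using R by (simp add: left_noetherian_def)
  note L = left_module_free[OF rR]
  obtain s f where f: "f \<in> free_maps R s r"
    "f ` vectors R s = {x \<in> vectors R r. e x \<in> Z}"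
    by (rule noetherian_cover[OF R submodule_vimage[OF L M e(1) Z]])
  have "(\<lambda>x. e (f x)) ` vectors R s = e ` (f ` vectors R s)"
    by (simp only: image_image)
  also have "\<dots> = Z" unfolding f(2) using e(2) by auto
  finally have im: "(\<lambda>x. e (f x)) ` vectors R s = Z" .
  obtain n d where nd: "n 0 = s" "free_resolves R n d M (\<lambda>x. e (f x))"
    by (rule free_resolution_exists[OF R M linear_maps_comp[OF f(1) e(1)]])
  have im': "(\<lambda>x. e (f x)) ` vectors R (n 0) = Z" unfolding nd(1) by (rule im)
  show ?thesis by (rule that[of n d "\<lambda>x. e (f x)", OF nd(2) im'])
qed

lemma finitely_generated_cover:
  assumes "left_module R M" "finitely_generated R M"
  obtains r e where "e \<in> linear_maps R (free_module R r) M" "e ` vectors R r = carrier M"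
proof -
  from assms(2) have "\<exists>ms. spans R M ms (carrier M)"
    by (rule iffD1[OF finitely_generated_iff_spans[OF assms(1)]])
  then obtain ms where ms: "set ms \<subseteq> carrier M"
    "(\<lambda>xs. lincomb M xs ms) ` vectors R (length ms) = carrier M"
    unfolding spans_def by (elim exE conjE)
  show ?thesis
    by (rule that[OF lincomb_linear[OF assms(1) ms(1) refl] ms(2)])
qed

section \<open>Lifting along surjections\<close>

text \<open>Lifting is demanded of every \<open>f\<close> with values in the image of \<open>g\<close>. In this form it applies to a
  differential and the kernel of the next one, without making the kernel a module of its own.\<close>

definition lifts ::
  "('a, 'r) ring_scheme \<Rightarrow> ('a, 'p, 'x) module_scheme \<Rightarrow> ('a, 'b, 'm) module_scheme \<Rightarrow>
   ('a, 'c, 'n) module_scheme \<Rightarrow> bool" where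
  "lifts R P N L \<longleftrightarrow> (\<forall>f\<in>linear_maps R P L. \<forall>g\<in>linear_maps R N L.
     f ` carrier P \<subseteq> g ` carrier N \<longrightarrow> (\<exists>h\<in>linear_maps R P N. \<forall>x\<in>carrier P. g (h x) = f x))"

lemma lifts_free_module:
  "left_module R N \<Longrightarrow> left_module R L \<Longrightarrow> lifts R (free_module R n) N L"
  unfolding lifts_def by (intro ballI impI free_module_lift)

text \<open>\<open>M\<close> with its elements renamed along an injection \<open>i\<close>.\<close>

definition copy_module :: "('b \<Rightarrow> 'c) \<Rightarrow> ('a, 'b, 'm) module_scheme \<Rightarrow> ('a, 'c) module" where
  "copy_module i M = \<lparr>carrier = i ` carrier M, mult = (\<lambda>x y. i \<zero>\<^bsub>M\<^esub>), one = i \<zero>\<^bsub>M\<^esub>, zero = i \<zero>\<^bsub>M\<^esub>,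
     add = (\<lambda>x y. i (inv_into (carrier M) i x \<oplus>\<^bsub>M\<^esub> inv_into (carrier M) i y)),
     smult = (\<lambda>a x. i (a \<odot>\<^bsub>M\<^esub> inv_into (carrier M) i x))\<rparr>"

lemma copy_module_simps [simp]:
  "carrier (copy_module i M) = i ` carrier M" "zero (copy_module i M) = i \<zero>\<^bsub>M\<^esub>"
  by (auto simp: copy_module_def)

lemma copy_module_maps:
  assumes "left_module R M" "inj_on i (carrier M)"
  shows "i \<in> linear_maps R M (copy_module i M)"
    and "inv_into (carrier M) i \<in> linear_maps R (copy_module i M) M"
    and "left_module R (copy_module i M)"
proof -
  interpret left_module R M by fact
  show 1: "i \<in> linear_maps R M (copy_module i M)"
    using assms(2) by (auto simp: linear_maps_def copy_module_def)
  show "inv_into (carrier M) i \<in> linear_maps R (copy_module i M) M"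
    using assms(2) by (intro linear_mapsI) (auto simp: copy_module_def)
  show "left_module R (copy_module i M)"
    using linear_mapsD[OF 1] by (intro left_module_image[OF assms(1), of i]) auto
qed

text \<open>Projectivity is tested on modules carried by one particular type. Copying \<open>N\<close>, and the image
  of \<open>g\<close> by way of representatives in \<open>N\<close>, into that type extends lifting to every module \<open>N\<close> whose
  carrier embeds there.\<close>

lemma lifts_projective:
  fixes P :: "('a, 'p, 'x) module_scheme" and i :: "'b \<Rightarrow> ('a + 'p) list"
  assumes P: "projective_module R P" and N: "left_module R N" and L: "left_module R L"
    and i: "inj_on i (carrier N)"
  shows "lifts R P N L"
  unfolding lifts_def
proof (intro ballI impI)
  fix f g assume f: "f \<in> linear_maps R P L" and g: "g \<in> linear_maps R N L"
    and fg: "f ` carrier P \<subseteq> g ` carrier N"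
  define L' where "L' = L\<lparr>carrier := g ` carrier N\<rparr>"
  have L': "left_module R L'" unfolding L'_def
    by (intro left_module_restrict[OF L] submodule_image[OF N L g] submodule_carrier N)
  have f': "f \<in> linear_maps R P L'" and g': "g \<in> linear_maps R N L'"
    using f g fg by (auto simp: linear_maps_def L'_def)
  define k where "k = (\<lambda>y. i (inv_into (carrier N) g y))"
  have "inj_on k (carrier L')"
    unfolding k_def L'_def by (auto intro!: inj_onI dest!: inj_onD[OF i] simp: inv_into_into)
      (metis f_inv_into_f imageI)
  note N' = copy_module_maps[OF N i] and L'' = copy_module_maps[OF L' this]
  have surj: "(\<lambda>x. k (g (inv_into (carrier N) i x))) ` carrier (copy_module i N) = carrier (copy_module k L')"
    using i by (auto simp: L'_def image_image)
  have test: "\<exists>h\<in>linear_maps R P N'. \<forall>x\<in>carrier P. g' (h x) = f' x"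
    if "left_module R N'" "left_module R L'" "f' \<in> linear_maps R P L'" "g' \<in> linear_maps R N' L'"
      "g' ` carrier N' = carrier L'"
    for N' :: "('a, ('a + 'p) list) module" and L' :: "('a, ('a + 'p) list) module" and f' g'
    using P that unfolding projective_module_def by blast
  have "\<exists>h\<in>linear_maps R P (copy_module i N).
      \<forall>x\<in>carrier P. k (g (inv_into (carrier N) i (h x))) = k (f x)"
    by (intro test[OF N'(3) L''(3) linear_maps_comp[OF f' L''(1)]
        linear_maps_comp[OF linear_maps_comp[OF N'(2) g'] L''(1)] surj])
  then obtain h where h: "h \<in> linear_maps R P (copy_module i N)"
    "\<And>x. x \<in> carrier P \<Longrightarrow> k (g (inv_into (carrier N) i (h x))) = k (f x)" by blast
  have "g (inv_into (carrier N) i (h x)) = f x" if "x \<in> carrier P" for x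
    using inj_onD[OF \<open>inj_on k (carrier L')\<close> h(2)[OF that]] linear_mapsD(1)[OF f' that]
      linear_mapsD(1)[OF g' linear_mapsD(1)[OF N'(2) linear_mapsD(1)[OF h(1) that]]] by blast
  then show "\<exists>h\<in>linear_maps R P N. \<forall>x\<in>carrier P. g (h x) = f x"
    using linear_maps_comp[OF h(1) N'(2)] by (intro bexI) auto
qed

lemma projective_copy_free:
  fixes R :: "('a, 'r) ring_scheme" and i :: "'a list \<Rightarrow> 'b"
  assumes "ring R" "inj_on i (vectors R n)"
  shows "projective_module R (copy_module i (free_module R n))"
proof -
  note C = copy_module_maps[OF left_module_free[OF assms(1)] assms(2)]
  let ?F = "free_module R n" and ?j = "inv_into (vectors R n) i"
  have "\<exists>h\<in>linear_maps R (copy_module i ?F) N. \<forall>x\<in>carrier (copy_module i ?F). g (h x) = f x"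
    if N: "left_module R N" and L: "left_module R L" and f: "f \<in> linear_maps R (copy_module i ?F) L"
      and g: "g \<in> linear_maps R N L" "g ` carrier N = carrier L"
    for N :: "('a, ('a + 'b) list) module" and L :: "('a, ('a + 'b) list) module" and f g
  proof -
    have sub: "(\<lambda>x. f (i x)) ` carrier ?F \<subseteq> g ` carrier N"
      using g(2) linear_mapsD(1)[OF linear_maps_comp[OF C(1) f]] by auto
    obtain h where h: "h \<in> linear_maps R ?F N" "\<And>x. x \<in> carrier ?F \<Longrightarrow> g (h x) = f (i x)"
      using free_module_lift[OF N L linear_maps_comp[OF C(1) f] g(1) sub] by blast
    then show ?thesis
      using linear_maps_comp[OF C(2) h(1)] assms(2) by (intro bexI[of _ "\<lambda>x. h (?j x)"]) auto
  qed
  then show ?thesis unfolding projective_module_def using C(3) by auto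
qed

section \<open>Cocycles and the cohomology of the dual complex\<close>

definition cocycle ::
  "('a, 'r) ring_scheme \<Rightarrow> (nat \<Rightarrow> ('a, 'p, 'n) module_scheme) \<Rightarrow> (nat \<Rightarrow> 'p \<Rightarrow> 'p) \<Rightarrow> nat \<Rightarrow>
   ('p \<Rightarrow> 'a) \<Rightarrow> bool" where
  "cocycle R P d k f \<longleftrightarrow> f \<in> functionals R (P k) \<and>
    (\<forall>x\<in>carrier (P (Suc k)). f (d k x) = \<zero>\<^bsub>R\<^esub>)"

definition coboundary ::
  "('a, 'r) ring_scheme \<Rightarrow> (nat \<Rightarrow> ('a, 'p, 'n) module_scheme) \<Rightarrow> (nat \<Rightarrow> 'p \<Rightarrow> 'p) \<Rightarrow> nat \<Rightarrow>
   ('p \<Rightarrow> 'a) \<Rightarrow> bool" where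
  "coboundary R P d k f \<longleftrightarrow> (case k of 0 \<Rightarrow> \<forall>x\<in>carrier (P 0). f x = \<zero>\<^bsub>R\<^esub>
    | Suc j \<Rightarrow> \<exists>g\<in>functionals R (P j). \<forall>x\<in>carrier (P (Suc j)). f x = g (d j x))"

definition ext_vanishes ::
  "('a, 'r) ring_scheme \<Rightarrow> (nat \<Rightarrow> ('a, 'p, 'n) module_scheme) \<Rightarrow> (nat \<Rightarrow> 'p \<Rightarrow> 'p) \<Rightarrow> nat \<Rightarrow> bool" where
  "ext_vanishes R P d k \<longleftrightarrow> (\<forall>f. cocycle R P d k f \<longrightarrow> coboundary R P d k f)"

abbreviation "free_cocycle R n \<equiv> cocycle R (free_sequence R n)"

abbreviation "free_coboundary R n \<equiv> coboundary R (free_sequence R n)"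

abbreviation "free_ext_vanishes R n \<equiv> ext_vanishes R (free_sequence R n)"

lemma coboundary_0: "coboundary R P d 0 f \<longleftrightarrow> (\<forall>x\<in>carrier (P 0). f x = \<zero>\<^bsub>R\<^esub>)"
  and coboundary_Suc: "coboundary R P d (Suc k) f \<longleftrightarrow>
    (\<exists>g\<in>functionals R (P k). \<forall>x\<in>carrier (P (Suc k)). f x = g (d k x))"
  by (auto simp: coboundary_def)

lemma coboundary_cong:
  assumes "\<And>x. x \<in> carrier (P k) \<Longrightarrow> f x = g x"
  shows "coboundary R P d k f \<longleftrightarrow> coboundary R P d k g"
  using assms by (cases k) (auto simp: coboundary_0 coboundary_Suc)

lemma coboundary_plus:
  assumes "ring R" "\<And>k. d k \<in> linear_maps R (P (Suc k)) (P k)"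
    "coboundary R P d k f" "coboundary R P d k g"
  shows "coboundary R P d k (\<lambda>x. f x \<oplus>\<^bsub>R\<^esub> g x)"
proof -
  interpret ring R by fact
  show ?thesis
  proof (cases k)
    case 0
    then show ?thesis using assms by (simp add: coboundary_0)
  next
    case (Suc j)
    then obtain u v where uv: "u \<in> functionals R (P j)"
      "v \<in> functionals R (P j)"
      "\<forall>x\<in>carrier (P (Suc j)). f x = u (d j x)" "\<forall>x\<in>carrier (P (Suc j)). g x = v (d j x)"
      using assms(3,4) by (auto simp: coboundary_Suc)
    then show ?thesis unfolding Suc coboundary_Suc
      using linear_maps_plus[OF left_module_regular[OF assms(1)] uv(1,2)]
      by (intro bexI[of _ "\<lambda>x. u x \<oplus>\<^bsub>R\<^esub> v x"]) auto
  qed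
qed

lemma coboundary_diff_trans:
  assumes "ring R" "\<And>k. d k \<in> linear_maps R (P (Suc k)) (P k)"
    "coboundary R P d k (\<lambda>x. f x \<ominus>\<^bsub>R\<^esub> g x)" "coboundary R P d k g"
    "f \<in> functionals R (P k)" "g \<in> functionals R (P k)"
  shows "coboundary R P d k f"
proof -
  interpret ring R by fact
  have "coboundary R P d k (\<lambda>x. (f x \<ominus>\<^bsub>R\<^esub> g x) \<oplus>\<^bsub>R\<^esub> g x)"
    by (rule coboundary_plus[where d=d, OF assms(1-4)])
  then show ?thesis
    using linear_mapsD(1)[OF assms(5)] linear_mapsD(1)[OF assms(6)]
    by (subst coboundary_cong[of P k f "\<lambda>x. (f x \<ominus>\<^bsub>R\<^esub> g x) \<oplus>\<^bsub>R\<^esub> g x"])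
      (auto simp: minus_eq a_assoc l_neg)
qed

definition chain_map ::
  "('a, 'r) ring_scheme \<Rightarrow> (nat \<Rightarrow> ('a, 'p, 'n) module_scheme) \<Rightarrow> (nat \<Rightarrow> 'p \<Rightarrow> 'p) \<Rightarrow>
   (nat \<Rightarrow> ('a, 'q, 'm) module_scheme) \<Rightarrow> (nat \<Rightarrow> 'q \<Rightarrow> 'q) \<Rightarrow> (nat \<Rightarrow> 'p \<Rightarrow> 'q) \<Rightarrow> bool" where
  "chain_map R P d Q d' \<phi> \<longleftrightarrow> (\<forall>k. \<phi> k \<in> linear_maps R (P k) (Q k)) \<and>
    (\<forall>k. \<forall>x\<in>carrier (P (Suc k)). d' k (\<phi> (Suc k) x) = \<phi> k (d k x))"

abbreviation "free_chain_map R n d n' d' \<equiv> chain_map R (free_sequence R n) d (free_sequence R n') d'"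

lemma chain_mapD:
  assumes "chain_map R P d Q d' \<phi>"
  shows "\<phi> k \<in> linear_maps R (P k) (Q k)"
    and "x \<in> carrier (P (Suc k)) \<Longrightarrow> d' k (\<phi> (Suc k) x) = \<phi> k (d k x)"
  using assms by (auto simp: chain_map_def)

lemma chain_map_comp:
  assumes "chain_map R P d Q d' \<phi>" "chain_map R Q d' S d'' \<psi>"
  shows "chain_map R P d S d'' (\<lambda>k x. \<psi> k (\<phi> k x))"
  unfolding chain_map_def
  using linear_maps_comp[OF chain_mapD(1)[OF assms(1)] chain_mapD(1)[OF assms(2)]]
    chain_mapD(2)[OF assms(1)] chain_mapD(2)[OF assms(2)] linear_mapsD(1)[OF chain_mapD(1)[OF assms(1)]]
  by auto

lemma chain_map_ident: "chain_map R P d P d (\<lambda>k x. x)"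
  by (simp add: chain_map_def linear_maps_ident)

lemma cocycle_pullback:
  assumes "chain_map R P d Q d' \<phi>" "cocycle R Q d' k f"
  shows "cocycle R P d k (\<lambda>x. f (\<phi> k x))"
proof -
  have "f (\<phi> k (d k x)) = \<zero>\<^bsub>R\<^esub>" if "x \<in> carrier (P (Suc k))" for x
    using assms(2) chain_mapD(2)[OF assms(1) that] linear_mapsD(1)[OF chain_mapD(1)[OF assms(1)] that]
    by (auto simp: cocycle_def simp flip: chain_mapD(2)[OF assms(1)])
  then show ?thesis
    using linear_maps_comp[OF chain_mapD(1)[OF assms(1)]] assms(2) by (auto simp: cocycle_def)
qed

lemma coboundary_pullback:
  assumes "chain_map R P d Q d' \<phi>" "coboundary R Q d' k f"
  shows "coboundary R P d k (\<lambda>x. f (\<phi> k x))"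
proof (cases k)
  case 0
  then show ?thesis
    using assms linear_mapsD(1)[OF chain_mapD(1)[OF assms(1), of 0]] by (auto simp: coboundary_0)
next
  case (Suc j)
  then obtain u where u: "u \<in> functionals R (Q j)"
    "\<forall>x\<in>carrier (Q (Suc j)). f x = u (d' j x)"
    using assms by (auto simp: coboundary_Suc)
  then show ?thesis unfolding Suc coboundary_Suc
    using linear_maps_comp[OF chain_mapD(1)[OF assms(1)] u(1)] chain_mapD(2)[OF assms(1)]
      linear_mapsD(1)[OF chain_mapD(1)[OF assms(1)]]
    by (intro bexI[of _ "\<lambda>x. u (\<phi> j x)"]) auto
qed

lemma liftsD:
  assumes "lifts R P N L" "f \<in> linear_maps R P L" "g \<in> linear_maps R N L"
    and "\<And>x. x \<in> carrier P \<Longrightarrow> f x \<in> g ` carrier N"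
  shows "\<exists>h\<in>linear_maps R P N. \<forall>x\<in>carrier P. g (h x) = f x"
  using assms(1)[unfolded lifts_def, rule_format, OF assms(2,3)] assms(4) by auto

section \<open>Comparison of resolutions\<close>

lemma comparison_map:
  fixes P :: "nat \<Rightarrow> ('a, 'p, 'x) module_scheme" and Q :: "nat \<Rightarrow> ('a, 'q, 'y) module_scheme"
  assumes P: "resolves R P d M e" and Q: "resolves R Q d' M e'"
    and im: "e ` carrier (P 0) \<subseteq> e' ` carrier (Q 0)"
    and l0: "lifts R (P 0) (Q 0) M"
    and l: "\<And>k. lifts R (P (Suc k)) (Q (Suc k)) (Q k)"
  shows "\<exists>\<phi>. chain_map R P d Q d' \<phi> \<and> (\<forall>x\<in>carrier (P 0). e' (\<phi> 0 x) = e x)"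
proof -
  note PD = resolvesD[OF P] and QD = resolvesD[OF Q]
  note PE = exact_complexD[OF PD(1)] and QE = exact_complexD[OF QD(1)]
  \<comment> \<open>A choice in degree \<open>k\<close> must send boundaries to cycles, so that the next degree can be lifted.\<close>
  define good where "good k f \<longleftrightarrow> f \<in> linear_maps R (P k) (Q k) \<and>
      (case k of 0 \<Rightarrow> \<forall>x\<in>carrier (P 0). e' (f x) = e x
        | Suc j \<Rightarrow> \<forall>x\<in>carrier (P (Suc (Suc j))). d' j (f (d (Suc j) x)) = \<zero>\<^bsub>Q j\<^esub>)"
    for k and f :: "'p \<Rightarrow> 'q"
  define link where "link k f g \<longleftrightarrow> (\<forall>x\<in>carrier (P (Suc k)). d' k (g x) = f (d k x))"
    for k and f g :: "'p \<Rightarrow> 'q"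
  have "\<exists>\<phi>. \<forall>k. good k (\<phi> k) \<and> link k (\<phi> k) (\<phi> (Suc k))"
  proof (rule dependent_nat_choice)
    have "\<exists>h\<in>linear_maps R (P 0) (Q 0). \<forall>x\<in>carrier (P 0). e' (h x) = e x"
      using im by (intro liftsD[OF l0 PD(3) QD(3)]) blast
    then show "\<exists>f. good 0 f" by (auto simp: good_def)
  next
    fix f k assume g: "good k f"
    then have f: "f \<in> linear_maps R (P k) (Q k)" by (simp add: good_def)
    have fd: "(\<lambda>x. f (d k x)) \<in> linear_maps R (P (Suc k)) (Q k)"
      by (rule linear_maps_comp[OF PE(2) f])
    have "f (d k x) \<in> d' k ` carrier (Q (Suc k))" if "x \<in> carrier (P (Suc k))" for x
    proof (cases k)
      case 0
      then have "e' (f (d 0 x)) = \<zero>\<^bsub>M\<^esub>"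
        using g PD(5) that linear_mapsD(1)[OF PE(2), of x 0] by (simp add: good_def)
      then show ?thesis using QD(4) 0 linear_mapsD(1)[OF fd that] by simp
    next
      case (Suc j)
      then show ?thesis using g that linear_mapsD(1)[OF fd that] QE(3)[of j] by (simp add: good_def)
    qed
    then have "\<exists>h\<in>linear_maps R (P (Suc k)) (Q (Suc k)). \<forall>x\<in>carrier (P (Suc k)). d' k (h x) = f (d k x)"
      by (rule liftsD[OF l fd QE(2)])
    then obtain h where h: "h \<in> linear_maps R (P (Suc k)) (Q (Suc k))"
      "\<forall>x\<in>carrier (P (Suc k)). d' k (h x) = f (d k x)" by blast
    have "d' k (h (d (Suc k) x)) = \<zero>\<^bsub>Q k\<^esub>" if "x \<in> carrier (P (Suc (Suc k)))" for x
      using h(2) linear_mapsD(1)[OF PE(2) that] PE(4)[OF that] linear_maps_zero[OF PE(1) QE(1) f] by simp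
    then have "good (Suc k) h \<and> link k f h" using h by (simp add: good_def link_def)
    then show "\<exists>h. good (Suc k) h \<and> link k f h" by blast
  qed
  then obtain \<phi> where \<phi>: "\<forall>k. good k (\<phi> k) \<and> link k (\<phi> k) (\<phi> (Suc k))" by (rule exE)
  have "chain_map R P d Q d' \<phi>" using \<phi> by (simp add: chain_map_def good_def link_def)
  moreover have "\<forall>x\<in>carrier (P 0). e' (\<phi> 0 x) = e x"
    using \<phi>[rule_format, of 0] by (simp add: good_def)
  ultimately show ?thesis by blast
qed

lemma chain_homotopy:
  fixes P :: "nat \<Rightarrow> ('a, 'p, 'x) module_scheme" and Q :: "nat \<Rightarrow> ('a, 'q, 'y) module_scheme"
  assumes P: "resolves R P d M e" and Q: "resolves R Q d' M e'"
    and \<alpha>: "chain_map R P d Q d' \<alpha>" and \<beta>: "chain_map R P d Q d' \<beta>"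
    and eq: "\<forall>x\<in>carrier (P 0). e' (\<alpha> 0 x) = e' (\<beta> 0 x)"
    and l: "\<And>k. lifts R (P k) (Q (Suc k)) (Q k)"
  shows "\<exists>s. (\<forall>k. s k \<in> linear_maps R (P k) (Q (Suc k))) \<and>
    (\<forall>x\<in>carrier (P 0). d' 0 (s 0 x) = \<alpha> 0 x \<ominus>\<^bsub>Q 0\<^esub> \<beta> 0 x) \<and>
    (\<forall>k. \<forall>x\<in>carrier (P (Suc k)).
      d' (Suc k) (s (Suc k) x) = (\<alpha> (Suc k) x \<ominus>\<^bsub>Q (Suc k)\<^esub> \<beta> (Suc k) x) \<ominus>\<^bsub>Q (Suc k)\<^esub> s k (d k x))"
proof -
  note PD = resolvesD[OF P] and QD = resolvesD[OF Q]
  note PE = exact_complexD[OF PD(1)] and QE = exact_complexD[OF QD(1)]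
  note A = chain_mapD[OF \<alpha>] and B = chain_mapD[OF \<beta>]
  define \<gamma> where "\<gamma> k x = \<alpha> k x \<ominus>\<^bsub>Q k\<^esub> \<beta> k x" for k x
  have \<gamma>: "\<gamma> k \<in> linear_maps R (P k) (Q k)" for k
    unfolding \<gamma>_def by (rule linear_maps_diff[OF QE(1) A(1) B(1)])
  have \<gamma>d: "d' k (\<gamma> (Suc k) x) = \<gamma> k (d k x)" if "x \<in> carrier (P (Suc k))" for k x
    unfolding \<gamma>_def
    using linear_maps_minus(2)[OF QE(1) QE(1) QE(2) linear_mapsD(1)[OF B(1) that] linear_mapsD(1)[OF A(1) that]]
      A(2)[OF that] B(2)[OF that] by simp
  \<comment> \<open>Agreement with \<open>\<gamma>\<close> on boundaries is what the choice in the next degree needs.\<close>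
  define good where "good k s \<longleftrightarrow> s \<in> linear_maps R (P k) (Q (Suc k)) \<and>
      (\<forall>x\<in>carrier (P (Suc k)). d' k (s (d k x)) = \<gamma> k (d k x)) \<and>
      (k = 0 \<longrightarrow> (\<forall>x\<in>carrier (P 0). d' 0 (s x) = \<gamma> 0 x))"
    for k and s :: "'p \<Rightarrow> 'q"
  define link where "link k s t \<longleftrightarrow> (\<forall>x\<in>carrier (P (Suc k)).
      d' (Suc k) (t x) = \<gamma> (Suc k) x \<ominus>\<^bsub>Q (Suc k)\<^esub> s (d k x))"
    for k and s t :: "'p \<Rightarrow> 'q"
  have "\<exists>s. \<forall>k. good k (s k) \<and> link k (s k) (s (Suc k))"
  proof (rule dependent_nat_choice)
    have "\<gamma> 0 x \<in> d' 0 ` carrier (Q (Suc 0))" if "x \<in> carrier (P 0)" for x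
    proof -
      interpret M: left_module R M by (rule QD(2))
      have "e' (\<gamma> 0 x) = e' (\<alpha> 0 x) \<ominus>\<^bsub>M\<^esub> e' (\<beta> 0 x)" unfolding \<gamma>_def
        by (rule linear_maps_minus(2)[OF QE(1) QD(2) QD(3) linear_mapsD(1)[OF B(1) that] linear_mapsD(1)[OF A(1) that]])
      also have "\<dots> = \<zero>\<^bsub>M\<^esub>"
        using eq[rule_format, OF that] linear_mapsD(1)[OF QD(3) linear_mapsD(1)[OF B(1) that]]
        by (simp add: M.M.minus_eq M.M.r_neg)
      finally show ?thesis using QD(4) linear_mapsD(1)[OF \<gamma> that] by simp
    qed
    then have "\<exists>s\<in>linear_maps R (P 0) (Q (Suc 0)). \<forall>x\<in>carrier (P 0). d' 0 (s x) = \<gamma> 0 x"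
      by (rule liftsD[OF l \<gamma> QE(2)])
    then show "\<exists>s. good 0 s" using linear_mapsD(1)[OF PE(2), of _ 0] by (auto simp: good_def)
  next
    fix s k assume g: "good k s"
    then have s: "s \<in> linear_maps R (P k) (Q (Suc k))"
      and sd: "\<And>x. x \<in> carrier (P (Suc k)) \<Longrightarrow> d' k (s (d k x)) = \<gamma> k (d k x)"
      by (auto simp: good_def)
    interpret Qk: left_module R "Q k" by (rule QE(1))
    interpret Qs: left_module R "Q (Suc k)" by (rule QE(1))
    define t where "t x = \<gamma> (Suc k) x \<ominus>\<^bsub>Q (Suc k)\<^esub> s (d k x)" for x
    have t: "t \<in> linear_maps R (P (Suc k)) (Q (Suc k))"
      unfolding t_def by (rule linear_maps_diff[OF QE(1) \<gamma> linear_maps_comp[OF PE(2) s]])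
    have "t x \<in> d' (Suc k) ` carrier (Q (Suc (Suc k)))" if x: "x \<in> carrier (P (Suc k))" for x
    proof -
      have "d' k (t x) = d' k (\<gamma> (Suc k) x) \<ominus>\<^bsub>Q k\<^esub> d' k (s (d k x))"
        unfolding t_def by (rule linear_maps_minus(2)[OF QE(1) QE(1) QE(2)
            linear_mapsD(1)[OF linear_maps_comp[OF PE(2) s] x] linear_mapsD(1)[OF \<gamma> x]])
      also have "\<dots> = \<zero>\<^bsub>Q k\<^esub>"
        using sd[OF x] \<gamma>d[OF x] linear_mapsD(1)[OF linear_maps_comp[OF PE(2) \<gamma>] x]
        by (simp add: Qk.M.minus_eq Qk.M.r_neg)
      finally show ?thesis using QE(3)[of k] linear_mapsD(1)[OF t x] by simp
    qed
    then have "\<exists>s'\<in>linear_maps R (P (Suc k)) (Q (Suc (Suc k))). \<forall>x\<in>carrier (P (Suc k)). d' (Suc k) (s' x) = t x"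
      by (rule liftsD[OF l t QE(2)])
    then obtain s' where s': "s' \<in> linear_maps R (P (Suc k)) (Q (Suc (Suc k)))"
      "\<And>x. x \<in> carrier (P (Suc k)) \<Longrightarrow> d' (Suc k) (s' x) = t x" by blast
    have "d' (Suc k) (s' (d (Suc k) x)) = \<gamma> (Suc k) (d (Suc k) x)" if "x \<in> carrier (P (Suc (Suc k)))" for x
      using s'(2)[OF linear_mapsD(1)[OF PE(2) that]] PE(4)[OF that] linear_maps_zero[OF PE(1) QE(1) s]
        linear_mapsD(1)[OF \<gamma> linear_mapsD(1)[OF PE(2) that]]
      by (simp add: t_def Qs.M.minus_eq)
    then have "good (Suc k) s' \<and> link k s s'" using s' by (simp add: good_def link_def t_def)
    then show "\<exists>s'. good (Suc k) s' \<and> link k s s'" by blast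
  qed
  then obtain s where s: "\<forall>k. good k (s k) \<and> link k (s k) (s (Suc k))" by (rule exE)
  have "\<forall>x\<in>carrier (P 0). d' 0 (s 0 x) = \<gamma> 0 x"
    using s[rule_format, of 0] by (simp add: good_def)
  then show ?thesis
    using s unfolding good_def link_def \<gamma>_def by (intro exI[of _ s]) auto
qed

lemma homotopic_pullbacks_cohomologous:
  fixes P :: "nat \<Rightarrow> ('a, 'p, 'x) module_scheme" and Q :: "nat \<Rightarrow> ('a, 'q, 'y) module_scheme"
  assumes P: "resolves R P d M e" and Q: "resolves R Q d' M e'"
    and \<alpha>: "chain_map R P d Q d' \<alpha>" and \<beta>: "chain_map R P d Q d' \<beta>"
    and eq: "\<And>x. x \<in> carrier (P 0) \<Longrightarrow> e' (\<alpha> 0 x) = e' (\<beta> 0 x)"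
    and l: "\<And>k. lifts R (P k) (Q (Suc k)) (Q k)"
    and f: "cocycle R Q d' k f"
  shows "coboundary R P d k (\<lambda>x. f (\<alpha> k x) \<ominus>\<^bsub>R\<^esub> f (\<beta> k x))"
proof -
  note QE = exact_complexD[OF resolvesD(1)[OF Q]] and PE = exact_complexD[OF resolvesD(1)[OF P]]
  have R: "ring R" by (rule left_module_ring[OF QE(1)])
  interpret ring R by fact
  note RL = left_module_regular[OF R]
  have fl: "f \<in> functionals R (Q k)"
    and f0: "\<And>x. x \<in> carrier (Q (Suc k)) \<Longrightarrow> f (d' k x) = \<zero>\<^bsub>R\<^esub>" using f by (auto simp: cocycle_def)
  have eqb: "\<forall>x\<in>carrier (P 0). e' (\<alpha> 0 x) = e' (\<beta> 0 x)" using eq by blast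
  obtain s where s: "\<forall>k. s k \<in> linear_maps R (P k) (Q (Suc k))"
    "\<forall>x\<in>carrier (P 0). d' 0 (s 0 x) = \<alpha> 0 x \<ominus>\<^bsub>Q 0\<^esub> \<beta> 0 x"
    "\<forall>k. \<forall>x\<in>carrier (P (Suc k)). d' (Suc k) (s (Suc k) x) =
      (\<alpha> (Suc k) x \<ominus>\<^bsub>Q (Suc k)\<^esub> \<beta> (Suc k) x) \<ominus>\<^bsub>Q (Suc k)\<^esub> s k (d k x)"
    using chain_homotopy[OF P Q \<alpha> \<beta> eqb l] by (elim exE conjE) (rule that)
  note s = s(1)[rule_format] s(2)[rule_format] s(3)[rule_format]
  have a: "\<alpha> k x \<in> carrier (Q k)" and b: "\<beta> k x \<in> carrier (Q k)" if "x \<in> carrier (P k)" for x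
    using that linear_mapsD(1)[OF chain_mapD(1)[OF \<alpha>]] linear_mapsD(1)[OF chain_mapD(1)[OF \<beta>]] by auto
  have diff: "f (\<alpha> k x) \<ominus>\<^bsub>R\<^esub> f (\<beta> k x) = f (\<alpha> k x \<ominus>\<^bsub>Q k\<^esub> \<beta> k x)" if "x \<in> carrier (P k)" for x
    using linear_maps_minus(2)[OF QE(1) RL fl b[OF that] a[OF that]] by simp
  show ?thesis
  proof (cases k)
    case 0
    then show ?thesis unfolding 0 coboundary_0
      using diff f0 s(2) linear_mapsD(1)[OF s(1)] by (metis 0)
  next
    case (Suc j)
    have "f (\<alpha> k x) \<ominus>\<^bsub>R\<^esub> f (\<beta> k x) = f (s j (d j x))" if x: "x \<in> carrier (P (Suc j))" for x
    proof -
      interpret Qk: left_module R "Q k" by (rule QE(1))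
      have xk: "x \<in> carrier (P k)" using x Suc by simp
      have c: "s j (d j x) \<in> carrier (Q k)"
        using linear_mapsD(1)[OF s(1) linear_mapsD(1)[OF PE(2) x]] Suc by simp
      have "\<zero>\<^bsub>R\<^esub> = f (d' k (s k x))" using f0 linear_mapsD(1)[OF s(1) xk] by simp
      also have "\<dots> = f ((\<alpha> k x \<ominus>\<^bsub>Q k\<^esub> \<beta> k x) \<ominus>\<^bsub>Q k\<^esub> s j (d j x))" using s(3)[OF x] Suc by simp
      also have "\<dots> = f (\<alpha> k x \<ominus>\<^bsub>Q k\<^esub> \<beta> k x) \<ominus>\<^bsub>R\<^esub> f (s j (d j x))"
        using linear_maps_minus(2)[OF QE(1) RL fl c] a[OF xk] b[OF xk] by simp
      finally have "f (\<alpha> k x \<ominus>\<^bsub>Q k\<^esub> \<beta> k x) \<ominus>\<^bsub>R\<^esub> f (s j (d j x)) = \<zero>\<^bsub>R\<^esub>" by simp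
      moreover have "f (\<alpha> k x \<ominus>\<^bsub>Q k\<^esub> \<beta> k x) \<in> carrier R" "f (s j (d j x)) \<in> carrier R"
        using linear_mapsD(1)[OF fl] a[OF xk] b[OF xk] c by auto
      ultimately show ?thesis
        using diff[OF xk] by (metis a_inv_closed minus_eq minus_equality minus_minus)
    qed
    moreover have "(\<lambda>x. f (s j x)) \<in> functionals R (P j)"
      using linear_maps_comp[OF s(1) fl[unfolded Suc]] .
    ultimately show ?thesis using Suc coboundary_Suc[of R P d j] by auto
  qed
qed

text \<open>Cocycles on \<open>Q\<close>, pulled back along a comparison map \<open>P \<rightarrow> Q\<close>, represent the cohomology of
  \<open>P\<close> faithfully and completely.\<close>

lemma comparison_cohomology:
  fixes P :: "nat \<Rightarrow> ('a, 'p, 'x) module_scheme" and Q :: "nat \<Rightarrow> ('a, 'q, 'y) module_scheme"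
  assumes P: "resolves R P d M e" and Q: "resolves R Q d' M e'"
    and im: "e ` carrier (P 0) = e' ` carrier (Q 0)"
    and "lifts R (P 0) (Q 0) M" "\<And>k. lifts R (P (Suc k)) (Q (Suc k)) (Q k)"
    and "lifts R (Q 0) (P 0) M" "\<And>k. lifts R (Q (Suc k)) (P (Suc k)) (P k)"
    and lP: "\<And>k. lifts R (P k) (P (Suc k)) (P k)" and lQ: "\<And>k. lifts R (Q k) (Q (Suc k)) (Q k)"
  shows "\<exists>\<psi>. chain_map R P d Q d' \<psi> \<and>
    (\<forall>k f. cocycle R Q d' k f \<longrightarrow>
      coboundary R P d k (\<lambda>x. f (\<psi> k x)) = coboundary R Q d' k f) \<and>
    (\<forall>k u. cocycle R P d k u \<longrightarrow>
      (\<exists>f. cocycle R Q d' k f \<and> coboundary R P d k (\<lambda>x. u x \<ominus>\<^bsub>R\<^esub> f (\<psi> k x))))"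
proof -
  note QE = exact_complexD[OF resolvesD(1)[OF Q]]
  have R: "ring R" by (rule left_module_ring[OF QE(1)])
  obtain \<psi> where \<psi>: "chain_map R P d Q d' \<psi>" "\<And>x. x \<in> carrier (P 0) \<Longrightarrow> e' (\<psi> 0 x) = e x"
    using comparison_map[OF P Q _ assms(4,5)] im by auto
  obtain \<phi> where \<phi>: "chain_map R Q d' P d \<phi>" "\<And>x. x \<in> carrier (Q 0) \<Longrightarrow> e (\<phi> 0 x) = e' x"
    using comparison_map[OF Q P _ assms(6,7)] im by auto
  note pc = linear_mapsD(1)[OF chain_mapD(1)[OF \<psi>(1)]] linear_mapsD(1)[OF chain_mapD(1)[OF \<phi>(1)]]
  have hQ: "coboundary R Q d' k (\<lambda>x. f x \<ominus>\<^bsub>R\<^esub> f (\<psi> k (\<phi> k x)))" if "cocycle R Q d' k f" for k f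
    by (rule homotopic_pullbacks_cohomologous[OF Q Q chain_map_ident chain_map_comp[OF \<phi>(1) \<psi>(1)] _ lQ that])
      (simp add: \<psi>(2) \<phi>(2) pc)
  have hP: "coboundary R P d k (\<lambda>x. f x \<ominus>\<^bsub>R\<^esub> f (\<phi> k (\<psi> k x)))" if "cocycle R P d k f" for k f
    by (rule homotopic_pullbacks_cohomologous[OF P P chain_map_ident chain_map_comp[OF \<psi>(1) \<phi>(1)] _ lP that])
      (simp add: \<psi>(2) \<phi>(2) pc)
  have 1: "coboundary R Q d' k f" if f: "cocycle R Q d' k f" and "coboundary R P d k (\<lambda>x. f (\<psi> k x))" for k f
    using coboundary_diff_trans[where d=d', OF R QE(2) hQ[OF f] coboundary_pullback[OF \<phi>(1) that(2)]]
      cocycle_pullback[OF \<phi>(1) cocycle_pullback[OF \<psi>(1) f]] f by (auto simp: cocycle_def)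
  have 2: "\<exists>f. cocycle R Q d' k f \<and> coboundary R P d k (\<lambda>x. u x \<ominus>\<^bsub>R\<^esub> f (\<psi> k x))"
    if u: "cocycle R P d k u" for k u
    using hP[OF u] cocycle_pullback[OF \<phi>(1) u] by (intro exI[of _ "\<lambda>x. u (\<phi> k x)"]) auto
  show ?thesis using \<psi>(1) 1 2 coboundary_pullback[OF \<psi>(1)] by (intro exI[of _ \<psi>]) blast
qed

lemma free_resolution_ext_vanishes_unique:
  assumes P: "free_resolves R m d M e" and Q: "free_resolves R n d' M e'"
    and im: "e ` vectors R (m 0) = e' ` vectors R (n 0)"
  shows "free_ext_vanishes R m d k \<longleftrightarrow> free_ext_vanishes R n d' k"
proof -
  have M: "left_module R M" and R: "ring R"
    using resolvesD(2)[OF Q] left_module_ring by auto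
  note L = left_module_free[OF R]
  have *: "free_ext_vanishes R n d' k"
    if P: "free_resolves R m d M e" and Q: "free_resolves R n d' M e'"
      and im: "e ` vectors R (m 0) = e' ` vectors R (n 0)"
      and v: "free_ext_vanishes R m d k" for m d e n d' e'
  proof -
    note all = lifts_free_module[OF L M] lifts_free_module[OF L L]
    from comparison_cohomology[OF P Q im all(1,2,1,2,2,2)] obtain \<psi> where
      \<psi>: "free_chain_map R m d n d' \<psi>"
      "\<And>k f. free_cocycle R n d' k f \<Longrightarrow>
        free_coboundary R m d k (\<lambda>x. f (\<psi> k x)) = free_coboundary R n d' k f"
      by auto
    then show ?thesis using v cocycle_pullback[OF \<psi>(1)] unfolding ext_vanishes_def by blast
  qed
  show ?thesis using *[OF P Q im] *[OF Q P im[symmetric]] by blast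
qed

section \<open>Ext modules\<close>

lemma dual_module_simps [simp]:
  "zero (dual_module R P) = (\<lambda>x\<in>carrier P. \<zero>\<^bsub>R\<^esub>)"
  "f \<oplus>\<^bsub>dual_module R P\<^esub> g = (\<lambda>x\<in>carrier P. f x \<oplus>\<^bsub>R\<^esub> g x)"
  "a \<odot>\<^bsub>dual_module R P\<^esub> f = (\<lambda>x\<in>carrier P. f x \<otimes>\<^bsub>R\<^esub> a)"
  by (auto simp: dual_module_def)

lemma dual_module_carrier:
  "f \<in> carrier (dual_module R P) \<longleftrightarrow>
    f \<in> functionals R P \<and> f \<in> extensional (carrier P)"
  by (auto simp: dual_module_def)

lemma linear_maps_restrict:
  assumes "left_module R P" "f \<in> linear_maps R P N"
  shows "restrict f (carrier P) \<in> linear_maps R P N"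
proof -
  interpret left_module R P by fact
  show ?thesis using linear_mapsD[OF assms(2)] by (intro linear_mapsI) auto
qed

lemma linear_maps_right_mult:
  assumes "ring R" "f \<in> functionals R P" "a \<in> carrier R"
  shows "(\<lambda>x. f x \<otimes>\<^bsub>R\<^esub> a) \<in> functionals R P"
proof -
  interpret ring R by fact
  show ?thesis
    using linear_mapsD[OF assms(2)] assms(3) by (intro linear_mapsI) (auto simp: l_distr m_assoc)
qed

lemma left_module_dual:
  assumes P: "left_module R P"
  shows "left_module (opp_ring R) (dual_module R P)"
proof -
  have R: "ring R" by (rule left_module_ring[OF P])
  interpret ring R by fact
  interpret P: left_module R P by fact
  note RL = left_module_regular[OF R]
  have val: "f x \<in> carrier R" if "f \<in> carrier (dual_module R P)" "x \<in> carrier P" for f x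
    using that linear_mapsD(1)[of f R P "regular_module R" x] by (auto simp: dual_module_carrier)
  have add: "f \<oplus>\<^bsub>dual_module R P\<^esub> g \<in> carrier (dual_module R P)"
    if "f \<in> carrier (dual_module R P)" "g \<in> carrier (dual_module R P)" for f g
    using that linear_maps_restrict[OF P linear_maps_plus[OF RL, of f P g]] by (auto simp: dual_module_carrier)
  have "abelian_group (dual_module R P)"
  proof (rule abelian_groupI)
    show "\<zero>\<^bsub>dual_module R P\<^esub> \<in> carrier (dual_module R P)"
      using linear_maps_restrict[OF P linear_maps_const_zero[OF RL]] by (auto simp: dual_module_carrier)
    show "\<exists>g\<in>carrier (dual_module R P). g \<oplus>\<^bsub>dual_module R P\<^esub> f = \<zero>\<^bsub>dual_module R P\<^esub>"
      if "f \<in> carrier (dual_module R P)" for f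
      using that linear_maps_restrict[OF P linear_maps_neg[OF RL, of f P]] val[OF that]
      by (intro bexI[of _ "\<lambda>x\<in>carrier P. \<ominus>\<^bsub>R\<^esub> f x"]) (auto simp: dual_module_carrier l_neg)
  qed (use add val in \<open>auto simp: dual_module_carrier extensional_def a_ac\<close>)
  moreover have "a \<odot>\<^bsub>dual_module R P\<^esub> f \<in> carrier (dual_module R P)"
    if "f \<in> carrier (dual_module R P)" "a \<in> carrier R" for f a
    using that linear_maps_restrict[OF P linear_maps_right_mult[OF R _ that(2)], of f] by (auto simp: dual_module_carrier)
  ultimately show ?thesis
    by (intro left_moduleI[OF ring_opp_ring[OF R]])
      (use val in \<open>auto simp: l_distr r_distr m_assoc dual_module_carrier extensional_def\<close>)
qed

definition dual_boundaries ::
  "('a, 'r) ring_scheme \<Rightarrow> (nat \<Rightarrow> ('a, 'p, 'n) module_scheme) \<Rightarrow> (nat \<Rightarrow> 'p \<Rightarrow> 'p) \<Rightarrow> nat \<Rightarrow>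
   ('p \<Rightarrow> 'a) set" where
  "dual_boundaries R P d k = (case k of 0 \<Rightarrow> {\<zero>\<^bsub>dual_module R (P 0)\<^esub>}
    | Suc j \<Rightarrow> dual_map P d j ` carrier (dual_module R (P j)))"

text \<open>Elements of a dual module are extensional functions. Restricting first gives every functional
  a class, whatever its values outside the carrier.\<close>

definition cohomology_class ::
  "('a, 'r) ring_scheme \<Rightarrow> (nat \<Rightarrow> ('a, 'p, 'n) module_scheme) \<Rightarrow> (nat \<Rightarrow> 'p \<Rightarrow> 'p) \<Rightarrow> nat \<Rightarrow>
   ('p \<Rightarrow> 'a) \<Rightarrow> ('p \<Rightarrow> 'a) set" where
  "cohomology_class R P d k f =
    dual_boundaries R P d k +>\<^bsub>dual_module R (P k)\<^esub> (restrict f (carrier (P k)))"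

context
  fixes R :: "('a, 'r) ring_scheme" and P :: "nat \<Rightarrow> ('a, 'p, 'n) module_scheme" and d
  assumes ex: "exact_complex R P d"
begin

lemma dual_map_linear:
  "dual_map P d k \<in> linear_maps (opp_ring R) (dual_module R (P k)) (dual_module R (P (Suc k)))"
proof -
  note E = exact_complexD[OF ex]
  show ?thesis
  proof (rule linear_mapsI)
    show "dual_map P d k f \<in> carrier (dual_module R (P (Suc k)))" if "f \<in> carrier (dual_module R (P k))" for f
      using that linear_maps_restrict[OF E(1) linear_maps_comp[OF E(2), of f k]]
      by (auto simp: dual_module_carrier dual_map_def)
  qed (use linear_mapsD(1)[OF E(2)] in \<open>auto simp: dual_map_def\<close>)
qed

lemma dual_map_zero_iff:
  assumes "f \<in> carrier (dual_module R (P k))"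
  shows "dual_map P d k f = \<zero>\<^bsub>dual_module R (P (Suc k))\<^esub> \<longleftrightarrow> cocycle R P d k f"
  using assms by (auto simp: dual_map_def cocycle_def dual_module_carrier fun_eq_iff)

lemma dual_boundaries_iff:
  "f \<in> dual_boundaries R P d k \<longleftrightarrow> f \<in> carrier (dual_module R (P k)) \<and> coboundary R P d k f"
proof (cases k)
  case 0
  interpret D: left_module "opp_ring R" "dual_module R (P 0)"
    by (rule left_module_dual[OF exact_complexD(1)[OF ex]])
  show ?thesis
    using D.M.zero_closed unfolding 0
    by (auto simp: dual_boundaries_def coboundary_0 dual_module_carrier extensional_def)
next
  case (Suc j)
  note E = exact_complexD[OF ex]
  show ?thesis
  proof
    assume "f \<in> dual_boundaries R P d k"
    then obtain g where g: "g \<in> carrier (dual_module R (P j))" "f = dual_map P d j g"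
      by (auto simp: dual_boundaries_def Suc)
    then show "f \<in> carrier (dual_module R (P k)) \<and> coboundary R P d k f"
      using linear_mapsD(1)[OF dual_map_linear g(1)]
      by (auto simp: Suc coboundary_Suc dual_module_carrier dual_map_def)
  next
    assume f: "f \<in> carrier (dual_module R (P k)) \<and> coboundary R P d k f"
    then obtain g where g: "g \<in> functionals R (P j)"
      "\<And>x. x \<in> carrier (P (Suc j)) \<Longrightarrow> f x = g (d j x)" by (auto simp: coboundary_Suc Suc)
    have "f = dual_map P d j (restrict g (carrier (P j)))"
      using f g(2) linear_mapsD(1)[OF E(2)]
      by (auto simp: dual_map_def dual_module_carrier extensional_def Suc fun_eq_iff)
    moreover have "restrict g (carrier (P j)) \<in> carrier (dual_module R (P j))"
      using linear_maps_restrict[OF E(1) g(1)] by (simp add: dual_module_carrier)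
    ultimately show "f \<in> dual_boundaries R P d k" by (simp add: dual_boundaries_def Suc)
  qed
qed

lemma dual_cohomology_eq:
  "dual_cohomology R P d k = subquotient (dual_module R (P k))
    {f \<in> carrier (dual_module R (P k)). cocycle R P d k f} (dual_boundaries R P d k)"
proof -
  have "a_kernel (dual_module R (P k)) (dual_module R (P (Suc k))) (dual_map P d k) =
      {f \<in> carrier (dual_module R (P k)). cocycle R P d k f}"
    using dual_map_zero_iff by (auto simp: a_kernel_def' simp del: dual_module_simps)
  then show ?thesis by (simp add: dual_cohomology_def dual_boundaries_def)
qed

lemma submodule_dual_boundaries: "submodule (dual_boundaries R P d k) (opp_ring R) (dual_module R (P k))"
proof -
  note DL = left_module_dual[OF exact_complexD(1)[OF ex]]
  show ?thesis
  proof (cases k)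
    case 0
    then show ?thesis using submodule_zero[OF DL, of 0] by (simp add: dual_boundaries_def)
  next
    case (Suc j)
    then show ?thesis
      using submodule_image[OF DL DL dual_map_linear submodule_carrier[OF DL]]
      by (simp add: dual_boundaries_def)
  qed
qed

lemma submodule_dual_cocycles:
  "submodule {f \<in> carrier (dual_module R (P k)). cocycle R P d k f} (opp_ring R) (dual_module R (P k))"
proof -
  note DL = left_module_dual[OF exact_complexD(1)[OF ex]]
  have "{f \<in> carrier (dual_module R (P k)). cocycle R P d k f} =
      {f \<in> carrier (dual_module R (P k)). dual_map P d k f = \<zero>\<^bsub>dual_module R (P (Suc k))\<^esub>}"
    using dual_map_zero_iff by blast
  then show ?thesis using submodule_kernel[OF DL DL dual_map_linear] by simp
qed

lemma left_module_dual_cohomology: "left_module (opp_ring R) (dual_cohomology R P d k)"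
  unfolding dual_cohomology_eq
  by (rule left_module_subquotient[OF left_module_dual[OF exact_complexD(1)[OF ex]]
        submodule_dual_boundaries submodule_dual_cocycles])

lemma restrict_dual:
  "f \<in> functionals R (P k) \<Longrightarrow>
    restrict f (carrier (P k)) \<in> carrier (dual_module R (P k))"
  using linear_maps_restrict[OF exact_complexD(1)[OF ex]] by (simp add: dual_module_carrier)

lemma cocycle_restrict:
  "cocycle R P d k f \<Longrightarrow> cocycle R P d k (restrict f (carrier (P k)))"
  using linear_maps_restrict[OF exact_complexD(1)[OF ex]] linear_mapsD(1)[OF exact_complexD(2)[OF ex]]
  by (auto simp: cocycle_def)

lemma cohomology_class_image:
  "carrier (dual_cohomology R P d k) = cohomology_class R P d k ` {f. cocycle R P d k f}"
proof -
  have "restrict f (carrier (P k)) = f" if "f \<in> carrier (dual_module R (P k))" for f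
    using that by (auto simp: dual_module_carrier extensional_restrict)
  then have "cohomology_class R P d k f = dual_boundaries R P d k +>\<^bsub>dual_module R (P k)\<^esub> f"
    if "f \<in> carrier (dual_module R (P k))" for f using that by (simp add: cohomology_class_def)
  moreover have "cohomology_class R P d k f = cohomology_class R P d k (restrict f (carrier (P k)))" for f
    by (simp add: cohomology_class_def)
  moreover have "restrict f (carrier (P k)) \<in> {f \<in> carrier (dual_module R (P k)). cocycle R P d k f}"
    if "cocycle R P d k f" for f
    using cocycle_restrict[OF that] restrict_dual that unfolding cocycle_def by blast
  ultimately show ?thesis
    unfolding dual_cohomology_eq subquotient_simps by (auto simp: image_iff) metis+
qed

lemma cohomology_class_eq_iff:
  assumes "f \<in> functionals R (P k)" "g \<in> functionals R (P k)"
  shows "cohomology_class R P d k f = cohomology_class R P d k g \<longleftrightarrow>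
    coboundary R P d k (\<lambda>x. f x \<ominus>\<^bsub>R\<^esub> g x)"
proof -
  note PL = exact_complexD(1)[OF ex]
  note DL = left_module_dual[OF PL]
  interpret R: ring R by (rule left_module_ring[OF PL])
  interpret D: left_module "opp_ring R" "dual_module R (P k)" by (rule DL)
  let ?f = "restrict f (carrier (P k))" and ?g = "restrict g (carrier (P k))"
  note v = linear_mapsD(1)[OF assms(1)] linear_mapsD(1)[OF assms(2)]
  have neg: "\<ominus>\<^bsub>dual_module R (P k)\<^esub> ?g = (\<lambda>x\<in>carrier (P k). \<ominus>\<^bsub>R\<^esub> g x)"
    using restrict_dual[OF assms(2)] v
      restrict_dual[OF linear_maps_neg[OF left_module_regular[OF R.ring_axioms] assms(2)]]
    by (intro D.M.minus_equality) (auto simp: R.l_neg)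
  have "?f \<ominus>\<^bsub>dual_module R (P k)\<^esub> ?g = (\<lambda>x\<in>carrier (P k). f x \<ominus>\<^bsub>R\<^esub> g x)"
    unfolding D.M.minus_eq neg by (auto simp: R.minus_eq)
  moreover have "(\<lambda>x\<in>carrier (P k). f x \<ominus>\<^bsub>R\<^esub> g x) \<in> carrier (dual_module R (P k))"
    using restrict_dual[OF linear_maps_diff[OF left_module_regular[OF R.ring_axioms] assms]] by simp
  ultimately show ?thesis
    unfolding cohomology_class_def
      coset_eq_iff[OF DL submodule_dual_boundaries restrict_dual[OF assms(1)] restrict_dual[OF assms(2)]]
      dual_boundaries_iff
    by (auto cong: coboundary_cong)
qed

lemma cohomology_class_zero_iff:
  assumes "f \<in> functionals R (P k)"
  shows "cohomology_class R P d k f = \<zero>\<^bsub>dual_cohomology R P d k\<^esub> \<longleftrightarrow> coboundary R P d k f"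
proof -
  note DL = left_module_dual[OF exact_complexD(1)[OF ex]]
  show ?thesis
    unfolding cohomology_class_def dual_cohomology_eq subquotient_simps
      coset_eq_self_iff[OF DL submodule_dual_boundaries restrict_dual[OF assms]] dual_boundaries_iff
    using restrict_dual[OF assms] coboundary_cong[of P k "restrict f (carrier (P k))" f] by auto
qed

lemma cohomology_class_add:
  assumes "f \<in> functionals R (P k)" "g \<in> functionals R (P k)"
  shows "cohomology_class R P d k (\<lambda>x. f x \<oplus>\<^bsub>R\<^esub> g x) =
    cohomology_class R P d k f \<oplus>\<^bsub>dual_cohomology R P d k\<^esub> cohomology_class R P d k g"
proof -
  note DL = left_module_dual[OF exact_complexD(1)[OF ex]]
  show ?thesis
    unfolding cohomology_class_def dual_cohomology_eq
      subquotient_add[OF DL submodule_dual_boundaries restrict_dual[OF assms(1)] restrict_dual[OF assms(2)]]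
    by (intro arg_cong[where f="\<lambda>h. dual_boundaries R P d k +>\<^bsub>dual_module R (P k)\<^esub> h"])
      (auto simp: restrict_def fun_eq_iff)
qed

lemma cohomology_class_smult:
  assumes "f \<in> functionals R (P k)" "a \<in> carrier R"
  shows "cohomology_class R P d k (\<lambda>x. f x \<otimes>\<^bsub>R\<^esub> a) =
    a \<odot>\<^bsub>dual_cohomology R P d k\<^esub> cohomology_class R P d k f"
proof -
  note DL = left_module_dual[OF exact_complexD(1)[OF ex]]
  have a: "a \<in> carrier (opp_ring R)" using assms by simp
  show ?thesis
    unfolding cohomology_class_def dual_cohomology_eq
      subquotient_smult[OF DL submodule_dual_boundaries restrict_dual[OF assms(1)] a]
    by (intro arg_cong[where f="\<lambda>h. dual_boundaries R P d k +>\<^bsub>dual_module R (P k)\<^esub> h"])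
      (auto simp: restrict_def fun_eq_iff)
qed

lemma trivial_dual_cohomology_iff: "trivial_module (dual_cohomology R P d k) \<longleftrightarrow> ext_vanishes R P d k"
proof -
  interpret H: left_module "opp_ring R" "dual_cohomology R P d k" by (rule left_module_dual_cohomology)
  have "trivial_module (dual_cohomology R P d k) \<longleftrightarrow>
      (\<forall>f. cocycle R P d k f \<longrightarrow> cohomology_class R P d k f = \<zero>\<^bsub>dual_cohomology R P d k\<^esub>)"
    using H.M.zero_closed unfolding trivial_module_def cohomology_class_image by blast
  then show ?thesis
    unfolding ext_vanishes_def using cohomology_class_zero_iff by (auto simp: cocycle_def)
qed

end

lemma projective_resolution_resolves:
  assumes "projective_resolution R M P d e" "left_module R M"
  shows "resolves R P d M e" "e ` carrier (P 0) = carrier M"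
  using assms unfolding projective_resolution_def resolves_def exact_complex_def a_kernel_def'
    projective_module_def by auto

lemma free_projective_comparison:
  fixes R :: "('a, 'r) ring_scheme" and M :: "('a, 'b, 'm) module_scheme"
    and P :: "nat \<Rightarrow> ('a, ('a + 'b) list) module"
  assumes P: "projective_resolution R M P d e"
    and F: "free_resolves R n d' M e'" "e' ` vectors R (n 0) = carrier M"
  shows "\<exists>\<psi>. chain_map R P d (free_sequence R n) d' \<psi> \<and>
    (\<forall>k f. free_cocycle R n d' k f \<longrightarrow>
      coboundary R P d k (\<lambda>x. f (\<psi> k x)) = free_coboundary R n d' k f) \<and>
    (\<forall>k u. cocycle R P d k u \<longrightarrow> (\<exists>f. free_cocycle R n d' k f \<and>
        coboundary R P d k (\<lambda>x. u x \<ominus>\<^bsub>R\<^esub> f (\<psi> k x))))"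
proof -
  have M: "left_module R M" by (rule resolvesD(2)[OF F(1)])
  note L = left_module_free[OF left_module_ring[OF M]]
  note P' = projective_resolution_resolves[OF P M]
  have proj: "projective_module R (P k)" for k using P by (simp add: projective_resolution_def)
  note PL = exact_complexD(1)[OF resolvesD(1)[OF P'(1)]]
  have i: "inj_on (map Inl) X" "inj_on (\<lambda>x. [Inr x]) Y"
    for X :: "'a list set" and Y :: "('a + 'b) list set"
    by (auto intro!: inj_onI simp: inj_map_eq_map)
  note lF = lifts_projective[OF proj L _ i(1)] and lP = lifts_projective[OF proj PL PL i(2)]
    and fl = lifts_free_module[OF PL] lifts_free_module[OF L L]
  show ?thesis
    using F(2) P'(2)
    by (intro comparison_cohomology[OF P'(1) F(1)] lF[OF M] lF[OF L] fl(1)[OF M] fl(1)[OF PL] fl(2) lP) simp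
qed


section \<open>Projective dimension and grade in terms of free resolutions\<close>

lemma copy_free_resolution:
  fixes i :: "'a list \<Rightarrow> 'p"
  assumes F: "free_resolves R n d M e" "e ` vectors R (n 0) = carrier M"
    and i: "inj i"
  shows "\<exists>d' e'. projective_resolution R M (\<lambda>k. copy_module i (free_module R (n k))) d' e'"
proof -
  note FD = resolvesD[OF F(1)] and FE = exact_complexD[OF resolvesD(1)[OF F(1)]]
  have R: "ring R" by (rule left_module_ring[OF FE(1)])
  note L = left_module_free[OF R]
  have inj: "inj_on i X" for X using i by (rule inj_on_subset) simp
  note C = copy_module_maps[OF L inj]
  define j where "j k = inv_into (vectors R (n k)) i" for k
  have j: "j k \<in> linear_maps R (copy_module i (free_module R (n k))) (free_module R (n k))" for k
    unfolding j_def by (rule C(2))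
  have ji: "j k (i x) = x" if "x \<in> vectors R (n k)" for k x
    unfolding j_def using that by (simp add: inv_into_f_f[OF inj])
  have iz: "i x = i y \<longleftrightarrow> x = y" for x y using i by (auto simp: inj_eq)
  have im: "i ` {x \<in> vectors R (n k). Q x} =
      {y \<in> i ` vectors R (n k). Q (j k y)}" for k Q
    using ji by auto
  have "projective_resolution R M (\<lambda>k. copy_module i (free_module R (n k)))
      (\<lambda>k x. i (d k (j (Suc k) x))) (\<lambda>x. e (j 0 x))"
    unfolding projective_resolution_def a_kernel_def'
  proof (intro conjI allI)
    show "projective_module R (copy_module i (free_module R (n k)))" for k
      by (rule projective_copy_free[OF R inj])
    show "(\<lambda>x. i (d k (j (Suc k) x))) \<in> linear_maps R (copy_module i (free_module R (n (Suc k))))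
        (copy_module i (free_module R (n k)))" for k
      by (rule linear_maps_comp[OF linear_maps_comp[OF j FE(2)] C(1)])
    show "(\<lambda>x. e (j 0 x)) \<in> linear_maps R (copy_module i (free_module R (n 0))) M"
      by (rule linear_maps_comp[OF j FD(3)])
    show "(\<lambda>x. e (j 0 x)) ` carrier (copy_module i (free_module R (n 0))) = carrier M"
      using F(2) ji by (simp add: image_image cong: image_cong)
    have dim: "(\<lambda>x. i (d k (j (Suc k) x))) ` carrier (copy_module i (free_module R (n (Suc k)))) =
        i ` d k ` vectors R (n (Suc k))" for k
      using ji by (simp add: image_image cong: image_cong)
    show "(\<lambda>x. i (d 0 (j (Suc 0) x))) ` carrier (copy_module i (free_module R (n (Suc 0)))) =
        {x \<in> carrier (copy_module i (free_module R (n 0))). e (j 0 x) = \<zero>\<^bsub>M\<^esub>}"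
      unfolding dim FD(4) im by simp
    show "(\<lambda>x. i (d (Suc k) (j (Suc (Suc k)) x))) ` carrier (copy_module i (free_module R (n (Suc (Suc k))))) =
        {x \<in> carrier (copy_module i (free_module R (n (Suc k)))).
          i (d k (j (Suc k) x)) = \<zero>\<^bsub>copy_module i (free_module R (n k))\<^esub>}" for k
      unfolding dim FE(3) im by (simp add: iz)
  qed
  then show ?thesis by blast
qed

text \<open>A copy of the free resolution shows that projective resolutions of the required type exist, so
  that \<open>ext_module\<close> is computed from one of them, possibly another.\<close>

lemma ext_module_resolution:
  fixes R :: "('a, 'r) ring_scheme" and M :: "('a, 'b, 'm) module_scheme"
  assumes F: "free_resolves R n d M e" "e ` vectors R (n 0) = carrier M"
  shows "\<exists>(P :: nat \<Rightarrow> ('a, ('a + 'b) list) module) d e. projective_resolution R M P d e \<and>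
    (\<forall>k. ext_module R M k = dual_cohomology R P d k)"
proof -
  have inj: "inj (map Inl :: 'a list \<Rightarrow> ('a + 'b) list)" by (auto intro!: injI simp: inj_map_eq_map)
  define Q where "Q = (\<lambda>(P :: nat \<Rightarrow> ('a, ('a + 'b) list) module, d). \<exists>e. projective_resolution R M P d e)"
  have "\<exists>x. Q x" unfolding Q_def using copy_free_resolution[OF F inj] by auto
  then have "Q (SOME x. Q x)" by (rule someI_ex)
  moreover obtain P d where Pd: "(SOME x. Q x) = (P, d)" by (cases "SOME x. Q x")
  ultimately have "\<exists>e. projective_resolution R M P d e" by (simp add: Q_def)
  moreover have "ext_module R M k = dual_cohomology R P d k" for k
    using Pd unfolding ext_module_def Q_def by simp
  ultimately show ?thesis by blast
qed

lemma ext_module_trivial_iff: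
  fixes R :: "('a, 'r) ring_scheme" and M :: "('a, 'b, 'm) module_scheme"
  assumes F: "free_resolves R n d M e" "e ` vectors R (n 0) = carrier M"
  shows "trivial_module (ext_module R M k) \<longleftrightarrow> free_ext_vanishes R n d k"
proof -
  obtain P :: "nat \<Rightarrow> ('a, ('a + 'b) list) module" and dP eP where
    P: "projective_resolution R M P dP eP" "\<forall>k. ext_module R M k = dual_cohomology R P dP k"
    using ext_module_resolution[OF F] by (elim exE conjE) (rule that)
  have ex: "exact_complex R P dP"
    using resolvesD(1)[OF projective_resolution_resolves(1)[OF P(1) resolvesD(2)[OF F(1)]]] .
  have R: "ring R" by (rule left_module_ring[OF exact_complexD(1)[OF ex]])
  obtain \<psi> where \<psi>: "chain_map R P dP (free_sequence R n) d \<psi>"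
    "\<forall>k f. free_cocycle R n d k f \<longrightarrow>
      coboundary R P dP k (\<lambda>x. f (\<psi> k x)) = free_coboundary R n d k f"
    "\<forall>k u. cocycle R P dP k u \<longrightarrow> (\<exists>f. free_cocycle R n d k f \<and>
        coboundary R P dP k (\<lambda>x. u x \<ominus>\<^bsub>R\<^esub> f (\<psi> k x)))"
    using free_projective_comparison[OF P(1) F] by (elim exE conjE) (rule that)
  have "ext_vanishes R P dP k \<longleftrightarrow> free_ext_vanishes R n d k"
  proof
    assume "ext_vanishes R P dP k"
    then show "free_ext_vanishes R n d k"
      using \<psi>(2) cocycle_pullback[OF \<psi>(1)] unfolding ext_vanishes_def by blast
  next
    assume v: "free_ext_vanishes R n d k"
    show "ext_vanishes R P dP k" unfolding ext_vanishes_def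
    proof (intro allI impI)
      fix u assume u: "cocycle R P dP k u"
      then obtain f where f: "free_cocycle R n d k f"
        "coboundary R P dP k (\<lambda>x. u x \<ominus>\<^bsub>R\<^esub> f (\<psi> k x))" using \<psi>(3) by blast
      have "coboundary R P dP k (\<lambda>x. f (\<psi> k x))" using v f(1) \<psi>(2) unfolding ext_vanishes_def by blast
      then show "coboundary R P dP k u"
        using coboundary_diff_trans[where d=dP, OF R exact_complexD(2)[OF ex] f(2)]
          u cocycle_pullback[OF \<psi>(1) f(1)] by (simp add: cocycle_def)
    qed
  qed
  then show ?thesis using trivial_dual_cohomology_iff[OF ex] P(2) by simp
qed

lemma ext_trivial_below_grade:
  assumes "enat k < grade R M"
  shows "trivial_module (ext_module R M k)"
proof (rule ccontr)
  assume "\<not> trivial_module (ext_module R M k)"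
  then have "grade R M \<le> enat k" unfolding grade_def by (intro Inf_lower) auto
  with assms show False by simp
qed

text \<open>The condition \<open>d k \<circ> h \<circ> d k = d k\<close> says that the image of \<open>d k\<close>, the syzygy of order
  \<open>Suc k\<close>, is a direct summand. If \<open>P\<close> is a projective resolution of length at most \<open>k\<close>, then
  comparing through \<open>P\<close> vanishes in degree \<open>Suc k\<close>, and the homotopy to the identity provides \<open>h\<close>.\<close>

lemma pdim_le_imp_split:
  fixes R :: "('a, 'r) ring_scheme" and M :: "('a, 'b, 'm) module_scheme"
  assumes F: "free_resolves R n d M e" "e ` vectors R (n 0) = carrier M"
    and pd: "pdim R M \<le> enat l" and k: "l \<le> k"
  shows "\<exists>h\<in>free_maps R (n k) (n (Suc k)).
    \<forall>x\<in>vectors R (n (Suc k)). d k (h (d k x)) = d k x"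
proof -
  let ?F = "free_sequence R n"
  let ?S = "{l. \<exists>(P :: nat \<Rightarrow> ('a, ('a + 'b) list) module) d e.
     projective_resolution R M P d e \<and> (\<forall>q>l. trivial_module (P q))}"
  have M: "left_module R M" by (rule resolvesD(2)[OF F(1)])
  have ne: "enat ` ?S \<noteq> {}"
  proof
    assume "enat ` ?S = {}"
    then have "pdim R M = \<infinity>" unfolding pdim_def Inf_enat_def by (rule if_P)
    with pd show False by simp
  qed
  then have "pdim R M = (LEAST x. x \<in> enat ` ?S)" unfolding pdim_def Inf_enat_def by (rule if_not_P)
  then have "pdim R M \<in> enat ` ?S" using ne by (metis (no_types, lifting) LeastI_ex ex_in_conv)
  then obtain l' where l': "l' \<in> ?S" "pdim R M = enat l'" by blast
  then obtain P :: "nat \<Rightarrow> ('a, ('a + 'b) list) module" and dP eP where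
    P: "projective_resolution R M P dP eP" and Pt: "\<forall>q>l'. trivial_module (P q)" by blast
  have l'k: "l' \<le> k" using pd k l'(2) by simp
  note P' = projective_resolution_resolves[OF P M]
  note PE = exact_complexD[OF resolvesD(1)[OF P'(1)]] and FE = exact_complexD[OF resolvesD(1)[OF F(1)]]
  note L = left_module_free[OF left_module_ring[OF M]]
  have proj: "projective_module R (P k)" for k using P by (simp add: projective_resolution_def)
  have i: "inj_on (map Inl) X" for X :: "'a list set" by (auto intro!: inj_onI simp: inj_map_eq_map)
  obtain \<psi> where \<psi>: "chain_map R P dP ?F d \<psi>" "\<forall>x\<in>carrier (P 0). e (\<psi> 0 x) = eP x"
    using comparison_map[OF P'(1) F(1) _ lifts_projective[OF proj L M i] lifts_projective[OF proj L L i]] F(2) P'(2)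
    by auto
  obtain \<phi> where \<phi>: "chain_map R ?F d P dP \<phi>" "\<forall>x\<in>carrier (?F 0). eP (\<phi> 0 x) = e x"
    using comparison_map[OF F(1) P'(1) _ lifts_free_module[OF PE(1) M] lifts_free_module[OF PE(1) PE(1)]] F(2) P'(2)
    by auto
  note c = linear_mapsD(1)[OF chain_mapD(1)[OF \<phi>(1)]]
  have eq: "\<forall>x\<in>carrier (?F 0). e x = e (\<psi> 0 (\<phi> 0 x))" using \<phi>(2) \<psi>(2) c by auto
  obtain s where s: "\<forall>k. s k \<in> linear_maps R (?F k) (?F (Suc k))"
    "\<forall>x\<in>carrier (?F 0). d 0 (s 0 x) = x \<ominus>\<^bsub>?F 0\<^esub> \<psi> 0 (\<phi> 0 x)"
    "\<forall>k. \<forall>x\<in>carrier (?F (Suc k)). d (Suc k) (s (Suc k) x) =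
      (x \<ominus>\<^bsub>?F (Suc k)\<^esub> \<psi> (Suc k) (\<phi> (Suc k) x)) \<ominus>\<^bsub>?F (Suc k)\<^esub> s k (d k x)"
    using chain_homotopy[OF F(1) F(1) chain_map_ident chain_map_comp[OF \<phi>(1) \<psi>(1)] eq lifts_free_module[OF L L]]
    by (elim exE conjE) (rule that)
  have "d k (s k (d k x)) = d k x" if x: "x \<in> carrier (?F (Suc k))" for x
  proof -
    interpret Fk: left_module R "?F k" by (rule L)
    have dx: "d k x \<in> carrier (?F k)" by (rule linear_mapsD(1)[OF FE(2) x])
    have minus_zero: "y \<ominus>\<^bsub>?F k\<^esub> \<zero>\<^bsub>?F k\<^esub> = y" if "y \<in> carrier (?F k)" for y
      using that Fk.M.minus_eq Fk.M.a_inv_closed Fk.M.r_zero Fk.M.l_zero Fk.M.r_neg Fk.M.zero_closed by metis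
    have "\<phi> (Suc k) x = \<zero>\<^bsub>P (Suc k)\<^esub>"
      using c[OF x] Pt l'k by (simp add: trivial_module_def)
    then have "\<phi> k (d k x) = \<zero>\<^bsub>P k\<^esub>"
      using chain_mapD(2)[OF \<phi>(1) x] linear_maps_zero[OF PE(1) PE(1) PE(2)[of k]] by simp
    then have 0: "\<psi> k (\<phi> k (d k x)) = \<zero>\<^bsub>?F k\<^esub>"
      using linear_maps_zero[OF PE(1) L chain_mapD(1)[OF \<psi>(1)]] by simp
    show ?thesis
    proof (cases k)
      case k0: 0
      have "d k (s k (d k x)) = d k x \<ominus>\<^bsub>?F k\<^esub> \<psi> k (\<phi> k (d k x))"
        using s(2)[rule_format, of "d k x"] dx unfolding k0 by blast
      also have "\<dots> = d k x" unfolding 0 by (rule minus_zero[OF dx])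
      finally show ?thesis .
    next
      case (Suc j)
      have x': "x \<in> carrier (?F (Suc (Suc j)))" using x unfolding Suc .
      have "d k (s k (d k x)) = (d k x \<ominus>\<^bsub>?F k\<^esub> \<psi> k (\<phi> k (d k x))) \<ominus>\<^bsub>?F k\<^esub> s j (d j (d k x))"
        using s(3)[rule_format, of "d k x" j] dx unfolding Suc by blast
      also have "s j (d j (d k x)) = \<zero>\<^bsub>?F k\<^esub>"
        using FE(4)[OF x'] linear_maps_zero[OF L L s(1)[rule_format, of j]] unfolding Suc by simp
      also have "(d k x \<ominus>\<^bsub>?F k\<^esub> \<psi> k (\<phi> k (d k x))) \<ominus>\<^bsub>?F k\<^esub> \<zero>\<^bsub>?F k\<^esub> = d k x"
        unfolding 0 minus_zero[OF dx] ..
      finally show ?thesis .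
    qed
  qed
  then show ?thesis using s(1) by blast
qed

text \<open>The vector \<open>x - h (d k x)\<close> is a cycle, hence a boundary, so a cocycle \<open>f\<close> agrees with
  \<open>f \<circ> h\<close> composed with \<open>d k\<close>.\<close>

lemma split_imp_ext_vanishes:
  assumes ex: "exact_complex R P d" and h: "h \<in> linear_maps R (P k) (P (Suc k))"
    "\<And>x. x \<in> carrier (P (Suc k)) \<Longrightarrow> d k (h (d k x)) = d k x"
  shows "ext_vanishes R P d (Suc k)"
  unfolding ext_vanishes_def
proof (intro allI impI)
  note E = exact_complexD[OF ex]
  interpret P: left_module R "P (Suc k)" by (rule E(1))
  interpret Q: left_module R "P k" by (rule E(1))
  have R: "ring R" by (rule left_module_ring[OF E(1)])
  fix f assume "cocycle R P d (Suc k) f"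
  then have f: "f \<in> functionals R (P (Suc k))"
    and f0: "\<And>x. x \<in> carrier (P (Suc (Suc k))) \<Longrightarrow> f (d (Suc k) x) = \<zero>\<^bsub>R\<^esub>"
    by (auto simp: cocycle_def)
  have "f x = f (h (d k x))" if x: "x \<in> carrier (P (Suc k))" for x
  proof -
    have hd: "h (d k x) \<in> carrier (P (Suc k))"
      by (rule linear_mapsD(1)[OF linear_maps_comp[OF E(2) h(1)] x])
    have dx: "d k x \<in> carrier (P k)" by (rule linear_mapsD(1)[OF E(2) x])
    have "d k (x \<ominus>\<^bsub>P (Suc k)\<^esub> h (d k x)) = \<zero>\<^bsub>P k\<^esub>"
      using linear_maps_minus(2)[OF E(1) E(1) E(2) hd x] h(2)[OF x] dx by (simp add: Q.M.minus_eq Q.M.r_neg)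
    moreover have c: "x \<ominus>\<^bsub>P (Suc k)\<^esub> h (d k x) \<in> carrier (P (Suc k))" using x hd by simp
    ultimately have "x \<ominus>\<^bsub>P (Suc k)\<^esub> h (d k x) \<in> d (Suc k) ` carrier (P (Suc (Suc k)))" unfolding E(3) by simp
    then have "f (x \<ominus>\<^bsub>P (Suc k)\<^esub> h (d k x)) = \<zero>\<^bsub>R\<^esub>" using f0 by auto
    then have "f x \<ominus>\<^bsub>R\<^esub> f (h (d k x)) = \<zero>\<^bsub>R\<^esub>"
      using linear_maps_minus(2)[OF E(1) left_module_regular[OF R] f hd x] by simp
    then show ?thesis
      using linear_mapsD(1)[OF f x] linear_mapsD(1)[OF f hd]
      by (metis P.R.a_inv_closed P.R.minus_eq P.R.minus_equality P.R.minus_minus regular_module_simps(1))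
  qed
  then show "coboundary R P d (Suc k) f"
    unfolding coboundary_Suc using linear_maps_comp[OF h(1) f] by (intro bexI[of _ "\<lambda>x. f (h x)"]) auto
qed

section \<open>Mapping cones\<close>

lemma take_linear: "take a \<in> free_maps R (a + b) a"
  by (intro linear_mapsI) (auto simp: free_module_carrier take_map take_zip dest: in_set_takeD)

lemma drop_linear: "drop a \<in> free_maps R (a + b) b"
  by (intro linear_mapsI) (auto simp: free_module_carrier drop_map drop_zip dest: in_set_dropD)

lemma append_linear:
  assumes "f \<in> linear_maps R M (free_module R a)" "g \<in> linear_maps R M (free_module R b)"
  shows "(\<lambda>x. f x @ g x) \<in> linear_maps R M (free_module R (a + b))"
proof (rule linear_mapsI)
  note l = linear_mapsD[OF assms(1)] linear_mapsD[OF assms(2)]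
  show "f x @ g x \<in> vectors R (a + b)" if "x \<in> carrier M" for x
    using l(1)[OF that] l(4)[OF that] by (auto simp: free_module_carrier)
  show "f (x \<oplus>\<^bsub>M\<^esub> y) @ g (x \<oplus>\<^bsub>M\<^esub> y) = (f x @ g x) \<oplus>\<^bsub>free_module R (a + b)\<^esub> (f y @ g y)"
    if "x \<in> carrier M" "y \<in> carrier M" for x y
    using l(1)[OF that(1)] l(1)[OF that(2)] l(2)[OF that] l(5)[OF that] by (simp add: free_module_carrier)
  show "f (c \<odot>\<^bsub>M\<^esub> x) @ g (c \<odot>\<^bsub>M\<^esub> x) = c \<odot>\<^bsub>free_module R (a + b)\<^esub> (f x @ g x)"
    if "c \<in> carrier R" "x \<in> carrier M" for x c
    using l(3)[OF that] l(6)[OF that] by simp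
qed

lemma free_module_append:
  assumes "y \<in> vectors R a" "x \<in> vectors R b"
  shows "y @ x \<in> vectors R (a + b)" "take a (y @ x) = y" "drop a (y @ x) = x"
  using assms by (auto simp: free_module_carrier)

lemma free_module_split:
  assumes "z \<in> vectors R (a + b)"
  shows "take a z \<in> vectors R a" "drop a z \<in> vectors R b"
    "take a z @ drop a z = z"
  using linear_mapsD(1)[OF take_linear assms] linear_mapsD(1)[OF drop_linear assms] by auto

lemma functional_append:
  assumes "ring R" "f \<in> linear_maps R (free_module R (a + b)) L"
    "y \<in> vectors R a" "x \<in> vectors R b"
  shows "f (y @ x) = f (y @ \<zero>\<^bsub>free_module R b\<^esub>) \<oplus>\<^bsub>L\<^esub> f (\<zero>\<^bsub>free_module R a\<^esub> @ x)"
proof -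
  interpret A: left_module R "free_module R a" by (rule left_module_free[OF assms(1)])
  interpret B: left_module R "free_module R b" by (rule left_module_free[OF assms(1)])
  have "y @ x = (y @ \<zero>\<^bsub>free_module R b\<^esub>) \<oplus>\<^bsub>free_module R (a + b)\<^esub> (\<zero>\<^bsub>free_module R a\<^esub> @ x)"
    using A.M.r_zero[OF assms(3)] B.M.l_zero[OF assms(4)] assms(3,4) by (simp add: free_module_carrier)
  then show ?thesis
    using linear_mapsD(2)[OF assms(2) free_module_append(1)[OF assms(3) B.M.zero_closed]
        free_module_append(1)[OF A.M.zero_closed assms(4)]] by simp
qed

lemma append_zero_linear:
  assumes "ring R"
  shows "(\<lambda>y. y @ \<zero>\<^bsub>free_module R b\<^esub>) \<in> free_maps R a (a + b)"
    and "(\<lambda>x. \<zero>\<^bsub>free_module R a\<^esub> @ x) \<in> free_maps R b (a + b)"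
  by (rule append_linear[OF linear_maps_ident linear_maps_const_zero[OF left_module_free[OF assms]]])
    (rule append_linear[OF linear_maps_const_zero[OF left_module_free[OF assms]] linear_maps_ident])

text \<open>The complex \<open>X\<close> moved up by one degree; it is zero in degree 0.\<close>

definition shifted_rank :: "(nat \<Rightarrow> nat) \<Rightarrow> nat \<Rightarrow> nat" where
  "shifted_rank n k = (case k of 0 \<Rightarrow> 0 | Suc j \<Rightarrow> n j)"

definition shifted_map :: "(nat \<Rightarrow> 'a list \<Rightarrow> 'a list) \<Rightarrow> nat \<Rightarrow> 'a list \<Rightarrow> 'a list" where
  "shifted_map d k = (case k of 0 \<Rightarrow> (\<lambda>x. []) | Suc j \<Rightarrow> d j)"

definition cone_rank :: "(nat \<Rightarrow> nat) \<Rightarrow> (nat \<Rightarrow> nat) \<Rightarrow> nat \<Rightarrow> nat" where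
  "cone_rank nY nX k = nY k + shifted_rank nX k"

text \<open>The differential \<open>(y, x) \<mapsto> (d y + \<phi> x, - d x)\<close> on pairs written as concatenated lists.\<close>

definition cone_map ::
  "('a, 'r) ring_scheme \<Rightarrow> (nat \<Rightarrow> nat) \<Rightarrow> (nat \<Rightarrow> 'a list \<Rightarrow> 'a list) \<Rightarrow> (nat \<Rightarrow> nat) \<Rightarrow>
   (nat \<Rightarrow> 'a list \<Rightarrow> 'a list) \<Rightarrow> (nat \<Rightarrow> 'a list \<Rightarrow> 'a list) \<Rightarrow> nat \<Rightarrow> 'a list \<Rightarrow> 'a list" where
  "cone_map R nY dY nX dX \<phi> k z =
    (dY k (take (nY (Suc k)) z) \<oplus>\<^bsub>free_module R (nY k)\<^esub> \<phi> k (drop (nY (Suc k)) z)) @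
    (\<ominus>\<^bsub>free_module R (shifted_rank nX k)\<^esub> shifted_map dX k (drop (nY (Suc k)) z))"

lemma shifted_rank_simps [simp]: "shifted_rank n 0 = 0" "shifted_rank n (Suc k) = n k"
  by (auto simp: shifted_rank_def)

lemma shifted_map_simps [simp]: "shifted_map d 0 x = []" "shifted_map d (Suc k) = d k"
  by (auto simp: shifted_map_def)

context
  fixes R :: "('a, 'r) ring_scheme" and M :: "('a, 'b, 'm) module_scheme" and nX nY dX dY eX eY \<phi>
  assumes X: "free_resolves R nX dX M eX"
    and Y: "free_resolves R nY dY M eY"
    and \<phi>: "free_chain_map R nX dX nY dY \<phi>"
    and \<phi>0: "\<forall>x\<in>vectors R (nX 0). eY (\<phi> 0 x) = eX x"
begin

private abbreviation (input) "C \<equiv> free_sequence R (cone_rank nY nX)"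
private abbreviation (input) "D \<equiv> cone_map R nY dY nX dX \<phi>"
private abbreviation (input) "F \<equiv> free_module R"

private lemma R: "ring R"
  by (rule left_module_ring[OF resolvesD(2)[OF X]])

private lemma FL: "left_module R (F j)"
  by (rule left_module_free[OF R])

private lemma XL: "dX k \<in> linear_maps R (F (nX (Suc k))) (F (nX k))"
  using exact_complexD(2)[OF resolvesD(1)[OF X]] .

private lemma YL: "dY k \<in> linear_maps R (F (nY (Suc k))) (F (nY k))"
  using exact_complexD(2)[OF resolvesD(1)[OF Y]] .

private lemma shL: "shifted_map dX k \<in> linear_maps R (F (nX k)) (F (shifted_rank nX k))"
proof (cases k)
  case 0
  have "(\<lambda>x. \<zero>\<^bsub>F 0\<^esub>) \<in> linear_maps R (F (nX 0)) (F 0)"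
    by (rule linear_maps_const_zero[OF FL])
  then show ?thesis using 0 by (simp add: shifted_map_def)
qed (simp add: XL)

private lemma negL: "(\<lambda>x. \<ominus>\<^bsub>F (shifted_rank nX k)\<^esub> shifted_map dX k x) \<in>
    linear_maps R (F (nX k)) (F (shifted_rank nX k))"
  by (rule linear_maps_neg[OF FL shL])

private lemma C_Suc: "C (Suc k) = F (nY (Suc k) + nX k)"
  by (simp add: cone_rank_def)

private lemma C_k: "C k = F (nY k + shifted_rank nX k)"
  by (simp add: cone_rank_def)

private lemma tl: "take (nY (Suc k)) \<in> linear_maps R (C (Suc k)) (F (nY (Suc k)))"
  and dl: "drop (nY (Suc k)) \<in> linear_maps R (C (Suc k)) (F (nX k))"
  unfolding C_Suc by (rule take_linear, rule drop_linear)

private lemma DL: "D k \<in> linear_maps R (C (Suc k)) (C k)"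
proof -
  have "(\<lambda>z. (dY k (take (nY (Suc k)) z) \<oplus>\<^bsub>F (nY k)\<^esub> \<phi> k (drop (nY (Suc k)) z)) @
     (\<ominus>\<^bsub>F (shifted_rank nX k)\<^esub> shifted_map dX k (drop (nY (Suc k)) z)))
     \<in> linear_maps R (C (Suc k)) (F (nY k + shifted_rank nX k))"
    by (intro append_linear linear_maps_plus[OF FL] linear_maps_comp[OF tl YL]
        linear_maps_comp[OF dl chain_mapD(1)[OF \<phi>]] linear_maps_comp[OF dl negL])
  moreover have "D k = (\<lambda>z. (dY k (take (nY (Suc k)) z) \<oplus>\<^bsub>F (nY k)\<^esub> \<phi> k (drop (nY (Suc k)) z)) @
     (\<ominus>\<^bsub>F (shifted_rank nX k)\<^esub> shifted_map dX k (drop (nY (Suc k)) z)))"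
    by (rule ext) (simp add: cone_map_def)
  ultimately show ?thesis by (simp only: C_k)
qed

private lemma D_append:
  assumes "y \<in> carrier (F (nY (Suc k)))"
  shows "D k (y @ x) = (dY k y \<oplus>\<^bsub>F (nY k)\<^esub> \<phi> k x) @ (\<ominus>\<^bsub>F (shifted_rank nX k)\<^esub> shifted_map dX k x)"
  using assms by (simp add: cone_map_def free_module_carrier)

private lemma C_cases:
  assumes "z \<in> carrier (C (Suc k))"
  obtains y x where "z = y @ x" "y \<in> carrier (F (nY (Suc k)))" "x \<in> carrier (F (nX k))"
  using free_module_split[OF assms[unfolded C_Suc]] that by metis

private lemma sh_zero: "shifted_map dX k (dX k x) = \<zero>\<^bsub>F (shifted_rank nX k)\<^esub>"
  if "x \<in> carrier (F (nX (Suc k)))"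
proof (cases k)
  case (Suc j)
  then show ?thesis using exact_complexD(4)[OF resolvesD(1)[OF X], of x j] that by simp
qed simp

text \<open>The cokernel of the last differential is the cokernel of the map of augmented modules: the cone
  resolves the quotient of the module covered by \<open>eY\<close> by the one covered by \<open>eX\<close>.\<close>

lemma cone_augmentation_image:
  "D 0 ` carrier (C (Suc 0)) = {y \<in> carrier (C 0). eY y \<in> eX ` carrier (F (nX 0))}"
proof -
  interpret M: left_module R M by (rule resolvesD(2)[OF X])
  interpret Y0: left_module R "F (nY 0)" by (rule FL)
  have neg0: "\<ominus>\<^bsub>F 0\<^esub> [] = []"
    using linear_mapsD(1)[OF negL, of _ 0] Y0.M.zero_closed
      abelian_group.a_inv_closed[OF left_module_group[OF left_module_free[OF R, of 0]], of "[]"] by simp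
  have C0: "C 0 = F (nY 0)" by (simp add: cone_rank_def)
  note eYL = resolvesD(3)[OF Y] and \<phi>L = chain_mapD(1)[OF \<phi>, of 0]
  have D0: "D 0 (y @ x) = dY 0 y \<oplus>\<^bsub>F (nY 0)\<^esub> \<phi> 0 x" if "y \<in> carrier (F (nY (Suc 0)))" for x y
    unfolding D_append[OF that] using neg0 by simp
  show ?thesis
  proof (intro equalityI subsetI)
    fix w assume "w \<in> D 0 ` carrier (C (Suc 0))"
    then obtain y x where w: "w = D 0 (y @ x)" "y \<in> carrier (F (nY (Suc 0)))" "x \<in> carrier (F (nX 0))"
      by (auto elim!: C_cases)
    have c: "dY 0 y \<in> carrier (F (nY 0))" "\<phi> 0 x \<in> carrier (F (nY 0))"
      using linear_mapsD(1)[OF YL w(2)] linear_mapsD(1)[OF \<phi>L w(3)] by auto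
    have "eY w = eX x"
      using linear_mapsD(2)[OF eYL c] resolvesD(5)[OF Y w(2)] \<phi>0 w(3) linear_mapsD(1)[OF resolvesD(3)[OF X] w(3)]
      unfolding w(1) D0[OF w(2)] by simp
    then show "w \<in> {y \<in> carrier (C 0). eY y \<in> eX ` carrier (F (nX 0))}"
      using w c Y0.M.a_closed[OF c] unfolding C0 w(1) D0[OF w(2)] by auto
  next
    fix w assume "w \<in> {y \<in> carrier (C 0). eY y \<in> eX ` carrier (F (nX 0))}"
    then obtain x where w: "w \<in> carrier (F (nY 0))" "x \<in> carrier (F (nX 0))" "eY w = eX x"
      unfolding C0 by auto
    have px: "\<phi> 0 x \<in> carrier (F (nY 0))" by (rule linear_mapsD(1)[OF \<phi>L w(2)])
    have "eY (w \<ominus>\<^bsub>F (nY 0)\<^esub> \<phi> 0 x) = eX x \<ominus>\<^bsub>M\<^esub> eX x"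
      using linear_maps_minus(2)[OF FL resolvesD(2)[OF X] eYL px w(1)] \<phi>0 w by simp
    also have "\<dots> = \<zero>\<^bsub>M\<^esub>"
      using linear_mapsD(1)[OF resolvesD(3)[OF X] w(2)] by (simp add: M.M.minus_eq M.M.r_neg)
    finally have "w \<ominus>\<^bsub>F (nY 0)\<^esub> \<phi> 0 x \<in> dY 0 ` carrier (F (nY (Suc 0)))"
      using Y0.M.minus_closed[OF w(1) px] resolvesD(4)[OF Y] by simp
    then obtain y where y: "y \<in> carrier (F (nY (Suc 0)))" "w \<ominus>\<^bsub>F (nY 0)\<^esub> \<phi> 0 x = dY 0 y" by auto
    have "D 0 (y @ x) = w"
      unfolding D0[OF y(1)] y(2)[symmetric] using w(1) px
      by (simp add: Y0.M.minus_eq Y0.M.a_assoc Y0.M.l_neg del: free_module_simps)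
    moreover have "y @ x \<in> carrier (C (Suc 0))"
      unfolding C_Suc by (rule free_module_append(1)[OF y(1) w(2)])
    ultimately show "w \<in> D 0 ` carrier (C (Suc 0))" by blast
  qed
qed

text \<open>At the lower end, exactness needs that the map of augmented modules is injective. This holds
  because both augmentations take values in the same module \<open>M\<close> and are compatible with \<open>\<phi>\<close>.\<close>

lemma cone_exact: "exact_complex R C D"
  unfolding exact_complex_def
proof (intro conjI allI)
  show "left_module R (C k)" for k by (rule FL)
  show "D k \<in> linear_maps R (C (Suc k)) (C k)" for k by (rule DL)
next
  fix k
  interpret Yk: left_module R "F (nY k)" by (rule FL)
  interpret Yk1: left_module R "F (nY (Suc k))" by (rule FL)
  interpret Xk: left_module R "F (nX k)" by (rule FL)
  interpret Xk1: left_module R "F (nX (Suc k))" by (rule FL)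
  interpret S: left_module R "F (shifted_rank nX k)" by (rule FL)
  interpret M: left_module R M by (rule resolvesD(2)[OF X])
  note p = chain_mapD(1)[OF \<phi>, of k] chain_mapD(1)[OF \<phi>, of "Suc k"]
  have Dzero: "D k (y @ x) = \<zero>\<^bsub>C k\<^esub> \<longleftrightarrow> dY k y \<oplus>\<^bsub>F (nY k)\<^esub> \<phi> k x = \<zero>\<^bsub>F (nY k)\<^esub> \<and>
      shifted_map dX k x = \<zero>\<^bsub>F (shifted_rank nX k)\<^esub>"
    if y: "y \<in> carrier (F (nY (Suc k)))" and x: "x \<in> carrier (F (nX k))" for x y
  proof -
    have c: "dY k y \<oplus>\<^bsub>F (nY k)\<^esub> \<phi> k x \<in> carrier (F (nY k))"
      using linear_mapsD(1)[OF YL y] linear_mapsD(1)[OF p(1) x] by (rule Yk.M.a_closed)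
    have sc: "shifted_map dX k x \<in> carrier (F (shifted_rank nX k))" by (rule linear_mapsD(1)[OF shL x])
    have "\<zero>\<^bsub>C k\<^esub> = \<zero>\<^bsub>F (nY k)\<^esub> @ \<zero>\<^bsub>F (shifted_rank nX k)\<^esub>"
      by (simp add: cone_rank_def replicate_add)
    then have "D k (y @ x) = \<zero>\<^bsub>C k\<^esub> \<longleftrightarrow> dY k y \<oplus>\<^bsub>F (nY k)\<^esub> \<phi> k x = \<zero>\<^bsub>F (nY k)\<^esub> \<and>
        \<ominus>\<^bsub>F (shifted_rank nX k)\<^esub> shifted_map dX k x = \<zero>\<^bsub>F (shifted_rank nX k)\<^esub>"
      unfolding D_append[OF y] using c by (simp add: free_module_carrier)
    also have "\<ominus>\<^bsub>F (shifted_rank nX k)\<^esub> shifted_map dX k x = \<zero>\<^bsub>F (shifted_rank nX k)\<^esub> \<longleftrightarrow>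
        shifted_map dX k x = \<zero>\<^bsub>F (shifted_rank nX k)\<^esub>"
      using sc by (metis S.M.minus_minus S.M.l_zero S.M.r_neg S.M.a_inv_closed S.M.zero_closed)
    finally show ?thesis .
  qed
  show "D (Suc k) ` carrier (C (Suc (Suc k))) = {z \<in> carrier (C (Suc k)). D k z = \<zero>\<^bsub>C k\<^esub>}"
  proof (intro equalityI subsetI)
    fix w assume "w \<in> D (Suc k) ` carrier (C (Suc (Suc k)))"
    then obtain z where z: "z \<in> carrier (C (Suc (Suc k)))" "w = D (Suc k) z" by blast
    obtain y x where yx: "z = y @ x" "y \<in> carrier (F (nY (Suc (Suc k))))" "x \<in> carrier (F (nX (Suc k)))"
      by (rule C_cases[OF z(1)])
    have w: "w = D (Suc k) (y @ x)" "y \<in> carrier (F (nY (Suc (Suc k))))"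
      "x \<in> carrier (F (nX (Suc k)))" "y @ x \<in> carrier (C (Suc (Suc k)))"
      using z yx by auto
    have dx: "dX k x \<in> carrier (F (nX k))" by (rule linear_mapsD(1)[OF XL w(3)])
    have dy: "dY (Suc k) y \<in> carrier (F (nY (Suc k)))" by (rule linear_mapsD(1)[OF YL w(2)])
    have px: "\<phi> (Suc k) x \<in> carrier (F (nY (Suc k)))" by (rule linear_mapsD(1)[OF p(2) w(3)])
    have w': "w = (dY (Suc k) y \<oplus>\<^bsub>F (nY (Suc k))\<^esub> \<phi> (Suc k) x) @ (\<ominus>\<^bsub>F (nX k)\<^esub> dX k x)"
      unfolding w(1) D_append[OF w(2)] by simp
    have "dY k (dY (Suc k) y \<oplus>\<^bsub>F (nY (Suc k))\<^esub> \<phi> (Suc k) x) \<oplus>\<^bsub>F (nY k)\<^esub> \<phi> k (\<ominus>\<^bsub>F (nX k)\<^esub> dX k x) =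
        (dY k (dY (Suc k) y) \<oplus>\<^bsub>F (nY k)\<^esub> dY k (\<phi> (Suc k) x)) \<oplus>\<^bsub>F (nY k)\<^esub> \<ominus>\<^bsub>F (nY k)\<^esub> \<phi> k (dX k x)"
      using linear_mapsD(2)[OF YL dy px]
        linear_maps_minus(1)[OF FL FL p(1) dx] by simp
    also have "\<dots> = \<zero>\<^bsub>F (nY k)\<^esub>"
      using exact_complexD(4)[OF resolvesD(1)[OF Y] w(2)] chain_mapD(2)[OF \<phi> w(3)] linear_mapsD(1)[OF p(1) dx]
      by (simp add: Yk.M.r_neg del: free_module_simps)
    finally have "D k w = \<zero>\<^bsub>C k\<^esub>"
      unfolding w' using Dzero[OF Yk1.M.a_closed[OF dy px] Xk.M.a_inv_closed[OF dx]]
        linear_maps_minus(1)[OF FL FL shL dx] sh_zero[OF w(3)]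
      by (simp del: free_module_simps)
    then show "w \<in> {z \<in> carrier (C (Suc k)). D k z = \<zero>\<^bsub>C k\<^esub>}"
      using linear_mapsD(1)[OF DL w(4)] w(1) by blast
  next
    fix z assume "z \<in> {z \<in> carrier (C (Suc k)). D k z = \<zero>\<^bsub>C k\<^esub>}"
    then obtain y x where z: "z = y @ x" "y \<in> carrier (F (nY (Suc k)))" "x \<in> carrier (F (nX k))"
      and D0: "D k (y @ x) = \<zero>\<^bsub>C k\<^esub>" by (auto elim!: C_cases)
    have 1: "dY k y \<oplus>\<^bsub>F (nY k)\<^esub> \<phi> k x = \<zero>\<^bsub>F (nY k)\<^esub>"
      and 2: "shifted_map dX k x = \<zero>\<^bsub>F (shifted_rank nX k)\<^esub>"
      using D0 Dzero[OF z(2,3)] by auto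
    have dyc: "dY k y \<in> carrier (F (nY k))" by (rule linear_mapsD(1)[OF YL z(2)])
    have pxc: "\<phi> k x \<in> carrier (F (nY k))" by (rule linear_mapsD(1)[OF p(1) z(3)])
    have "x \<in> dX k ` carrier (F (nX (Suc k)))"
    proof (cases k)
      case 0
      note eYL = resolvesD(3)[OF Y]
      have "eX x = eY (dY 0 y) \<oplus>\<^bsub>M\<^esub> eY (\<phi> 0 x)"
        using resolvesD(5)[OF Y, of y] \<phi>0 z linear_mapsD(1)[OF resolvesD(3)[OF X], of x] 0 by simp
      also have "\<dots> = eY (dY 0 y \<oplus>\<^bsub>F (nY 0)\<^esub> \<phi> 0 x)"
        using linear_mapsD(2)[OF eYL, of "dY 0 y" "\<phi> 0 x"] dyc pxc 0 by simp
      also have "\<dots> = \<zero>\<^bsub>M\<^esub>"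
        using 1 linear_maps_zero[OF FL resolvesD(2)[OF X] eYL] 0 by simp
      finally show ?thesis using resolvesD(4)[OF X] z(3) 0 by simp
    next
      case (Suc j)
      then show ?thesis using exact_complexD(3)[OF resolvesD(1)[OF X], of j] z(3) 2 by simp
    qed
    then obtain x' where x': "x' \<in> carrier (F (nX (Suc k)))" "x = dX k x'" by blast
    have px': "\<phi> (Suc k) x' \<in> carrier (F (nY (Suc k)))" by (rule linear_mapsD(1)[OF p(2) x'(1)])
    have "dY k (y \<oplus>\<^bsub>F (nY (Suc k))\<^esub> \<phi> (Suc k) x') = \<zero>\<^bsub>F (nY k)\<^esub>"
      using linear_mapsD(2)[OF YL z(2) px'] chain_mapD(2)[OF \<phi> x'(1)] 1 x'(2) by simp
    then have "y \<oplus>\<^bsub>F (nY (Suc k))\<^esub> \<phi> (Suc k) x' \<in> dY (Suc k) ` carrier (F (nY (Suc (Suc k))))"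
      using exact_complexD(3)[OF resolvesD(1)[OF Y], of k] Yk1.M.a_closed[OF z(2) px'] by simp
    then obtain y' where y': "y' \<in> carrier (F (nY (Suc (Suc k))))"
      "y \<oplus>\<^bsub>F (nY (Suc k))\<^esub> \<phi> (Suc k) x' = dY (Suc k) y'" by blast
    have "D (Suc k) (y' @ (\<ominus>\<^bsub>F (nX (Suc k))\<^esub> x')) =
        ((y \<oplus>\<^bsub>F (nY (Suc k))\<^esub> \<phi> (Suc k) x') \<oplus>\<^bsub>F (nY (Suc k))\<^esub> (\<ominus>\<^bsub>F (nY (Suc k))\<^esub> \<phi> (Suc k) x')) @
        (\<ominus>\<^bsub>F (nX k)\<^esub> (\<ominus>\<^bsub>F (nX k)\<^esub> dX k x'))"
      unfolding D_append[OF y'(1)]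
      by (simp only: shifted_rank_simps shifted_map_simps y'(2)
          linear_maps_minus(1)[OF FL FL p(2) x'(1)]
          linear_maps_minus(1)[OF FL FL XL x'(1)])
    also have "\<dots> = z"
      using z x' px' by (simp add: Yk1.M.a_assoc Yk1.M.r_neg del: free_module_simps)
    finally show "z \<in> D (Suc k) ` carrier (C (Suc (Suc k)))"
      using free_module_append(1)[OF y'(1) Xk1.M.a_inv_closed[OF x'(1)]] C_Suc by (metis imageI)
  qed
qed

text \<open>The next four lemmas are the long exact sequence of the cone in terms of functionals. Those on
  \<open>X k\<close> become functionals on the cone in degree \<open>Suc k\<close> by ignoring the component in \<open>Y\<close>.\<close>

lemma cone_cocycle_shift:
  assumes "free_cocycle R nX dX k f"
  shows "cocycle R C D (Suc k) (\<lambda>z. f (drop (nY (Suc k)) z))"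
proof -
  interpret R: ring R by (rule R)
  have f: "f \<in> functionals R (F (nX k))"
    and f0: "\<And>x. x \<in> carrier (F (nX (Suc k))) \<Longrightarrow> f (dX k x) = \<zero>\<^bsub>R\<^esub>"
    using assms by (auto simp: cocycle_def)
  have "f (drop (nY (Suc k)) (D (Suc k) z)) = \<zero>\<^bsub>R\<^esub>" if z: "z \<in> carrier (C (Suc (Suc k)))" for z
  proof -
    obtain y x where yx: "z = y @ x" "y \<in> carrier (F (nY (Suc (Suc k))))" "x \<in> carrier (F (nX (Suc k)))"
      by (rule C_cases[OF z])
    interpret Y: left_module R "F (nY (Suc k))" by (rule FL)
    have c: "dY (Suc k) y \<oplus>\<^bsub>F (nY (Suc k))\<^esub> \<phi> (Suc k) x \<in> carrier (F (nY (Suc k)))"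
      by (rule Y.M.a_closed[OF linear_mapsD(1)[OF YL yx(2)] linear_mapsD(1)[OF chain_mapD(1)[OF \<phi>] yx(3)]])
    have "drop (nY (Suc k)) (D (Suc k) z) = \<ominus>\<^bsub>F (nX k)\<^esub> dX k x"
      unfolding yx(1) D_append[OF yx(2)] using c by (simp add: free_module_carrier)
    then show ?thesis
      using linear_maps_minus(1)[OF FL left_module_regular[OF R] f linear_mapsD(1)[OF XL yx(3)]]
        f0[OF yx(3)] by simp
  qed
  then show ?thesis unfolding cocycle_def using linear_maps_comp[OF dl f] by blast
qed

lemma cone_coboundary_shift:
  assumes "free_coboundary R nX dX k f"
  shows "coboundary R C D (Suc k) (\<lambda>z. f (drop (nY (Suc k)) z))"
proof (cases k)
  case 0
  interpret R: ring R by (rule R)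
  show ?thesis
    unfolding coboundary_Suc
    using linear_maps_const_zero[OF left_module_regular[OF R], of "C k"] assms linear_mapsD(1)[OF dl]
    by (intro bexI[of _ "\<lambda>x. \<zero>\<^bsub>R\<^esub>"]) (auto simp: 0 coboundary_0)
next
  case (Suc j)
  interpret R: ring R by (rule R)
  obtain g where g: "g \<in> functionals R (F (nX j))"
    "\<And>x. x \<in> carrier (F (nX (Suc j))) \<Longrightarrow> f x = g (dX j x)"
    using assms unfolding Suc coboundary_Suc by auto
  have "(\<lambda>z. \<ominus>\<^bsub>R\<^esub> g (drop (nY k) z)) \<in> functionals R (C k)"
    using linear_maps_neg[OF left_module_regular[OF R] linear_maps_comp[OF dl g(1)]] Suc by simp
  moreover have "f (drop (nY (Suc k)) z) = \<ominus>\<^bsub>R\<^esub> g (drop (nY k) (D k z))" if z: "z \<in> carrier (C (Suc k))" for z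
  proof -
    obtain y x where yx: "z = y @ x" "y \<in> carrier (F (nY (Suc k)))" "x \<in> carrier (F (nX k))"
      by (rule C_cases[OF z])
    interpret Y: left_module R "F (nY k)" by (rule FL)
    have c: "dY k y \<oplus>\<^bsub>F (nY k)\<^esub> \<phi> k x \<in> carrier (F (nY k))"
      by (rule Y.M.a_closed[OF linear_mapsD(1)[OF YL yx(2)] linear_mapsD(1)[OF chain_mapD(1)[OF \<phi>] yx(3)]])
    have x: "x \<in> carrier (F (nX (Suc j)))" using yx(3) Suc by simp
    have dx: "dX j x \<in> carrier (F (nX j))" by (rule linear_mapsD(1)[OF XL x])
    have "drop (nY k) (D k z) = \<ominus>\<^bsub>F (nX j)\<^esub> dX j x"
      unfolding yx(1) D_append[OF yx(2)] using c Suc by (simp add: free_module_carrier)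
    moreover have "drop (nY (Suc k)) z = x" using yx by (simp add: free_module_carrier)
    ultimately show ?thesis
      using linear_maps_minus(1)[OF FL left_module_regular[OF R] g(1) dx]
        linear_mapsD(1)[OF g(1) dx] g(2)[OF x] by simp
  qed
  ultimately show ?thesis
    unfolding coboundary_Suc by (intro bexI[of _ "\<lambda>z. \<ominus>\<^bsub>R\<^esub> g (drop (nY k) z)"] ballI)
qed

text \<open>What is lost on the way from \<open>X\<close> to the cone comes from \<open>Y\<close>.\<close>

lemma cone_shift_coboundaryE:
  assumes f: "f \<in> functionals R (F (nX k))"
    and cb: "coboundary R C D (Suc k) (\<lambda>z. f (drop (nY (Suc k)) z))"
  shows "\<exists>g. free_cocycle R nY dY k g \<and>
    free_coboundary R nX dX k (\<lambda>x. f x \<ominus>\<^bsub>R\<^esub> g (\<phi> k x))"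
proof -
  interpret R: ring R by (rule R)
  interpret Yk: left_module R "F (nY k)" by (rule FL)
  interpret Y1: left_module R "F (nY (Suc k))" by (rule FL)
  interpret Xk: left_module R "F (nX k)" by (rule FL)
  interpret S: left_module R "F (shifted_rank nX k)" by (rule FL)
  note RL = left_module_regular[OF R]
  obtain g where g: "g \<in> functionals R (C k)"
    "\<And>z. z \<in> carrier (C (Suc k)) \<Longrightarrow> f (drop (nY (Suc k)) z) = g (D k z)"
    using cb unfolding coboundary_Suc by blast
  note g' = g(1)[unfolded C_k]
  define g1 where "g1 y = g (y @ \<zero>\<^bsub>F (shifted_rank nX k)\<^esub>)" for y
  define g2 where "g2 x = g (\<zero>\<^bsub>F (nY k)\<^esub> @ x)" for x
  have g1: "g1 \<in> functionals R (F (nY k))"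
    unfolding g1_def by (rule linear_maps_comp[OF append_zero_linear(1)[OF R] g'])
  have g2: "g2 \<in> functionals R (F (shifted_rank nX k))"
    unfolding g2_def by (rule linear_maps_comp[OF append_zero_linear(2)[OF R] g'])
  have val: "f x = g1 (dY k y \<oplus>\<^bsub>F (nY k)\<^esub> \<phi> k x) \<oplus>\<^bsub>R\<^esub> g2 (\<ominus>\<^bsub>F (shifted_rank nX k)\<^esub> shifted_map dX k x)"
    if y: "y \<in> carrier (F (nY (Suc k)))" and x: "x \<in> carrier (F (nX k))" for x y
  proof -
    have "f x = g (D k (y @ x))"
      using g(2)[of "y @ x"] free_module_append[OF y x] C_Suc by metis
    also have "\<dots> = g1 (dY k y \<oplus>\<^bsub>F (nY k)\<^esub> \<phi> k x) \<oplus>\<^bsub>R\<^esub> g2 (\<ominus>\<^bsub>F (shifted_rank nX k)\<^esub> shifted_map dX k x)"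
      unfolding D_append[OF y] g1_def g2_def
      using functional_append[OF R g' Yk.M.a_closed[OF linear_mapsD(1)[OF YL y] linear_mapsD(1)[OF chain_mapD(1)[OF \<phi>] x]]
          linear_mapsD(1)[OF negL x]] by simp
    finally show ?thesis .
  qed
  have "g1 (dY k y) = \<zero>\<^bsub>R\<^esub>" if y: "y \<in> carrier (F (nY (Suc k)))" for y
  proof -
    have dy: "dY k y \<in> carrier (F (nY k))" by (rule linear_mapsD(1)[OF YL y])
    have "f \<zero>\<^bsub>F (nX k)\<^esub> = g1 (dY k y) \<oplus>\<^bsub>R\<^esub> g2 \<zero>\<^bsub>F (shifted_rank nX k)\<^esub>"
      unfolding val[OF y Xk.M.zero_closed]
      using linear_maps_zero[OF FL FL chain_mapD(1)[OF \<phi>]]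
        linear_maps_zero[OF FL FL negL] dy
      by (simp del: free_module_simps)
    then show ?thesis
      using linear_maps_zero[OF FL RL f] linear_maps_zero[OF FL RL g2]
        linear_mapsD(1)[OF g1 dy] by simp
  qed
  then have 1: "free_cocycle R nY dY k g1" using g1 by (simp add: cocycle_def)
  have diff: "f x \<ominus>\<^bsub>R\<^esub> g1 (\<phi> k x) = g2 (\<ominus>\<^bsub>F (shifted_rank nX k)\<^esub> shifted_map dX k x)"
    if x: "x \<in> carrier (F (nX k))" for x
  proof -
    have px: "\<phi> k x \<in> carrier (F (nY k))" by (rule linear_mapsD(1)[OF chain_mapD(1)[OF \<phi>] x])
    have "f x = g1 (\<phi> k x) \<oplus>\<^bsub>R\<^esub> g2 (\<ominus>\<^bsub>F (shifted_rank nX k)\<^esub> shifted_map dX k x)"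
      unfolding val[OF Y1.M.zero_closed x]
      using linear_maps_zero[OF FL FL YL] px by (simp del: free_module_simps)
    then show ?thesis
      using linear_mapsD(1)[OF g1 px] linear_mapsD(1)[OF linear_maps_comp[OF negL g2] x]
      by (simp add: R.minus_eq R.a_ac R.r_neg1 R.r_neg2 R.r_neg)
  qed
  have "free_coboundary R nX dX k (\<lambda>x. f x \<ominus>\<^bsub>R\<^esub> g1 (\<phi> k x))"
  proof (cases k)
    case 0
    have "g2 (\<ominus>\<^bsub>F (shifted_rank nX k)\<^esub> shifted_map dX k x) = \<zero>\<^bsub>R\<^esub>"
      if "x \<in> carrier (F (nX k))" for x
      using linear_mapsD(1)[OF negL that] linear_maps_zero[OF FL RL g2] 0 by simp
    then show ?thesis using diff 0 by (simp add: coboundary_0)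
  next
    case (Suc j)
    have "(\<lambda>x. g2 (\<ominus>\<^bsub>F (shifted_rank nX k)\<^esub> x)) \<in> functionals R (F (shifted_rank nX k))"
      by (rule linear_maps_comp[OF linear_maps_neg[OF FL linear_maps_ident] g2])
    then show ?thesis unfolding Suc coboundary_Suc
      using diff by (intro bexI[of _ "\<lambda>x. g2 (\<ominus>\<^bsub>F (shifted_rank nX k)\<^esub> x)"]) (auto simp: Suc)
  qed
  with 1 show ?thesis by blast
qed

text \<open>The component of \<open>f\<close> in \<open>Y\<close> is a cocycle; if it is a coboundary, subtracting the corresponding
  coboundary of the cone leaves a functional that ignores \<open>Y\<close>.\<close>

lemma cone_cocycle_cohomologous_shift:
  assumes f: "cocycle R C D (Suc k) f"
    and Y1: "free_ext_vanishes R nY dY (Suc k)"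
  shows "\<exists>f'. free_cocycle R nX dX k f' \<and>
    coboundary R C D (Suc k) (\<lambda>z. f z \<ominus>\<^bsub>R\<^esub> f' (drop (nY (Suc k)) z))"
proof -
  interpret R: ring R by (rule R)
  interpret Yk: left_module R "F (nY k)" by (rule FL)
  interpret Y1: left_module R "F (nY (Suc k))" by (rule FL)
  interpret Xk: left_module R "F (nX k)" by (rule FL)
  interpret X1: left_module R "F (nX (Suc k))" by (rule FL)
  interpret Y2: left_module R "F (nY (Suc (Suc k)))" by (rule FL)
  note RL = left_module_regular[OF R]
  have fl: "f \<in> functionals R (F (nY (Suc k) + nX k))"
    and f0: "\<And>z. z \<in> carrier (C (Suc (Suc k))) \<Longrightarrow> f (D (Suc k) z) = \<zero>\<^bsub>R\<^esub>"
    using f unfolding cocycle_def C_Suc by auto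
  define f1 where "f1 y = f (y @ \<zero>\<^bsub>F (nX k)\<^esub>)" for y
  define f2 where "f2 x = f (\<zero>\<^bsub>F (nY (Suc k))\<^esub> @ x)" for x
  have f1: "f1 \<in> functionals R (F (nY (Suc k)))"
    unfolding f1_def by (rule linear_maps_comp[OF append_zero_linear(1)[OF R] fl])
  have f2: "f2 \<in> functionals R (F (nX k))"
    unfolding f2_def by (rule linear_maps_comp[OF append_zero_linear(2)[OF R] fl])
  have f12: "f (y @ x) = f1 y \<oplus>\<^bsub>R\<^esub> f2 x" if "y \<in> carrier (F (nY (Suc k)))" "x \<in> carrier (F (nX k))" for x y
    unfolding f1_def f2_def using functional_append[OF R fl that] by simp
  have val: "f1 (dY (Suc k) y \<oplus>\<^bsub>F (nY (Suc k))\<^esub> \<phi> (Suc k) x) \<oplus>\<^bsub>R\<^esub> f2 (\<ominus>\<^bsub>F (nX k)\<^esub> dX k x) = \<zero>\<^bsub>R\<^esub>"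
    if y: "y \<in> carrier (F (nY (Suc (Suc k))))" and x: "x \<in> carrier (F (nX (Suc k)))" for x y
  proof -
    have "f (D (Suc k) (y @ x)) = \<zero>\<^bsub>R\<^esub>"
      using f0[of "y @ x"] free_module_append(1)[OF y x] C_Suc by metis
    then show ?thesis unfolding D_append[OF y]
      using f12[OF Y1.M.a_closed[OF linear_mapsD(1)[OF YL y] linear_mapsD(1)[OF chain_mapD(1)[OF \<phi>] x]]
          Xk.M.a_inv_closed[OF linear_mapsD(1)[OF XL x]]] by simp
  qed
  have "f1 (dY (Suc k) y) = \<zero>\<^bsub>R\<^esub>" if y: "y \<in> carrier (F (nY (Suc (Suc k))))" for y
  proof -
    have dy: "dY (Suc k) y \<in> carrier (F (nY (Suc k)))" by (rule linear_mapsD(1)[OF YL y])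
    note zeros = linear_maps_zero[OF FL FL chain_mapD(1)[OF \<phi>]]
      linear_maps_zero[OF FL FL XL]
      linear_maps_zero[OF FL FL
        linear_maps_neg[OF FL linear_maps_ident]]
      linear_maps_zero[OF FL RL f2] Y1.M.r_zero[OF dy]
    have "f1 (dY (Suc k) y) \<oplus>\<^bsub>R\<^esub> \<zero>\<^bsub>regular_module R\<^esub> = \<zero>\<^bsub>R\<^esub>"
      using val[OF y X1.M.zero_closed] unfolding zeros .
    then show ?thesis using linear_mapsD(1)[OF f1 dy] by simp
  qed
  then have "free_cocycle R nY dY (Suc k) f1" using f1 by (simp add: cocycle_def)
  then obtain g where g: "g \<in> functionals R (F (nY k))"
    "\<And>y. y \<in> carrier (F (nY (Suc k))) \<Longrightarrow> f1 y = g (dY k y)"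
    using Y1 unfolding ext_vanishes_def coboundary_Suc by blast
  define f' where "f' x = f2 x \<ominus>\<^bsub>R\<^esub> g (\<phi> k x)" for x
  have gp: "(\<lambda>x. g (\<phi> k x)) \<in> functionals R (F (nX k))"
    by (rule linear_maps_comp[OF chain_mapD(1)[OF \<phi>] g(1)])
  have f': "f' \<in> functionals R (F (nX k))"
    unfolding f'_def using linear_maps_diff[OF RL f2 gp] by simp
  have "f' (dX k x) = \<zero>\<^bsub>R\<^esub>" if x: "x \<in> carrier (F (nX (Suc k)))" for x
  proof -
    have dx: "dX k x \<in> carrier (F (nX k))" by (rule linear_mapsD(1)[OF XL x])
    have px: "\<phi> (Suc k) x \<in> carrier (F (nY (Suc k)))" by (rule linear_mapsD(1)[OF chain_mapD(1)[OF \<phi>] x])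
    have c: "f2 (dX k x) \<in> carrier R" "g (\<phi> k (dX k x)) \<in> carrier R"
      using linear_mapsD(1)[OF f2 dx] linear_mapsD(1)[OF gp dx] by auto
    have "f1 (\<phi> (Suc k) x) \<oplus>\<^bsub>R\<^esub> \<ominus>\<^bsub>R\<^esub> f2 (dX k x) = \<zero>\<^bsub>R\<^esub>"
      using val[OF Y2.M.zero_closed x] linear_maps_zero[OF FL FL YL] px
        linear_maps_minus(1)[OF FL RL f2 dx] by (simp del: free_module_simps)
    moreover have "f1 (\<phi> (Suc k) x) = g (\<phi> k (dX k x))"
      using g(2)[OF px] chain_mapD(2)[OF \<phi> x] by simp
    ultimately have "f2 (dX k x) = g (\<phi> k (dX k x))"
      using c by (metis R.a_inv_closed R.minus_equality R.minus_minus)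
    then show ?thesis unfolding f'_def using c by (simp add: R.minus_eq R.r_neg)
  qed
  then have "free_cocycle R nX dX k f'" using f' by (simp add: cocycle_def)
  moreover have "coboundary R C D (Suc k) (\<lambda>z. f z \<ominus>\<^bsub>R\<^esub> f' (drop (nY (Suc k)) z))"
    unfolding coboundary_Suc
  proof (intro bexI ballI)
    show "(\<lambda>z. g (take (nY k) z)) \<in> functionals R (C k)"
      unfolding C_k by (rule linear_maps_comp[OF take_linear g(1)])
    fix z assume "z \<in> carrier (C (Suc k))"
    then obtain y x where z: "z = y @ x" and y: "y \<in> carrier (F (nY (Suc k)))" and x: "x \<in> carrier (F (nX k))"
      by (rule C_cases)
    have dy: "dY k y \<in> carrier (F (nY k))" and px: "\<phi> k x \<in> carrier (F (nY k))"
      using linear_mapsD(1)[OF YL y] linear_mapsD(1)[OF chain_mapD(1)[OF \<phi>] x] by auto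
    have c: "g (dY k y) \<in> carrier R" "g (\<phi> k x) \<in> carrier R" "f2 x \<in> carrier R"
      using linear_mapsD(1)[OF g(1) dy] linear_mapsD(1)[OF gp x] linear_mapsD(1)[OF f2 x] by auto
    have dr: "drop (nY (Suc k)) z = x" using z y by (simp add: free_module_carrier)
    have "take (nY k) (D k z) = dY k y \<oplus>\<^bsub>F (nY k)\<^esub> \<phi> k x"
      unfolding z D_append[OF y] using Yk.M.a_closed[OF dy px] by (simp add: free_module_carrier)
    then have "g (take (nY k) (D k z)) = g (dY k y) \<oplus>\<^bsub>R\<^esub> g (\<phi> k x)"
      using linear_mapsD(2)[OF g(1) dy px] by simp
    also have "\<dots> = f z \<ominus>\<^bsub>R\<^esub> f' (drop (nY (Suc k)) z)"
      unfolding dr f'_def unfolding z f12[OF y x] g(2)[OF y] using c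
      by (simp add: R.minus_eq R.minus_add R.a_ac R.r_neg R.r_neg1 R.r_neg2)
    finally show "f z \<ominus>\<^bsub>R\<^esub> f' (drop (nY (Suc k)) z) = g (take (nY k) (D k z))" by simp
  qed
  ultimately show ?thesis by blast
qed

lemma cone_shift_coboundary_iff:
  assumes "free_cocycle R nX dX k f" "free_ext_vanishes R nY dY k"
  shows "coboundary R C D (Suc k) (\<lambda>z. f (drop (nY (Suc k)) z)) \<longleftrightarrow>
    free_coboundary R nX dX k f"
proof
  assume cb: "coboundary R C D (Suc k) (\<lambda>z. f (drop (nY (Suc k)) z))"
  have f: "f \<in> functionals R (F (nX k))" using assms(1) by (simp add: cocycle_def)
  obtain g where g: "free_cocycle R nY dY k g"
    "free_coboundary R nX dX k (\<lambda>x. f x \<ominus>\<^bsub>R\<^esub> g (\<phi> k x))"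
    using cone_shift_coboundaryE[OF f cb] by blast
  have "free_coboundary R nY dY k g" using assms(2) g(1) by (simp add: ext_vanishes_def)
  from coboundary_pullback[OF \<phi> this]
  have "free_coboundary R nX dX k (\<lambda>x. g (\<phi> k x))" .
  then show "free_coboundary R nX dX k f"
    using coboundary_diff_trans[where d=dX and P="free_sequence R nX", OF R XL g(2)] f
      cocycle_pullback[OF \<phi> g(1)] by (simp add: cocycle_def)
qed (rule cone_coboundary_shift)

lemma cone_ext_vanishes:
  assumes "free_ext_vanishes R nX dX k" "free_ext_vanishes R nY dY (Suc k)"
  shows "ext_vanishes R C D (Suc k)"
  unfolding ext_vanishes_def
proof (intro allI impI)
  fix f assume f: "cocycle R C D (Suc k) f"
  obtain f' where f': "free_cocycle R nX dX k f'"
    "coboundary R C D (Suc k) (\<lambda>z. f z \<ominus>\<^bsub>R\<^esub> f' (drop (nY (Suc k)) z))"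
    using cone_cocycle_cohomologous_shift[OF f assms(2)] by (elim exE conjE) (rule that)
  have "coboundary R C D (Suc k) (\<lambda>z. f' (drop (nY (Suc k)) z))"
    by (rule cone_coboundary_shift[OF assms(1)[unfolded ext_vanishes_def, rule_format, OF f'(1)]])
  then show "coboundary R C D (Suc k) f"
    using coboundary_diff_trans[where d=D and P=C, OF R DL f'(2)] f cone_cocycle_shift[OF f'(1)]
    by (simp add: cocycle_def)
qed

lemma cone_source_ext_vanishes:
  assumes "ext_vanishes R C D (Suc k)" "free_ext_vanishes R nY dY k"
  shows "free_ext_vanishes R nX dX k"
  unfolding ext_vanishes_def
proof (intro allI impI)
  fix f assume f: "free_cocycle R nX dX k f"
  show "free_coboundary R nX dX k f"
    by (rule iffD1[OF cone_shift_coboundary_iff[OF f assms(2)]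
          assms(1)[unfolded ext_vanishes_def, rule_format, OF cone_cocycle_shift[OF f]]])
qed

end

section \<open>Recovering a module from its Ext modules\<close>

text \<open>The complex dual to a free resolution \<open>(n, d)\<close> consists of the free right modules of rank
  \<open>n k\<close>, with differentials \<open>transposed R n d k\<close> from degree \<open>k\<close> to degree \<open>Suc k\<close>. Its cycles modulo
  its boundaries are the Ext modules.\<close>

definition transposed ::
  "('a, 'r) ring_scheme \<Rightarrow> (nat \<Rightarrow> nat) \<Rightarrow> (nat \<Rightarrow> 'a list \<Rightarrow> 'a list) \<Rightarrow> nat \<Rightarrow> 'a list \<Rightarrow> 'a list" where
  "transposed R n d k = transpose_map R (n (Suc k)) (d k)"

definition transposed_cycles ::
  "('a, 'r) ring_scheme \<Rightarrow> (nat \<Rightarrow> nat) \<Rightarrow> (nat \<Rightarrow> 'a list \<Rightarrow> 'a list) \<Rightarrow> nat \<Rightarrow> 'a list set" where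
  "transposed_cycles R n d k =
    {v \<in> vectors R (n k). transposed R n d k v = \<zero>\<^bsub>free_module R (n (Suc k))\<^esub>}"

definition transposed_boundaries ::
  "('a, 'r) ring_scheme \<Rightarrow> (nat \<Rightarrow> nat) \<Rightarrow> (nat \<Rightarrow> 'a list \<Rightarrow> 'a list) \<Rightarrow> nat \<Rightarrow> 'a list set" where
  "transposed_boundaries R n d k = (case k of 0 \<Rightarrow> {\<zero>\<^bsub>free_module R (n 0)\<^esub>}
    | Suc j \<Rightarrow> transposed R n d j ` vectors R (n j))"

text \<open>The image of an idempotent \<open>p\<close> is projective; alternating \<open>p\<close> and \<open>1 - p\<close> resolves it by a
  single free module, and the dual of that periodic complex is exact in positive degrees.\<close>

lemma idempotent_resolution:
  assumes R: "ring R" and p: "p \<in> free_maps R N N"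
    and idem: "\<And>x. x \<in> vectors R N \<Longrightarrow> p (p x) = p x"
  shows "\<exists>d. free_resolves R (\<lambda>_. N) d (free_module R N) p \<and>
    (\<forall>k. free_ext_vanishes R (\<lambda>_. N) d (Suc k))"
proof -
  let ?F = "free_module R N"
  interpret F: left_module R ?F by (rule left_module_free[OF R])
  note L = F.left_module_axioms
  define q where "q x = x \<ominus>\<^bsub>?F\<^esub> p x" for x
  have q: "q \<in> linear_maps R ?F ?F"
    unfolding q_def by (rule linear_maps_diff[OF L linear_maps_ident p])
  note pc = linear_mapsD(1)[OF p] and qc = linear_mapsD(1)[OF q]
  have qp: "q (p x) = \<zero>\<^bsub>?F\<^esub>" if "x \<in> carrier ?F" for x
    unfolding q_def idem[OF that] using pc[OF that] by (simp add: F.M.minus_eq F.M.r_neg del: free_module_simps)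
  have pq: "p (q x) = \<zero>\<^bsub>?F\<^esub>" if "x \<in> carrier ?F" for x
    unfolding q_def linear_maps_minus(2)[OF L L p pc[OF that] that] idem[OF that]
    using pc[OF that] by (simp add: F.M.minus_eq F.M.r_neg del: free_module_simps)
  have sum: "x = q x \<oplus>\<^bsub>?F\<^esub> p x" if "x \<in> carrier ?F" for x
    unfolding q_def using that pc[OF that]
    by (simp add: F.M.minus_eq F.M.a_assoc F.M.l_neg del: free_module_simps)
  have kp: "q ` carrier ?F = {x \<in> carrier ?F. p x = \<zero>\<^bsub>?F\<^esub>}"
  proof (intro equalityI subsetI)
    fix x assume "x \<in> {x \<in> carrier ?F. p x = \<zero>\<^bsub>?F\<^esub>}"
    then have x: "x \<in> carrier ?F" "p x = \<zero>\<^bsub>?F\<^esub>" by auto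
    have "x = q x" using sum[OF x(1)] F.M.r_zero[OF qc[OF x(1)]] unfolding x(2) by simp
    then show "x \<in> q ` carrier ?F" using x(1) by (rule image_eqI)
  qed (use pq qc in auto)
  have kq: "p ` carrier ?F = {x \<in> carrier ?F. q x = \<zero>\<^bsub>?F\<^esub>}"
  proof (intro equalityI subsetI)
    fix x assume "x \<in> {x \<in> carrier ?F. q x = \<zero>\<^bsub>?F\<^esub>}"
    then have x: "x \<in> carrier ?F" "q x = \<zero>\<^bsub>?F\<^esub>" by auto
    have "x = p x" using sum[OF x(1)] F.M.l_zero[OF pc[OF x(1)]] unfolding x(2) by simp
    then show "x \<in> p ` carrier ?F" using x(1) by (rule image_eqI)
  qed (use qp pc in auto)
  define d where "d k = (if even k then q else p)" for k :: nat
  have "free_resolves R (\<lambda>_. N) d ?F p"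
    unfolding resolves_def exact_complex_def using L p q kp kq by (auto simp: d_def)
  moreover have "free_ext_vanishes R (\<lambda>_. N) d (Suc k)" for k
    unfolding ext_vanishes_def
  proof (intro allI impI)
    fix f assume "free_cocycle R (\<lambda>_. N) d (Suc k) f"
    then have f: "f \<in> functionals R ?F"
      and f0: "\<And>x. x \<in> carrier ?F \<Longrightarrow> f (d (Suc k) x) = \<zero>\<^bsub>R\<^esub>" by (auto simp: cocycle_def)
    interpret R: ring R by (rule R)
    have "f x = f (d k x)" if x: "x \<in> carrier ?F" for x
    proof -
      have "f x = f (q x) \<oplus>\<^bsub>R\<^esub> f (p x)"
        using linear_mapsD(2)[OF f qc[OF x] pc[OF x]] sum[OF x] by simp
      then show ?thesis
        using f0[OF x] linear_mapsD(1)[OF f qc[OF x]] linear_mapsD(1)[OF f pc[OF x]]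
        by (auto simp: d_def split: if_splits)
    qed
    then show "free_coboundary R (\<lambda>_. N) d (Suc k) f"
      unfolding coboundary_Suc using f by (intro bexI[of _ f]) auto
  qed
  ultimately show ?thesis by (intro exI[of _ d] conjI allI)
qed

lemma transposed_linear:
  assumes "free_exact_complex R n d"
  shows "transposed R n d k \<in>
    free_maps (opp_ring R) (n k) (n (Suc k))"
proof -
  have R: "ring R" using left_module_ring[OF exact_complexD(1)[OF assms]] .
  show ?thesis
    unfolding transposed_def by (rule transpose_map_linear[OF R exact_complexD(2)[OF assms]])
qed

lemma transposed_adjoint:
  assumes "free_exact_complex R n d"
    "v \<in> vectors R (n k)" "x \<in> vectors R (n (Suc k))"
  shows "pairing R x (transposed R n d k v) = pairing R (d k x) v"
proof -
  have R: "ring R" using left_module_ring[OF exact_complexD(1)[OF assms(1)]] .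
  show ?thesis
    unfolding transposed_def by (rule transpose_map_adjoint[OF R exact_complexD(2)[OF assms(1)] assms(2,3)])
qed

lemma pairing_zero:
  assumes "ring R" "x \<in> vectors R n"
  shows "pairing R x \<zero>\<^bsub>free_module R n\<^esub> = \<zero>\<^bsub>R\<^esub>" "pairing R \<zero>\<^bsub>free_module R n\<^esub> x = \<zero>\<^bsub>R\<^esub>"
  using linear_maps_zero[OF left_module_free[OF assms(1)] left_module_regular[OF assms(1)] pairing_linear[OF assms]]
    linear_maps_zero[OF left_module_free[OF ring_opp_ring[OF assms(1)]]
      left_module_regular[OF ring_opp_ring[OF assms(1)]] pairing_linear_right[OF assms]]
  by simp_all

lemma transposed_cycles_cocycle:
  assumes ex: "free_exact_complex R n d" and v: "v \<in> vectors R (n k)"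
  shows "v \<in> transposed_cycles R n d k \<longleftrightarrow> free_cocycle R n d k (\<lambda>x. pairing R x v)"
proof -
  have R: "ring R" using left_module_ring[OF exact_complexD(1)[OF ex]] .
  have tc: "transposed R n d k v \<in> vectors R (n (Suc k))"
    using linear_mapsD(1)[OF transposed_linear[OF ex]] v by simp
  have zc: "\<zero>\<^bsub>free_module R (n (Suc k))\<^esub> \<in> vectors R (n (Suc k))"
    using submoduleD(2)[OF left_module_free[OF R] submodule_carrier[OF left_module_free[OF R]]] .
  have "transposed R n d k v = \<zero>\<^bsub>free_module R (n (Suc k))\<^esub> \<longleftrightarrow>
      (\<forall>x\<in>vectors R (n (Suc k)). pairing R (d k x) v = \<zero>\<^bsub>R\<^esub>)"
  proof
    assume "transposed R n d k v = \<zero>\<^bsub>free_module R (n (Suc k))\<^esub>"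
    then show "\<forall>x\<in>vectors R (n (Suc k)). pairing R (d k x) v = \<zero>\<^bsub>R\<^esub>"
      using transposed_adjoint[OF ex v] pairing_zero(1)[OF R] by (metis (no_types))
  next
    assume "\<forall>x\<in>vectors R (n (Suc k)). pairing R (d k x) v = \<zero>\<^bsub>R\<^esub>"
    then show "transposed R n d k v = \<zero>\<^bsub>free_module R (n (Suc k))\<^esub>"
      using transposed_adjoint[OF ex v] pairing_zero(1)[OF R]
      by (intro pairing_nondegenerate[OF R tc zc]) (metis (no_types))
  qed
  then show ?thesis
    using v pairing_linear[OF R v] by (simp add: transposed_cycles_def cocycle_def del: free_module_simps)
qed

lemma transposed_boundaries_coboundary:
  assumes ex: "free_exact_complex R n d" and v: "v \<in> vectors R (n k)"
  shows "v \<in> transposed_boundaries R n d k \<longleftrightarrow> free_coboundary R n d k (\<lambda>x. pairing R x v)"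
proof (cases k)
  case 0
  have R: "ring R" using left_module_ring[OF exact_complexD(1)[OF ex]] .
  have zc: "\<zero>\<^bsub>free_module R (n k)\<^esub> \<in> vectors R (n k)"
    using submoduleD(2)[OF left_module_free[OF R] submodule_carrier[OF left_module_free[OF R]]] .
  have "v = \<zero>\<^bsub>free_module R (n k)\<^esub> \<longleftrightarrow> (\<forall>x\<in>vectors R (n k). pairing R x v = \<zero>\<^bsub>R\<^esub>)"
    using pairing_zero(1)[OF R] pairing_nondegenerate[OF R v zc] by metis
  then show ?thesis using 0 by (simp add: transposed_boundaries_def coboundary_0)
next
  case (Suc j)
  have R: "ring R" using left_module_ring[OF exact_complexD(1)[OF ex]] .
  have tc: "transposed R n d j w \<in> vectors R (n k)" if "w \<in> vectors R (n j)" for w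
    using linear_mapsD(1)[OF transposed_linear[OF ex]] that Suc by simp
  show ?thesis
  proof
    assume "v \<in> transposed_boundaries R n d k"
    then obtain w where w: "w \<in> vectors R (n j)" "v = transposed R n d j w"
      by (auto simp: transposed_boundaries_def Suc)
    have "pairing R x v = pairing R (d j x) w" if "x \<in> vectors R (n (Suc j))" for x
      unfolding w(2) by (rule transposed_adjoint[OF ex w(1) that])
    then show "free_coboundary R n d k (\<lambda>x. pairing R x v)"
      unfolding Suc coboundary_Suc by (intro bexI[OF _ pairing_linear[OF R w(1)]] ballI)
  next
    assume "free_coboundary R n d k (\<lambda>x. pairing R x v)"
    then obtain g where g: "g \<in> functionals R (free_module R (n j))"
      "\<forall>x\<in>vectors R (n (Suc j)). pairing R x v = g (d j x)"
      unfolding Suc coboundary_Suc by (elim bexE) (rule that)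
    obtain w where w: "w \<in> vectors R (n j)"
      "\<And>y. y \<in> vectors R (n j) \<Longrightarrow> g y = pairing R y w"
      by (rule functional_eq_pairing[OF R g(1)]) (rule that)
    have "v = transposed R n d j w"
    proof (rule pairing_nondegenerate[OF R v tc[OF w(1)]])
      fix x assume x: "x \<in> vectors R (n k)"
      then have x': "x \<in> vectors R (n (Suc j))" using Suc by simp
      show "pairing R x v = pairing R x (transposed R n d j w)"
        unfolding transposed_adjoint[OF ex w(1) x'] using g(2) x' w(2)[OF linear_mapsD(1)[OF exact_complexD(2)[OF ex] x']]
        by simp
    qed
    then show "v \<in> transposed_boundaries R n d k" using w(1) by (auto simp: transposed_boundaries_def Suc)
  qed
qed

lemma transposed_boundaries_subset:
  assumes ex: "free_exact_complex R n d"
  shows "transposed_boundaries R n d k \<subseteq> transposed_cycles R n d k"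
proof
  fix v assume v: "v \<in> transposed_boundaries R n d k"
  have R: "ring R" using left_module_ring[OF exact_complexD(1)[OF ex]] .
  note L = left_module_free[OF R]
  show "v \<in> transposed_cycles R n d k"
  proof (cases k)
    case 0
    have S: "ring (opp_ring R)" by (rule ring_opp_ring[OF R])
    have "\<zero>\<^bsub>free_module R (n 0)\<^esub> \<in> vectors R (n 0)"
      using submoduleD(2)[OF L submodule_carrier[OF L]] .
    then show ?thesis
      using v 0 linear_maps_zero[OF left_module_free[OF S] left_module_free[OF S] transposed_linear[OF ex, of 0]]
      by (simp add: transposed_boundaries_def transposed_cycles_def)
  next
    case (Suc j)
    have vc: "v \<in> vectors R (n k)"
      using v linear_mapsD(1)[OF transposed_linear[OF ex]] Suc by (auto simp: transposed_boundaries_def)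
    have cb: "free_coboundary R n d k (\<lambda>x. pairing R x v)"
      using v transposed_boundaries_coboundary[OF ex vc] by simp
    obtain g where g: "g \<in> functionals R (free_module R (n j))"
      "\<forall>x\<in>vectors R (n (Suc j)). pairing R x v = g (d j x)"
      using cb unfolding Suc coboundary_Suc by (elim bexE) (rule that)
    have "pairing R (d k x) v = \<zero>\<^bsub>R\<^esub>" if x: "x \<in> vectors R (n (Suc k))" for x
      using g(2) linear_mapsD(1)[OF exact_complexD(2)[OF ex] x] exact_complexD(4)[OF ex, of x j] x
        linear_maps_zero[OF L left_module_regular[OF R] g(1)] by (simp add: Suc)
    then have "free_cocycle R n d k (\<lambda>x. pairing R x v)"
      using pairing_linear[OF R vc] by (simp add: cocycle_def)
    then show ?thesis using transposed_cycles_cocycle[OF ex vc] by simp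
  qed
qed

text \<open>The hypothesis \<open>E\<close> says that \<open>Ext k\<close> of the right module \<open>Z k / I k\<close>, with \<open>Z k\<close> and \<open>I k\<close> the
  transposed cycles and boundaries, vanishes: that module is the cokernel of \<open>dG 0\<close>.\<close>

context
  fixes R :: "('a, 'r) ring_scheme" and S :: "('a, 'r) ring_scheme" and n d l
  assumes S_def: "S = opp_ring R" and noeth: "left_noetherian S"
    and ex: "free_exact_complex R n d"
    and split: "\<And>k. l \<le> k \<Longrightarrow> \<exists>h\<in>free_maps R (n k) (n (Suc k)).
      \<forall>x\<in>vectors R (n (Suc k)). d k (h (d k x)) = d k x"
    and E: "\<And>k m dG e. free_exact_complex S m dG \<Longrightarrow>
      e \<in> free_maps S (m 0) (n k) \<Longrightarrow>
      e ` vectors S (m 0) = transposed_cycles R n d k \<Longrightarrow>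
      dG 0 ` vectors S (m (Suc 0)) =
        {y \<in> vectors S (m 0). e y \<in> transposed_boundaries R n d k} \<Longrightarrow>
      free_ext_vanishes S m dG k"
begin

private abbreviation (input) "X k \<equiv> free_module S (n k)"
private abbreviation (input) "\<delta> \<equiv> transposed R n d"
private abbreviation (input) "Z \<equiv> transposed_cycles R n d"
private abbreviation (input) "I \<equiv> transposed_boundaries R n d"

private lemma ringR: "ring R"
  using left_module_ring[OF exact_complexD(1)[OF ex]] .

private lemma ringS: "ring S"
  unfolding S_def by (rule ring_opp_ring[OF ringR])

private lemma \<delta>L: "\<delta> k \<in> linear_maps S (X k) (X (Suc k))"
  unfolding S_def by (rule transposed_linear[OF ex])

private lemma Z_eq: "Z k = {v \<in> carrier (X k). \<delta> k v = \<zero>\<^bsub>X (Suc k)\<^esub>}"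
  by (simp add: transposed_cycles_def S_def)

private lemma I_Suc: "I (Suc k) = \<delta> k ` carrier (X k)"
  by (simp add: transposed_boundaries_def S_def)

private lemma submodule_I: "submodule (I k) S (X k)"
proof (cases k)
  case 0
  then show ?thesis
    using submodule_zero[OF left_module_free[OF ringS], of "n 0"] by (simp add: transposed_boundaries_def S_def)
next
  case (Suc j)
  show ?thesis unfolding Suc I_Suc
    by (rule submodule_image[OF left_module_free[OF ringS] left_module_free[OF ringS] \<delta>L
          submodule_carrier[OF left_module_free[OF ringS]]])
qed

private lemma submodule_Z: "submodule (Z k) S (X k)"
  unfolding Z_eq by (rule submodule_kernel[OF left_module_free[OF ringS] left_module_free[OF ringS] \<delta>L])

private lemma free_resolution_in_X:
  assumes "submodule H S (X k)"
  shows "\<exists>m dG e. free_resolves S m dG (X k) e \<and> e ` vectors S (m 0) = H"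
proof -
  note L = left_module_free[OF ringS, of "n k"]
  have "H \<subseteq> (\<lambda>x. x) ` carrier (X k)" using submoduleD(1)[OF L assms] by simp
  from free_resolution_submodule[OF noeth L assms linear_maps_ident this]
  show ?thesis by metis
qed

text \<open>Resolving \<open>I k \<subseteq> Z k\<close> and taking the cone gives a resolution of \<open>Z k / I k\<close>.\<close>

private lemma cone_of_boundaries:
  assumes GI: "free_resolves S m dG (X k) e" "e ` vectors S (m 0) = I k"
  shows "\<exists>mZ dZ eZ \<phi>. free_resolves S mZ dZ (X k) eZ \<and>
    eZ ` vectors S (mZ 0) = Z k \<and>
    free_chain_map S m dG mZ dZ \<phi> \<and>
    (\<forall>x\<in>vectors S (m 0). eZ (\<phi> 0 x) = e x) \<and>
    free_ext_vanishes S (cone_rank mZ m) (cone_map S mZ dZ m dG \<phi>) k"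
proof -
  note L = left_module_free[OF ringS]
  obtain mZ dZ eZ where GZ: "free_resolves S mZ dZ (X k) eZ"
    "eZ ` vectors S (mZ 0) = Z k"
    using free_resolution_in_X[OF submodule_Z[of k]] by (elim exE conjE) (rule that)
  have sub: "e ` vectors S (m 0) \<subseteq> eZ ` vectors S (mZ 0)"
    using GI(2) GZ(2) transposed_boundaries_subset[OF ex] by simp
  obtain \<phi> where \<phi>: "free_chain_map S m dG mZ dZ \<phi>"
    "\<forall>x\<in>vectors S (m 0). eZ (\<phi> 0 x) = e x"
    using comparison_map[OF GI(1) GZ(1) sub lifts_free_module[OF L L] lifts_free_module[OF L L]]
    by (elim exE conjE) (rule that)
  have "free_ext_vanishes S (cone_rank mZ m) (cone_map S mZ dZ m dG \<phi>) k"
  proof (rule E[of "cone_rank mZ m" "cone_map S mZ dZ m dG \<phi>" eZ])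
    show "free_exact_complex S (cone_rank mZ m) (cone_map S mZ dZ m dG \<phi>)"
      by (rule cone_exact[OF GI(1) GZ(1) \<phi>])
    have c0: "cone_rank mZ m 0 = mZ 0" by (simp add: cone_rank_def)
    show "eZ \<in> linear_maps S (free_module S (cone_rank mZ m 0)) (X k)"
      unfolding c0 by (rule resolvesD(3)[OF GZ(1)])
    show "eZ ` vectors S (cone_rank mZ m 0) = Z k" unfolding c0 by (rule GZ(2))
    show "cone_map S mZ dZ m dG \<phi> 0 ` vectors S (cone_rank mZ m (Suc 0)) =
        {y \<in> vectors S (cone_rank mZ m 0). eZ y \<in> I k}"
      using cone_augmentation_image[OF GI(1) GZ(1) \<phi>] unfolding GI(2) .
  qed
  then show ?thesis using GZ \<phi> by (intro exI conjI)
qed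

text \<open>Prolonging a resolution of \<open>Z k\<close> by the free module \<open>X k\<close> resolves \<open>I (Suc k)\<close>.\<close>

private lemma splice:
  assumes GZ: "free_resolves S m dG (X k) e" "e ` vectors S (m 0) = Z k"
  shows "free_resolves S (case_nat (n k) m) (case_nat e dG) (X (Suc k)) (\<delta> k)"
proof -
  note L = left_module_free[OF ringS] and G = exact_complexD[OF resolvesD(1)[OF GZ(1)]]
  have "free_exact_complex S (case_nat (n k) m) (case_nat e dG)"
    unfolding exact_complex_def
  proof (intro conjI allI)
    show "left_module S (free_module S (case_nat (n k) m i))" for i by (rule L)
    show "case_nat e dG i \<in> linear_maps S (free_module S (case_nat (n k) m (Suc i)))
        (free_module S (case_nat (n k) m i))" for i
      using resolvesD(3)[OF GZ(1)] G(2) by (cases i) auto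
    show "case_nat e dG (Suc i) ` vectors S (case_nat (n k) m (Suc (Suc i))) =
        {x \<in> vectors S (case_nat (n k) m (Suc i)). case_nat e dG i x =
          \<zero>\<^bsub>free_module S (case_nat (n k) m i)\<^esub>}" for i
      using resolvesD(4)[OF GZ(1)] G(3) by (cases i) auto
  qed
  then show ?thesis
    unfolding resolves_def using L \<delta>L GZ(2) Z_eq by simp
qed

text \<open>The statement of the downward induction: \<open>Ext k\<close> of the right module \<open>I (Suc k)\<close> vanishes.\<close>

private definition "higher_ext_vanishes k \<longleftrightarrow> (\<forall>m dG e.
  free_resolves S m dG (X (Suc k)) e \<longrightarrow>
  e ` vectors S (m 0) = I (Suc k) \<longrightarrow> free_ext_vanishes S m dG k)"

text \<open>In high degrees \<open>I (Suc k)\<close> is a direct summand of \<open>X (Suc k)\<close>: transposing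
  \<open>d k \<circ> h \<circ> d k = d k\<close> gives an idempotent with image \<open>I (Suc k)\<close>.\<close>

private lemma higher_ext_vanishes_base:
  assumes "l \<le> Suc k" shows "higher_ext_vanishes (Suc k)"
proof -
  note L = left_module_free[OF ringS]
  obtain h where h: "h \<in> free_maps R (n (Suc k)) (n (Suc (Suc k)))"
    "\<forall>x\<in>vectors R (n (Suc (Suc k))). d (Suc k) (h (d (Suc k) x)) = d (Suc k) x"
    using split[OF assms] by (elim bexE) (rule that)
  define ht where "ht = transpose_map R (n (Suc k)) h"
  have ht: "ht \<in> linear_maps S (X (Suc (Suc k))) (X (Suc k))"
    unfolding ht_def S_def by (rule transpose_map_linear[OF ringR h(1)])
  have cS: "carrier (X j) = vectors R (n j)" for j by (simp add: S_def)
  define p where "p v = \<delta> (Suc k) (ht v)" for v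
  have p: "p \<in> linear_maps S (X (Suc (Suc k))) (X (Suc (Suc k)))"
    unfolding p_def by (rule linear_maps_comp[OF ht \<delta>L])
  have fixed: "p (\<delta> (Suc k) v) = \<delta> (Suc k) v" if v: "v \<in> carrier (X (Suc k))" for v
  proof (rule pairing_nondegenerate[OF ringR])
    have v': "v \<in> vectors R (n (Suc k))" using v cS by simp
    have dv: "\<delta> (Suc k) v \<in> vectors R (n (Suc (Suc k)))"
      using linear_mapsD(1)[OF \<delta>L v] cS by simp
    have hdv: "ht (\<delta> (Suc k) v) \<in> vectors R (n (Suc k))"
      using linear_mapsD(1)[OF linear_maps_comp[OF \<delta>L ht] v] cS by simp
    show "p (\<delta> (Suc k) v) \<in> vectors R (n (Suc (Suc k)))"
      using linear_mapsD(1)[OF linear_maps_comp[OF \<delta>L p] v] cS by simp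
    show "\<delta> (Suc k) v \<in> vectors R (n (Suc (Suc k)))" by (rule dv)
    fix x assume x: "x \<in> vectors R (n (Suc (Suc k)))"
    have dx: "d (Suc k) x \<in> vectors R (n (Suc k))"
      by (rule linear_mapsD(1)[OF exact_complexD(2)[OF ex] x])
    have "pairing R x (p (\<delta> (Suc k) v)) = pairing R (d (Suc k) x) (ht (\<delta> (Suc k) v))"
      unfolding p_def by (rule transposed_adjoint[OF ex hdv x])
    also have "\<dots> = pairing R (h (d (Suc k) x)) (\<delta> (Suc k) v)"
      unfolding ht_def by (rule transpose_map_adjoint[OF ringR h(1) dv dx])
    also have "\<dots> = pairing R (d (Suc k) (h (d (Suc k) x))) v"
      by (rule transposed_adjoint[OF ex v' linear_mapsD(1)[OF h(1) dx]])
    also have "\<dots> = pairing R x (\<delta> (Suc k) v)"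
      using h(2) x transposed_adjoint[OF ex v' x] by simp
    finally show "pairing R x (p (\<delta> (Suc k) v)) = pairing R x (\<delta> (Suc k) v)" .
  qed
  have "p (p v) = p v" if "v \<in> carrier (X (Suc (Suc k)))" for v
    using fixed[OF linear_mapsD(1)[OF ht that]] unfolding p_def .
  then obtain dP where dP: "free_resolves S (\<lambda>_. n (Suc (Suc k))) dP (X (Suc (Suc k))) p"
    "\<forall>j. free_ext_vanishes S (\<lambda>_. n (Suc (Suc k))) dP (Suc j)"
    using idempotent_resolution[OF ringS p] by (elim meta_impE exE conjE) (assumption, rule that)
  have imp: "p ` carrier (X (Suc (Suc k))) = I (Suc (Suc k))"
  proof (intro equalityI subsetI)
    fix w assume "w \<in> p ` carrier (X (Suc (Suc k)))"
    then show "w \<in> I (Suc (Suc k))" using linear_mapsD(1)[OF ht] unfolding I_Suc p_def by blast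
  next
    fix w assume "w \<in> I (Suc (Suc k))"
    then obtain v where v: "v \<in> carrier (X (Suc k))" "w = \<delta> (Suc k) v" unfolding I_Suc by blast
    show "w \<in> p ` carrier (X (Suc (Suc k)))"
      using fixed[OF v(1)] v(2) linear_mapsD(1)[OF \<delta>L v(1)] by (metis imageI)
  qed
  show ?thesis unfolding higher_ext_vanishes_def
  proof (intro allI impI)
    fix m dG e assume G: "free_resolves S m dG (X (Suc (Suc k))) e"
      "e ` vectors S (m 0) = I (Suc (Suc k))"
    show "free_ext_vanishes S m dG (Suc k)"
      using free_resolution_ext_vanishes_unique[OF G(1) dP(1)] G(2) imp dP(2) by simp
  qed
qed

text \<open>In the splice the terms of a resolution of \<open>Z\<close> move up by one, so the vanishing of
  \<open>Ext (Suc (Suc k))\<close> for \<open>I\<close> in the next degree becomes that of \<open>Ext (Suc k)\<close> for \<open>Z\<close>. The cone then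
  passes from \<open>Z\<close> to \<open>I\<close> in the same degree.\<close>

private lemma higher_ext_vanishes_step:
  assumes H: "higher_ext_vanishes (Suc (Suc k))" shows "higher_ext_vanishes (Suc k)"
  unfolding higher_ext_vanishes_def
proof (intro allI impI)
  fix m dG e assume GI: "free_resolves S m dG (X (Suc (Suc k))) e"
    "e ` vectors S (m 0) = I (Suc (Suc k))"
  obtain mZ dZ eZ \<phi> where GZ: "free_resolves S mZ dZ (X (Suc (Suc k))) eZ"
    "eZ ` vectors S (mZ 0) = Z (Suc (Suc k))"
    and \<phi>: "free_chain_map S m dG mZ dZ \<phi>"
      "\<forall>x\<in>vectors S (m 0). eZ (\<phi> 0 x) = e x"
    and cone: "free_ext_vanishes S (cone_rank mZ m) (cone_map S mZ dZ m dG \<phi>) (Suc (Suc k))"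
    using cone_of_boundaries[OF GI] by (elim exE conjE) (rule that)
  have spl: "free_ext_vanishes S (case_nat (n (Suc (Suc k))) mZ) (case_nat eZ dZ) (Suc (Suc k))"
    using H splice[OF GZ] I_Suc unfolding higher_ext_vanishes_def by simp
  have "free_ext_vanishes S mZ dZ (Suc k)"
    unfolding ext_vanishes_def
  proof (intro allI impI)
    fix f assume "free_cocycle S mZ dZ (Suc k) f"
    then have "free_cocycle S (case_nat (n (Suc (Suc k))) mZ) (case_nat eZ dZ) (Suc (Suc k)) f"
      by (simp add: cocycle_def)
    then have "free_coboundary S (case_nat (n (Suc (Suc k))) mZ) (case_nat eZ dZ) (Suc (Suc k)) f"
      using spl by (simp add: ext_vanishes_def)
    then show "free_coboundary S mZ dZ (Suc k) f"
      by (simp add: coboundary_Suc)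
  qed
  then show "free_ext_vanishes S m dG (Suc k)"
    by (rule cone_source_ext_vanishes[OF GI(1) GZ(1) \<phi> cone])
qed

private lemma higher_ext_vanishes_all: "higher_ext_vanishes (Suc k)"
proof (cases "l \<le> Suc k")
  case False
  then have "k \<le> l" by simp
  then show ?thesis
    by (induction rule: inc_induct)
      (auto intro: higher_ext_vanishes_base higher_ext_vanishes_step)
qed (rule higher_ext_vanishes_base)

text \<open>Double duality in degree 0. A vector \<open>v\<close> of the free module at position 0 is a functional on
  \<open>X 0\<close>; it kills \<open>Z 0\<close>, so it descends to \<open>I 1\<close>, and the vanishing statements extend it first to
  \<open>Z 1\<close> and then to \<open>X 1\<close>. The extension is a preimage of \<open>v\<close> under \<open>d 0\<close>.\<close>

lemma augmented_module_zero:
  "d 0 ` vectors R (n (Suc 0)) = vectors R (n 0)"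
proof (intro equalityI subsetI)
  show "v \<in> vectors R (n 0)" if "v \<in> d 0 ` vectors R (n (Suc 0))" for v
    using that linear_mapsD(1)[OF exact_complexD(2)[OF ex]] by auto
next
  fix v assume v: "v \<in> vectors R (n 0)"
  note L = left_module_free[OF ringS] and SL = left_module_regular[OF ringS]
  have cS: "carrier (X j) = vectors R (n j)" for j by (simp add: S_def)
  interpret R: ring R by (rule ringR)
  interpret S: ring S by (rule ringS)
  interpret X0: left_module S "X 0" by (rule L)
  interpret X1: left_module S "X (Suc 0)" by (rule L)
  have vf: "pairing R v \<in> functionals S (X 0)"
    unfolding S_def by (rule pairing_linear_right[OF ringR v])
  have vZ: "pairing R v u = \<zero>\<^bsub>S\<^esub>" if u: "u \<in> Z 0" for u
  proof -
    obtain m dG e where G: "free_resolves S m dG (X 0) e" "e ` vectors S (m 0) = Z 0"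
      using free_resolution_in_X[OF submodule_Z[of 0]] by (elim exE conjE) (rule that)
    have "free_ext_vanishes S m dG 0"
    proof (rule E)
      show "dG 0 ` vectors S (m (Suc 0)) = {y \<in> vectors S (m 0). e y \<in> I 0}"
        using resolvesD(4)[OF G(1)] by (simp add: transposed_boundaries_def S_def)
    qed (use resolvesD(1,3)[OF G(1)] G(2) in simp_all)
    moreover have "free_cocycle S m dG 0 (\<lambda>x. pairing R v (e x))"
      unfolding cocycle_def
      using linear_maps_comp[OF resolvesD(3)[OF G(1)] vf] resolvesD(5)[OF G(1)]
        linear_maps_zero[OF L SL vf] by simp
    ultimately have "\<forall>x\<in>vectors S (m 0). pairing R v (e x) = \<zero>\<^bsub>S\<^esub>"
      unfolding ext_vanishes_def coboundary_0 by (elim allE impE)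
    then show ?thesis using u unfolding G(2)[symmetric] by blast
  qed
  obtain m dG e where GI: "free_resolves S m dG (X (Suc 0)) e"
    "e ` vectors S (m 0) = I (Suc 0)"
    using free_resolution_in_X[OF submodule_I[of "Suc 0"]] by (elim exE conjE) (rule that)
  obtain mZ dZ eZ \<phi> where GZ: "free_resolves S mZ dZ (X (Suc 0)) eZ"
    "eZ ` vectors S (mZ 0) = Z (Suc 0)"
    and \<phi>: "free_chain_map S m dG mZ dZ \<phi>"
      "\<forall>x\<in>vectors S (m 0). eZ (\<phi> 0 x) = e x"
    and cone: "free_ext_vanishes S (cone_rank mZ m) (cone_map S mZ dZ m dG \<phi>) (Suc 0)"
    using cone_of_boundaries[OF GI] by (elim exE conjE) (rule that)
  have eL: "e \<in> linear_maps S (free_module S (m 0)) (X (Suc 0))" by (rule resolvesD(3)[OF GI(1)])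
  have eim: "e ` vectors S (m 0) \<subseteq> \<delta> 0 ` carrier (X 0)" unfolding GI(2) I_Suc by simp
  obtain \<rho> where \<rho>: "\<rho> \<in> linear_maps S (free_module S (m 0)) (X 0)"
    "\<forall>x\<in>vectors S (m 0). \<delta> 0 (\<rho> x) = e x"
    using free_module_lift[OF L L eL \<delta>L eim] by (elim bexE) (rule that)
  define f where "f x = pairing R v (\<rho> x)" for x
  have f: "f \<in> functionals S (free_module S (m 0))"
    unfolding f_def by (rule linear_maps_comp[OF \<rho>(1) vf])
  have fc: "free_cocycle S m dG 0 f"
    unfolding cocycle_def
  proof (intro conjI ballI)
    fix x assume x: "x \<in> vectors S (m (Suc 0))"
    have dx: "dG 0 x \<in> vectors S (m 0)"
      by (rule linear_mapsD(1)[OF exact_complexD(2)[OF resolvesD(1)[OF GI(1)]] x])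
    have "\<delta> 0 (\<rho> (dG 0 x)) = \<zero>\<^bsub>X (Suc 0)\<^esub>" using \<rho>(2) dx resolvesD(5)[OF GI(1) x] by simp
    then have "\<rho> (dG 0 x) \<in> Z 0" using linear_mapsD(1)[OF \<rho>(1) dx] unfolding Z_eq by simp
    then show "f (dG 0 x) = \<zero>\<^bsub>S\<^esub>" unfolding f_def by (rule vZ)
  qed (rule f)
  have cb: "free_coboundary S (cone_rank mZ m) (cone_map S mZ dZ m dG \<phi>) (Suc 0)
      (\<lambda>z. f (drop (mZ (Suc 0)) z))"
    by (rule cone[unfolded ext_vanishes_def, rule_format, OF cone_cocycle_shift[OF GI(1) GZ(1) \<phi> fc]])
  obtain g where g: "free_cocycle S mZ dZ 0 g"
    "free_coboundary S m dG 0 (\<lambda>x. f x \<ominus>\<^bsub>S\<^esub> g (\<phi> 0 x))"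
    using cone_shift_coboundaryE[OF GI(1) GZ(1) \<phi> f cb] by (elim exE conjE) (rule that)
  have "free_cocycle S (case_nat (n (Suc 0)) mZ) (case_nat eZ dZ) (Suc 0) g"
    using g(1) by (simp add: cocycle_def)
  moreover have "free_ext_vanishes S (case_nat (n (Suc 0)) mZ) (case_nat eZ dZ) (Suc 0)"
    using higher_ext_vanishes_all[of 0] splice[OF GZ] I_Suc unfolding higher_ext_vanishes_def by simp
  ultimately have "free_coboundary S (case_nat (n (Suc 0)) mZ) (case_nat eZ dZ) (Suc 0) g"
    by (simp add: ext_vanishes_def)
  then have "\<exists>w\<in>functionals S (X (Suc 0)).
      \<forall>y\<in>vectors S (mZ 0). g y = w (eZ y)"
    by (simp add: coboundary_Suc)
  then obtain w where w: "w \<in> functionals S (X (Suc 0))"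
    "\<forall>y\<in>vectors S (mZ 0). g y = w (eZ y)" by (elim bexE) (rule that)
  obtain u where u: "u \<in> carrier (X (Suc 0))"
    "\<And>y. y \<in> carrier (X (Suc 0)) \<Longrightarrow> w y = pairing S y u"
    by (rule functional_eq_pairing[OF ringS w(1)]) (rule that)
  have u': "u \<in> vectors R (n (Suc 0))" using u(1) cS by simp
  have fu: "pairing R v (\<rho> x) = pairing R u (e x)" if x: "x \<in> vectors S (m 0)" for x
  proof -
    have px: "\<phi> 0 x \<in> vectors S (mZ 0)" by (rule linear_mapsD(1)[OF chain_mapD(1)[OF \<phi>(1)] x])
    have ex': "e x \<in> carrier (X (Suc 0))" by (rule linear_mapsD(1)[OF eL x])
    have gx: "g (\<phi> 0 x) = pairing R u (e x)"
      using w(2) px \<phi>(2) x u(2)[OF ex'] pairing_opp[of R "e x" u] by (simp add: S_def)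
    have "f x \<ominus>\<^bsub>S\<^esub> g (\<phi> 0 x) = \<zero>\<^bsub>S\<^esub>" using g(2) x by (simp add: coboundary_0)
    moreover have "f x \<in> carrier S" using linear_mapsD(1)[OF f x] by simp
    moreover have "g (\<phi> 0 x) \<in> carrier S"
      using g(1) linear_mapsD(1)[OF _ px] unfolding cocycle_def by fastforce
    ultimately have "f x = g (\<phi> 0 x)"
      by (metis S.a_inv_closed S.minus_eq S.minus_equality S.minus_minus)
    then show ?thesis using gx by (simp add: f_def)
  qed
  have "v = d 0 u"
  proof (rule pairing_nondegenerate[OF ringS])
    show "v \<in> carrier (X 0)" using v cS by simp
    have du: "d 0 u \<in> vectors R (n 0)" by (rule linear_mapsD(1)[OF exact_complexD(2)[OF ex] u'])
    show "d 0 u \<in> carrier (X 0)" using du cS by simp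
    fix y assume y: "y \<in> carrier (X 0)"
    then have y': "y \<in> vectors R (n 0)" using cS by simp
    have "\<delta> 0 y \<in> e ` vectors S (m 0)" unfolding GI(2) I_Suc using y by (rule imageI)
    then obtain x where x: "x \<in> vectors S (m 0)" "\<delta> 0 y = e x" by (rule imageE) (rule that)
    have rx: "\<rho> x \<in> carrier (X 0)" by (rule linear_mapsD(1)[OF \<rho>(1) x(1)])
    have "\<delta> 0 (y \<ominus>\<^bsub>X 0\<^esub> \<rho> x) = \<delta> 0 y \<ominus>\<^bsub>X (Suc 0)\<^esub> \<delta> 0 (\<rho> x)"
      by (rule linear_maps_minus(2)[OF L L \<delta>L rx y])
    also have "\<dots> = \<zero>\<^bsub>X (Suc 0)\<^esub>"
      using \<rho>(2) x linear_mapsD(1)[OF eL x(1)] by (simp add: X1.M.minus_eq X1.M.r_neg del: free_module_simps)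
    finally have "y \<ominus>\<^bsub>X 0\<^esub> \<rho> x \<in> Z 0"
      unfolding Z_eq using X0.M.minus_closed[OF y rx] by simp
    then have "pairing R v (y \<ominus>\<^bsub>X 0\<^esub> \<rho> x) = \<zero>\<^bsub>S\<^esub>" by (rule vZ)
    moreover have "y = (y \<ominus>\<^bsub>X 0\<^esub> \<rho> x) \<oplus>\<^bsub>X 0\<^esub> \<rho> x"
      using y rx by (simp add: X0.M.minus_eq X0.M.a_assoc X0.M.l_neg del: free_module_simps)
    ultimately have "pairing R v y = \<zero>\<^bsub>S\<^esub> \<oplus>\<^bsub>S\<^esub> pairing R v (\<rho> x)"
      using linear_mapsD(2)[OF vf X0.M.minus_closed[OF y rx] rx] by simp
    also have "\<dots> = pairing R u (\<delta> 0 y)"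
      using linear_mapsD(1)[OF vf rx] fu[OF x(1)] x(2) by simp
    also have "\<dots> = pairing R (d 0 u) y" by (rule transposed_adjoint[OF ex y' u'])
    finally show "pairing S y v = pairing S y (d 0 u)" unfolding S_def pairing_opp .
  qed
  then show "v \<in> d 0 ` vectors R (n (Suc 0))" using u' by (rule image_eqI)
qed

end

section \<open>The grade of the last homology module\<close>

lemma zero_resolution:
  assumes M: "left_module R M"
  shows "free_resolves R (\<lambda>_. 0) (\<lambda>k x. []) M (\<lambda>x. \<zero>\<^bsub>M\<^esub>)"
    and "free_ext_vanishes R (\<lambda>_. 0) (\<lambda>k x. []) k"
proof -
  have R: "ring R" by (rule left_module_ring[OF M])
  interpret R: ring R by (rule R)
  note L = left_module_free[OF R] and RL = left_module_regular[OF R]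
  have z: "(\<lambda>x. []) \<in> free_maps R 0 0"
    using linear_maps_const_zero[OF L, of 0] by simp
  show "free_resolves R (\<lambda>_. 0) (\<lambda>k x. []) M (\<lambda>x. \<zero>\<^bsub>M\<^esub>)"
    unfolding resolves_def exact_complex_def
    using L M z linear_maps_const_zero[OF M, of "free_module R 0"] by simp
  show "free_ext_vanishes R (\<lambda>_. 0) (\<lambda>k x. []) k"
    unfolding ext_vanishes_def
  proof (intro allI impI)
    fix f assume "free_cocycle R (\<lambda>_. 0) (\<lambda>k x. []) k f"
    then have f: "f \<in> functionals R (free_module R 0)" by (simp add: cocycle_def)
    have "f [] = \<zero>\<^bsub>R\<^esub>" using linear_maps_zero[OF L RL f] by simp
    then show "free_coboundary R (\<lambda>_. 0) (\<lambda>k x. []) k f"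
      using linear_maps_const_zero[OF RL, of "free_module R 0"]
      by (cases k) (auto simp: coboundary_0 coboundary_Suc)
  qed
qed

text \<open>Finite global dimension and Auslander's condition speak of modules carried by cosets of lists.
  The cokernel of the last differential is the copy of the resolved module with such a carrier.\<close>

lemma cokernel_resolution:
  fixes R :: "('a, 'r) ring_scheme"
  assumes ex: "free_exact_complex R n d"
  shows "\<exists>(Q :: ('a, 'a list set) module) e. free_resolves R n d Q e \<and>
    e ` vectors R (n 0) = carrier Q \<and> left_module R Q \<and> finitely_generated R Q"
proof -
  note L = exact_complexD(1)[OF ex]
  let ?F = "free_module R (n 0)" and ?B = "d 0 ` vectors R (n (Suc 0))"
  have L0: "left_module R ?F" using L[of 0] by simp
  have B: "submodule ?B R ?F"
    using submodule_image[OF L L exact_complexD(2)[OF ex] submodule_carrier[OF L], of 0] by simp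
  have Z: "submodule (carrier ?F) R ?F" by (rule submodule_carrier[OF L0])
  define Q where "Q = subquotient ?F (carrier ?F) ?B"
  have Q: "left_module R Q" unfolding Q_def by (rule left_module_subquotient[OF L0 B Z])
  define e where "e x = ?B +>\<^bsub>?F\<^esub> x" for x
  have e: "e \<in> linear_maps R ?F Q"
    using coset_map_linear[OF L0 B Z] unfolding e_def Q_def by simp
  have im: "e ` carrier ?F = carrier Q" unfolding e_def Q_def subquotient_simps ..
  have "free_resolves R n d Q e"
    unfolding resolves_def
    using ex Q e coset_eq_self_iff[OF L0 B] submoduleD(1)[OF L0 B]
    by (auto simp: e_def Q_def subquotient_simps)
  then show ?thesis using im Q finitely_generated_free_image[OF Q e im] by blast
qed

lemma cohomology_class_cong:
  assumes "\<And>x. x \<in> carrier (P k) \<Longrightarrow> f x = g x"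
  shows "cohomology_class R P d k f = cohomology_class R P d k g"
  unfolding cohomology_class_def using assms by (simp cong: restrict_cong)

lemma finitely_generated_free_resolution:
  assumes "left_noetherian R" "left_module R M" "finitely_generated R M"
  shows "\<exists>n d e. free_resolves R n d M e \<and> e ` vectors R (n 0) = carrier M"
proof -
  obtain r e where e: "e \<in> linear_maps R (free_module R r) M" "e ` vectors R r = carrier M"
    by (rule finitely_generated_cover[OF assms(2,3)]) (rule that)
  obtain n d where n: "n 0 = r" "free_resolves R n d M e"
    by (rule free_resolution_exists[OF assms(1,2) e(1)])
  have "e ` vectors R (n 0) = carrier M" unfolding n(1) by (rule e(2))
  with n(2) show ?thesis by (intro exI conjI)
qed

text \<open>Let \<open>N \<subseteq> L\<close> be the submodules of \<open>M\<close> that \<open>X\<close> and \<open>Y\<close> resolve. Since \<open>Ext k L\<close> and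
  \<open>Ext (Suc k) L\<close> are zero, \<open>Ext k N\<close> is isomorphic to \<open>Ext (Suc k) (L / N)\<close>. Auslander's
  condition for \<open>L / N\<close> then bounds the grade of \<open>Ext k N\<close> below by \<open>Suc k\<close>, one more than the
  condition for \<open>N\<close> would give. So \<open>Ext k\<close> of the right module \<open>Ext k N\<close>, which is the
  cokernel of \<open>dG 0\<close>, vanishes.\<close>

lemma ext_of_submodule_ext_vanishes:
  fixes A :: "('a, 'r) ring_scheme" and M :: "('a, 'b, 'm) module_scheme"
  assumes ausl: "auslander_condition A"
    and X: "free_resolves A nX dX M eX"
    and Y: "free_resolves A nY dY M eY"
    and \<phi>: "free_chain_map A nX dX nY dY \<phi>"
    and \<phi>0: "\<forall>x\<in>vectors A (nX 0). eY (\<phi> 0 x) = eX x"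
    and Yk: "free_ext_vanishes A nY dY k" "free_ext_vanishes A nY dY (Suc k)"
    and S_def: "S = opp_ring A"
    and G: "free_exact_complex S g dG"
    and e: "e \<in> free_maps S (g 0) (nX k)"
    and im: "e ` vectors S (g 0) = transposed_cycles A nX dX k"
    and ker: "dG 0 ` vectors S (g (Suc 0)) =
      {y \<in> vectors S (g 0). e y \<in> transposed_boundaries A nX dX k}"
  shows "free_ext_vanishes S g dG k"
proof -
  note exX = resolvesD(1)[OF X]
  have A: "ring A" by (rule left_module_ring[OF resolvesD(2)[OF X]])
  define nC where "nC = cone_rank nY nX"
  define dC where "dC = cone_map A nY dY nX dX \<phi>"
  note exC = cone_exact[OF X Y \<phi> \<phi>0, folded nC_def dC_def]
  obtain Q :: "('a, 'a list set) module" and eQ where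
    Q: "free_resolves A nC dC Q eQ" "eQ ` vectors A (nC 0) = carrier Q"
    "left_module A Q" "finitely_generated A Q"
    using cokernel_resolution[OF exC] by (elim exE conjE) (rule that)
  obtain P :: "nat \<Rightarrow> ('a, ('a + 'a list set) list) module" and dP eP where
    P: "projective_resolution A Q P dP eP" "\<forall>k. ext_module A Q k = dual_cohomology A P dP k"
    using ext_module_resolution[OF Q(1,2)] by (elim exE conjE) (rule that)
  have exP: "exact_complex A P dP"
    by (rule resolvesD(1)[OF projective_resolution_resolves(1)[OF P(1) Q(3)]])
  obtain \<psi> where \<psi>: "chain_map A P dP (free_sequence A nC) dC \<psi>"
    "\<forall>k f. free_cocycle A nC dC k f \<longrightarrow>
      coboundary A P dP k (\<lambda>x. f (\<psi> k x)) = free_coboundary A nC dC k f"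
    "\<forall>k u. cocycle A P dP k u \<longrightarrow> (\<exists>f. free_cocycle A nC dC k f \<and>
        coboundary A P dP k (\<lambda>x. u x \<ominus>\<^bsub>A\<^esub> f (\<psi> k x)))"
    using free_projective_comparison[OF P(1) Q(1,2)] by (elim exE conjE) (rule that)
  let ?K = "Suc k"
  define E where "E = dual_cohomology A P dP ?K"
  have EL: "left_module S E" unfolding E_def S_def by (rule left_module_dual_cohomology[OF exP])
  define u where "u p = drop (nY ?K) (\<psi> ?K p)" for p
  have "free_module A (nC ?K) = free_module A (nY ?K + nX k)" by (simp add: nC_def cone_rank_def)
  then have uL: "u \<in> linear_maps A (P ?K) (free_module A (nX k))"
    unfolding u_def using linear_maps_comp[OF chain_mapD(1)[OF \<psi>(1), of ?K], of "drop (nY ?K)"] drop_linear by metis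
  note uc = linear_mapsD(1)[OF uL]
  \<comment> \<open>\<open>\<theta>\<close> sends a cocycle on \<open>X\<close> to its class in \<open>Ext (Suc k)\<close> of the quotient. It turns the
    augmentation \<open>e\<close> into one of that Ext module.\<close>
  define \<theta> where "\<theta> v = cohomology_class A P dP ?K (\<lambda>p. pairing A (u p) v)" for v
  have pl: "(\<lambda>p. pairing A (u p) v) \<in> functionals A (P ?K)"
    if "v \<in> vectors A (nX k)" for v
    by (rule linear_maps_comp[OF uL pairing_linear[OF A that]])
  have shift: "free_cocycle A nC dC ?K (\<lambda>z. pairing A (drop (nY ?K) z) v)"
    if "v \<in> transposed_cycles A nX dX k" for v
  proof -
    have v: "v \<in> vectors A (nX k)" using that by (simp add: transposed_cycles_def)
    then have "free_cocycle A nX dX k (\<lambda>x. pairing A x v)"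
      using transposed_cycles_cocycle[OF exX v] that by simp
    from cone_cocycle_shift[OF X Y \<phi> \<phi>0 this] show ?thesis unfolding nC_def dC_def .
  qed
  have ec: "e y \<in> transposed_cycles A nX dX k" "e y \<in> vectors A (nX k)"
    if "y \<in> vectors S (g 0)" for y
    using that im by (auto simp: transposed_cycles_def)
  have \<theta>c: "\<theta> v \<in> carrier E" if v: "v \<in> transposed_cycles A nX dX k" for v
    unfolding \<theta>_def E_def cohomology_class_image[OF exP] u_def
    using cocycle_pullback[OF \<psi>(1) shift[OF v]] by blast
  have eL: "(\<lambda>y. \<theta> (e y)) \<in> linear_maps S (free_module S (g 0)) E"
  proof (rule linear_mapsI)
    show "\<theta> (e y) \<in> carrier E" if "y \<in> vectors S (g 0)" for y
      by (rule \<theta>c[OF ec(1)[OF that]])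
    show "\<theta> (e (y \<oplus>\<^bsub>free_module S (g 0)\<^esub> y')) = \<theta> (e y) \<oplus>\<^bsub>E\<^esub> \<theta> (e y')"
      if y: "y \<in> vectors S (g 0)" "y' \<in> vectors S (g 0)" for y y'
    proof -
      have "pairing A (u p) (e (y \<oplus>\<^bsub>free_module S (g 0)\<^esub> y')) = pairing A (u p) (e y) \<oplus>\<^bsub>A\<^esub> pairing A (u p) (e y')"
        if p: "p \<in> carrier (P ?K)" for p
        unfolding linear_mapsD(2)[OF e y] unfolding S_def
        using linear_mapsD(2)[OF pairing_linear_right[OF A uc[OF p]]] ec(2)[OF y(1)] ec(2)[OF y(2)] by simp
      then have "\<theta> (e (y \<oplus>\<^bsub>free_module S (g 0)\<^esub> y')) =
          cohomology_class A P dP ?K (\<lambda>p. pairing A (u p) (e y) \<oplus>\<^bsub>A\<^esub> pairing A (u p) (e y'))"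
        unfolding \<theta>_def by (rule cohomology_class_cong)
      also have "\<dots> = \<theta> (e y) \<oplus>\<^bsub>E\<^esub> \<theta> (e y')"
        unfolding \<theta>_def E_def by (rule cohomology_class_add[OF exP pl[OF ec(2)[OF y(1)]] pl[OF ec(2)[OF y(2)]]])
      finally show ?thesis .
    qed
    show "\<theta> (e (a \<odot>\<^bsub>free_module S (g 0)\<^esub> y)) = a \<odot>\<^bsub>E\<^esub> \<theta> (e y)"
      if a: "a \<in> carrier S" and y: "y \<in> vectors S (g 0)" for a y
    proof -
      have a': "a \<in> carrier A" using a by (simp add: S_def)
      have "pairing A (u p) (e (a \<odot>\<^bsub>free_module S (g 0)\<^esub> y)) = pairing A (u p) (e y) \<otimes>\<^bsub>A\<^esub> a"
        if p: "p \<in> carrier (P ?K)" for p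
        unfolding linear_mapsD(3)[OF e a y] unfolding S_def
        using linear_mapsD(3)[OF pairing_linear_right[OF A uc[OF p]]] ec(2)[OF y] a' by simp
      then have "\<theta> (e (a \<odot>\<^bsub>free_module S (g 0)\<^esub> y)) =
          cohomology_class A P dP ?K (\<lambda>p. pairing A (u p) (e y) \<otimes>\<^bsub>A\<^esub> a)"
        unfolding \<theta>_def by (rule cohomology_class_cong)
      also have "\<dots> = a \<odot>\<^bsub>E\<^esub> \<theta> (e y)"
        unfolding \<theta>_def E_def by (rule cohomology_class_smult[OF exP pl[OF ec(2)[OF y]] a'])
      finally show ?thesis .
    qed
  qed
  have \<theta>0: "\<theta> v = \<zero>\<^bsub>E\<^esub> \<longleftrightarrow> v \<in> transposed_boundaries A nX dX k"
    if v: "v \<in> transposed_cycles A nX dX k" for v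
  proof -
    have vc: "v \<in> vectors A (nX k)" using v by (simp add: transposed_cycles_def)
    have cv: "free_cocycle A nX dX k (\<lambda>x. pairing A x v)"
      using transposed_cycles_cocycle[OF exX vc] v by simp
    have "\<theta> v = \<zero>\<^bsub>E\<^esub> \<longleftrightarrow> coboundary A P dP ?K (\<lambda>p. pairing A (u p) v)"
      unfolding \<theta>_def E_def by (rule cohomology_class_zero_iff[OF exP pl[OF vc]])
    also have "\<dots> \<longleftrightarrow> free_coboundary A nC dC ?K (\<lambda>z. pairing A (drop (nY ?K) z) v)"
      unfolding u_def by (rule \<psi>(2)[rule_format, OF shift[OF v]])
    also have "\<dots> \<longleftrightarrow> free_coboundary A nX dX k (\<lambda>x. pairing A x v)"
      unfolding nC_def dC_def by (rule cone_shift_coboundary_iff[OF X Y \<phi> \<phi>0 cv Yk(1)])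
    also have "\<dots> \<longleftrightarrow> v \<in> transposed_boundaries A nX dX k"
      by (rule transposed_boundaries_coboundary[OF exX vc, symmetric])
    finally show ?thesis .
  qed
  have onto: "carrier E \<subseteq> \<theta> ` transposed_cycles A nX dX k"
  proof
    fix c assume "c \<in> carrier E"
    then obtain w where w: "cocycle A P dP ?K w" "c = cohomology_class A P dP ?K w"
      unfolding E_def cohomology_class_image[OF exP] by blast
    obtain f where f: "free_cocycle A nC dC ?K f"
      "coboundary A P dP ?K (\<lambda>x. w x \<ominus>\<^bsub>A\<^esub> f (\<psi> ?K x))"
      using \<psi>(3)[rule_format, OF w(1)] by (elim exE conjE) (rule that)
    obtain f' where f': "free_cocycle A nX dX k f'"
      "free_coboundary A nC dC ?K (\<lambda>z. f z \<ominus>\<^bsub>A\<^esub> f' (drop (nY ?K) z))"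
      using cone_cocycle_cohomologous_shift[OF X Y \<phi> \<phi>0 f(1)[unfolded nC_def dC_def] Yk(2), folded nC_def dC_def]
      by (elim exE conjE) (rule that)
    have f'l: "f' \<in> functionals A (free_module A (nX k))"
      using f'(1) by (simp add: cocycle_def)
    obtain v where v: "v \<in> vectors A (nX k)"
      "\<And>x. x \<in> vectors A (nX k) \<Longrightarrow> f' x = pairing A x v"
      by (rule functional_eq_pairing[OF A f'l]) (rule that)
    have "free_cocycle A nX dX k (\<lambda>x. pairing A x v)"
      using f'(1) v(2) pairing_linear[OF A v(1)] linear_mapsD(1)[OF exact_complexD(2)[OF exX]]
      by (simp add: cocycle_def)
    then have vZ: "v \<in> transposed_cycles A nX dX k" using transposed_cycles_cocycle[OF exX v(1)] by simp
    have fp: "cocycle A P dP ?K (\<lambda>x. f (\<psi> ?K x))" by (rule cocycle_pullback[OF \<psi>(1) f(1)])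
    have f'p: "(\<lambda>x. f' (u x)) \<in> functionals A (P ?K)"
      by (rule linear_maps_comp[OF uL f'l])
    have "c = cohomology_class A P dP ?K (\<lambda>x. f (\<psi> ?K x))"
      unfolding w(2) using cohomology_class_eq_iff[OF exP] w(1) fp f(2) by (simp add: cocycle_def)
    also have "\<dots> = cohomology_class A P dP ?K (\<lambda>x. f' (u x))"
      using cohomology_class_eq_iff[OF exP _ f'p] fp coboundary_pullback[OF \<psi>(1) f'(2)]
      by (simp add: cocycle_def u_def)
    also have "\<dots> = \<theta> v"
      unfolding \<theta>_def by (rule cohomology_class_cong) (simp add: v(2) uc)
    finally show "c \<in> \<theta> ` transposed_cycles A nX dX k" using vZ by (rule image_eqI)
  qed
  have eim: "(\<lambda>y. \<theta> (e y)) ` vectors S (g 0) = carrier E"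
  proof -
    have "(\<lambda>y. \<theta> (e y)) ` vectors S (g 0) = \<theta> ` transposed_cycles A nX dX k"
      unfolding im[symmetric] image_image ..
    also have "\<dots> = carrier E" using onto image_subsetI[OF \<theta>c] by (rule equalityI[rotated])
    finally show ?thesis .
  qed
  have res: "free_resolves S g dG E (\<lambda>y. \<theta> (e y))"
    unfolding resolves_def using G EL eL ker ec(1) \<theta>0 by auto
  have "submodule (carrier E) S E" by (rule submodule_carrier[OF EL])
  then have "enat ?K \<le> grade S (E\<lparr>carrier := carrier E\<rparr>)"
    using ausl[unfolded auslander_condition_def, rule_format, OF Q(3,4), of "carrier E" ?K] P(2)
    by (simp add: E_def S_def)
  then have "enat k < grade S E" by (simp add: Suc_ile_eq)
  then show ?thesis using ext_trivial_below_grade ext_module_trivial_iff[OF res eim] by blast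
qed

lemma trivial_subquotient_iff:
  assumes "left_module R M" "submodule B R M" "submodule Z R M"
  shows "trivial_module (subquotient M Z B) \<longleftrightarrow> Z \<subseteq> B"
proof -
  have "trivial_module (subquotient M Z B) \<longleftrightarrow> (\<forall>x\<in>Z. B +>\<^bsub>M\<^esub> x = B)"
    unfolding trivial_module_def subquotient_simps using submoduleD(2)[OF assms(1,3)] by blast
  also have "\<dots> \<longleftrightarrow> Z \<subseteq> B"
    using coset_eq_self_iff[OF assms(1,2)] submoduleD(1)[OF assms(1,3)] by blast
  finally show ?thesis .
qed

context
  fixes A :: "('a, 'r) ring_scheme" and M :: "nat \<Rightarrow> ('a, 'b, 'm) module_scheme"
    and d :: "nat \<Rightarrow> 'b \<Rightarrow> 'b" and m i :: nat
  assumes noeth: "left_noetherian A" and is_complex: "module_complex A M d"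
    and top: "\<forall>q>m. trivial_module (M q)"
    and fg: "\<forall>q\<le>m. finitely_generated A (M q)"
    and pd: "\<forall>q\<le>m. pdim A (M q) \<le> enat (m - q)"
    and acyclic: "\<forall>q. i < q \<and> q \<le> m \<longrightarrow> trivial_module (homology M d q)"
begin

private abbreviation (input) "B q \<equiv> d q ` carrier (M (Suc q))"

private lemma term_mod: "left_module A (M q)"
  using is_complex by (simp add: module_complex_def)

private lemma dL: "d q \<in> linear_maps A (M (Suc q)) (M q)"
  using is_complex by (simp add: module_complex_def)

private lemma submodule_B: "submodule (B q) A (M q)"
  by (rule submodule_image[OF term_mod term_mod dL submodule_carrier[OF term_mod]])

private lemma submodule_cycles: "submodule (cycles M d q) A (M q)"
  using submodule_carrier[OF term_mod] submodule_kernel[OF term_mod term_mod dL]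
  by (cases q) (simp_all add: cycles_def a_kernel_def')

private lemma homology_trivial_iff: "trivial_module (homology M d q) \<longleftrightarrow> cycles M d q \<subseteq> B q"
  unfolding homology_def by (rule trivial_subquotient_iff[OF term_mod submodule_B submodule_cycles])

private lemma term_resolution:
  assumes "q \<le> m"
  shows "\<exists>n D e. free_resolves A n D (M q) e \<and> e ` vectors A (n 0) = carrier (M q) \<and>
    (\<forall>k\<ge>m - q. free_ext_vanishes A n D (Suc k))"
proof -
  obtain n D e where F: "free_resolves A n D (M q) e"
    "e ` vectors A (n 0) = carrier (M q)"
    using finitely_generated_free_resolution[OF noeth term_mod fg[rule_format, OF assms]] by (elim exE conjE) (rule that)
  have "free_ext_vanishes A n D (Suc k)" if k: "m - q \<le> k" for k
  proof -
    obtain h where "h \<in> free_maps A (n k) (n (Suc k))"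
      "\<forall>x\<in>vectors A (n (Suc k)). D k (h (D k x)) = D k x"
      using pdim_le_imp_split[OF F pd[rule_format, OF assms] k] by (elim bexE) (rule that)
    then show ?thesis by (intro split_imp_ext_vanishes[OF resolvesD(1)[OF F(1)]]) auto
  qed
  then show ?thesis using F by blast
qed

text \<open>The cone resolves \<open>M q / B q\<close>. The bound above which its Ext modules vanish is one higher than
  for \<open>B q\<close>, and matches the projective dimension allowed for the term \<open>M q\<close> itself.\<close>

private lemma cone_over_term:
  assumes q: "q \<le> m" and X: "free_resolves A nX dX (M q) eX" "eX ` vectors A (nX 0) = B q"
    "\<forall>k\<ge>m - q. free_ext_vanishes A nX dX k"
  shows "\<exists>n D e. free_exact_complex A n D \<and> e \<in> linear_maps A (free_module A (n 0)) (M q) \<and>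
    e ` vectors A (n 0) = carrier (M q) \<and>
    D 0 ` vectors A (n (Suc 0)) = {y \<in> vectors A (n 0). e y \<in> B q} \<and>
    (\<forall>k>m - q. free_ext_vanishes A n D k)"
proof -
  obtain nY dY eY where Y: "free_resolves A nY dY (M q) eY" "eY ` vectors A (nY 0) = carrier (M q)"
    "\<forall>k\<ge>m - q. free_ext_vanishes A nY dY (Suc k)"
    using term_resolution[OF q] by (elim exE conjE) (rule that)
  note L = left_module_free[OF left_module_ring[OF term_mod]]
  have sub: "eX ` vectors A (nX 0) \<subseteq> eY ` vectors A (nY 0)"
    using X(2) Y(2) submoduleD(1)[OF term_mod submodule_B] by simp
  obtain \<phi> where \<phi>: "free_chain_map A nX dX nY dY \<phi>" "\<forall>x\<in>vectors A (nX 0). eY (\<phi> 0 x) = eX x"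
    using comparison_map[OF X(1) Y(1) sub lifts_free_module[OF L term_mod] lifts_free_module[OF L L]]
    by (elim exE conjE) (rule that)
  let ?n = "cone_rank nY nX" and ?D = "cone_map A nY dY nX dX \<phi>"
  have n0: "?n 0 = nY 0" by (simp add: cone_rank_def)
  have "free_ext_vanishes A ?n ?D k" if k: "m - q < k" for k
  proof -
    obtain j where j: "k = Suc j" "m - q \<le> j" using k by (cases k) auto
    show ?thesis
      unfolding j(1) by (rule cone_ext_vanishes[OF X(1) Y(1) \<phi>]) (use X(3) Y(3) j(2) in auto)
  qed
  moreover have "eY \<in> linear_maps A (free_module A (?n 0)) (M q)" "eY ` vectors A (?n 0) = carrier (M q)"
    unfolding n0 using resolvesD(3)[OF Y(1)] Y(2) by simp_all
  moreover note cone_exact[OF X(1) Y(1) \<phi>] cone_augmentation_image[OF X(1) Y(1) \<phi>, unfolded X(2)]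
  ultimately show ?thesis by (intro exI conjI allI impI)
qed

text \<open>Where the complex is exact, \<open>d p\<close> embeds \<open>M (Suc p) / B (Suc p)\<close> into \<open>M p\<close> with image
  \<open>B p\<close>.\<close>

private lemma boundaries_resolution:
  assumes "i \<le> q" "q \<le> m"
  shows "\<exists>n D e. free_resolves A n D (M q) e \<and> e ` vectors A (n 0) = B q \<and>
    (\<forall>k\<ge>m - q. free_ext_vanishes A n D k)"
  using assms(2,1)
proof (induction q rule: inc_induct)
  case base
  have "carrier (M (Suc m)) = {\<zero>\<^bsub>M (Suc m)\<^esub>}" using top by (simp add: trivial_module_def)
  then have "B m = {\<zero>\<^bsub>M m\<^esub>}" using linear_maps_zero[OF term_mod term_mod dL] by simp
  then show ?case
    using zero_resolution[OF term_mod]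
    by (intro exI[of _ "\<lambda>_. 0"] exI[of _ "\<lambda>k x. []"] exI[of _ "\<lambda>x. \<zero>\<^bsub>M m\<^esub>"]) simp
next
  case (step p)
  then have pm: "Suc p \<le> m" and ip: "i < Suc p" by auto
  obtain nX dX eX where X: "free_resolves A nX dX (M (Suc p)) eX" "eX ` vectors A (nX 0) = B (Suc p)"
    "\<forall>k\<ge>m - Suc p. free_ext_vanishes A nX dX k"
    using step.IH step.prems by (elim meta_impE exE conjE) (simp, rule that)
  obtain n D e where C: "free_exact_complex A n D" "e \<in> linear_maps A (free_module A (n 0)) (M (Suc p))"
    "e ` vectors A (n 0) = carrier (M (Suc p))"
    "D 0 ` vectors A (n (Suc 0)) = {y \<in> vectors A (n 0). e y \<in> B (Suc p)}"
    "\<forall>k>m - Suc p. free_ext_vanishes A n D k"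
    using cone_over_term[OF pm X] by (elim exE conjE) (rule that)
  have Zp: "cycles M d (Suc p) = B (Suc p)"
  proof
    show "cycles M d (Suc p) \<subseteq> B (Suc p)" using acyclic ip pm homology_trivial_iff by blast
    show "B (Suc p) \<subseteq> cycles M d (Suc p)"
      using is_complex linear_mapsD(1)[OF dL] by (auto simp: cycles_def a_kernel_def' module_complex_def)
  qed
  have "{y \<in> vectors A (n 0). e y \<in> B (Suc p)} = {y \<in> vectors A (n 0). d p (e y) = \<zero>\<^bsub>M p\<^esub>}"
    unfolding Zp[symmetric] using linear_mapsD(1)[OF C(2)] by (auto simp: cycles_def a_kernel_def')
  then have "free_resolves A n D (M p) (\<lambda>y. d p (e y))"
    unfolding resolves_def using C(1,4) term_mod linear_maps_comp[OF C(2) dL] by simp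
  moreover have "(\<lambda>y. d p (e y)) ` vectors A (n 0) = B p"
    unfolding C(3)[symmetric] image_image ..
  moreover have "\<forall>k\<ge>m - p. free_ext_vanishes A n D k" using C(5) pm by auto
  ultimately show ?case by (intro exI conjI)
qed

text \<open>The cokernel \<open>M i / B i\<close> contains \<open>H i\<close>, and its Ext modules vanish above \<open>m - i\<close>.\<close>

private lemma cokernel_of_boundaries_resolution:
  assumes "i \<le> m"
  shows "\<exists>n D e. free_resolves A n D (subquotient (M i) (carrier (M i)) (B i)) e \<and>
    e ` vectors A (n 0) = carrier (subquotient (M i) (carrier (M i)) (B i)) \<and>
    (\<forall>k>m - i. free_ext_vanishes A n D k)"
proof -
  obtain nX dX eX where X: "free_resolves A nX dX (M i) eX" "eX ` vectors A (nX 0) = B i"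
    "\<forall>k\<ge>m - i. free_ext_vanishes A nX dX k"
    using boundaries_resolution[OF order_refl assms] by (elim exE conjE) (rule that)
  obtain n D e where C: "free_exact_complex A n D" "e \<in> linear_maps A (free_module A (n 0)) (M i)"
    "e ` vectors A (n 0) = carrier (M i)"
    "D 0 ` vectors A (n (Suc 0)) = {y \<in> vectors A (n 0). e y \<in> B i}"
    "\<forall>k>m - i. free_ext_vanishes A n D k"
    using cone_over_term[OF assms X] by (elim exE conjE) (rule that)
  let ?C = "subquotient (M i) (carrier (M i)) (B i)" and ?e = "\<lambda>y. B i +>\<^bsub>M i\<^esub> e y"
  have CL: "left_module A ?C"
    by (rule left_module_subquotient[OF term_mod submodule_B submodule_carrier[OF term_mod]])
  have pi: "(\<lambda>x. B i +>\<^bsub>M i\<^esub> x) \<in> linear_maps A (M i) ?C"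
    using coset_map_linear[OF term_mod submodule_B submodule_carrier[OF term_mod]]
    by (simp add: linear_maps_def)
  have "{y \<in> vectors A (n 0). e y \<in> B i} = {y \<in> vectors A (n 0). ?e y = \<zero>\<^bsub>?C\<^esub>}"
    unfolding subquotient_simps using linear_mapsD(1)[OF C(2)] coset_eq_self_iff[OF term_mod submodule_B] by blast
  then have "free_resolves A n D ?C ?e"
    unfolding resolves_def using C(1,4) CL linear_maps_comp[OF C(2) pi] by simp
  moreover have "?e ` vectors A (n 0) = carrier ?C"
    unfolding subquotient_simps C(3)[symmetric] image_image ..
  ultimately show ?thesis using C(5) by (intro exI conjI)
qed

private lemma homology_resolution:
  assumes "i \<le> m"
  shows "\<exists>n D e. free_resolves A n D (homology M d i) e \<and>
    e ` vectors A (n 0) = carrier (homology M d i)"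
proof -
  obtain nY dY eY where Y: "free_resolves A nY dY (M i) eY"
    "eY ` vectors A (nY 0) = carrier (M i)"
    using term_resolution[OF assms] by (elim exE conjE) (rule that)
  have sub: "cycles M d i \<subseteq> eY ` vectors A (nY 0)"
    unfolding Y(2) by (rule submoduleD(1)[OF term_mod submodule_cycles])
  obtain nZ dZ eZ where Z: "free_resolves A nZ dZ (M i) eZ"
    "eZ ` vectors A (nZ 0) = cycles M d i"
    by (rule free_resolution_submodule[OF noeth term_mod submodule_cycles resolvesD(3)[OF Y(1)] sub]) (rule that)
  have eZ: "eZ \<in> linear_maps A (free_module A (nZ 0)) (M i\<lparr>carrier := cycles M d i\<rparr>)"
    using linear_mapsD[OF resolvesD(3)[OF Z(1)]] Z(2) by (intro linear_mapsI) auto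
  have HL: "left_module A (homology M d i)"
    unfolding homology_def by (rule left_module_subquotient[OF term_mod submodule_B submodule_cycles])
  have pi: "(\<lambda>x. B i +>\<^bsub>M i\<^esub> eZ x) \<in> linear_maps A (free_module A (nZ 0)) (homology M d i)"
    unfolding homology_def by (rule linear_maps_comp[OF eZ coset_map_linear[OF term_mod submodule_B submodule_cycles]])
  have im: "(\<lambda>x. B i +>\<^bsub>M i\<^esub> eZ x) ` vectors A (nZ 0) = carrier (homology M d i)"
    unfolding homology_def subquotient_simps Z(2)[symmetric] image_image ..
  show ?thesis
    by (rule finitely_generated_free_resolution[OF noeth HL finitely_generated_free_image[OF HL pi im]])
qed

text \<open>If the grade of \<open>H i\<close> were larger than \<open>m - i\<close>, then \<open>Ext k (H i)\<close> would be zero for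
  \<open>k \<le> m - i\<close>, and for larger \<open>k\<close> it would be isomorphic to \<open>Ext (Suc k)\<close> of the quotient of
  \<open>M i / B i\<close> by \<open>H i\<close>. In both cases \<open>Ext k\<close> of the right module \<open>Ext k (H i)\<close> vanishes, which
  forces \<open>H i\<close> to be zero.\<close>

private lemma homology_zero_of_large_grade:
  assumes reg: "auslander_regular A" and im: "i \<le> m" and gr: "enat (m - i) < grade A (homology M d i)"
  shows "trivial_module (homology M d i)"
proof -
  let ?H = "homology M d i" and ?C = "subquotient (M i) (carrier (M i)) (B i)"
  obtain n D e where N: "free_resolves A n D ?H e" "e ` vectors A (n 0) = carrier ?H"
    using homology_resolution[OF im] by (elim exE conjE) (rule that)
  obtain nY dY eY where Y: "free_resolves A nY dY ?C eY"
    "eY ` vectors A (nY 0) = carrier ?C"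
    "\<forall>k>m - i. free_ext_vanishes A nY dY k"
    using cokernel_of_boundaries_resolution[OF im] by (elim exE conjE) (rule that)
  have A: "ring A" by (rule left_module_ring[OF term_mod])
  note L = left_module_free[OF A] and exN = resolvesD(1)[OF N(1)]
  have CL: "left_module A ?C" by (rule resolvesD(2)[OF Y(1)])
  have HC: "carrier ?H \<subseteq> carrier ?C"
    unfolding homology_def subquotient_simps using submoduleD(1)[OF term_mod submodule_cycles] by blast
  have ops: "zero ?H = zero ?C" "add ?H = add ?C" "smult ?H = smult ?C"
    by (simp_all add: homology_def subquotient_def)
  have X: "free_resolves A n D ?C e"
    using N(1) CL HC unfolding resolves_def linear_maps_def ops by auto
  have sub: "e ` vectors A (n 0) \<subseteq> eY ` vectors A (nY 0)"
    using N(2) Y(2) HC by simp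
  obtain \<phi> where \<phi>: "free_chain_map A n D nY dY \<phi>"
    "\<forall>x\<in>vectors A (n 0). eY (\<phi> 0 x) = e x"
    using comparison_map[OF X Y(1) sub lifts_free_module[OF L CL] lifts_free_module[OF L L]]
    by (elim exE conjE) (rule that)
  obtain Q :: "('a, 'a list set) module" and eQ where
    Q: "free_resolves A n D Q eQ" "eQ ` vectors A (n 0) = carrier Q"
    "left_module A Q" "finitely_generated A Q"
    using cokernel_resolution[OF exN] by (elim exE conjE) (rule that)
  obtain \<mu> :: nat where \<mu>: "\<forall>M :: ('a, 'a list set) module.
       left_module A M \<longrightarrow> finitely_generated A M \<longrightarrow> pdim A M \<le> enat \<mu>"
    using reg unfolding auslander_regular_def finite_global_dimension_def by (elim conjE exE) (rule that)
  have pdQ: "pdim A Q \<le> enat \<mu>" using \<mu> Q(3,4) by blast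
  have Sn: "left_noetherian (opp_ring A)" and ausl: "auslander_condition A"
    using reg by (auto simp: auslander_regular_def right_noetherian_def)
  have "D 0 ` vectors A (n (Suc 0)) = vectors A (n 0)"
  proof (rule augmented_module_zero[OF refl Sn exN pdim_le_imp_split[OF Q(1,2) pdQ]])
    fix k g dG e'
    assume G: "free_exact_complex (opp_ring A) g dG"
      and e': "e' \<in> free_maps (opp_ring A) (g 0) (n k)"
      and im': "e' ` vectors (opp_ring A) (g 0) = transposed_cycles A n D k"
      and ker: "dG 0 ` vectors (opp_ring A) (g (Suc 0)) =
        {y \<in> vectors (opp_ring A) (g 0). e' y \<in> transposed_boundaries A n D k}"
    show "free_ext_vanishes (opp_ring A) g dG k"
    proof (cases "m - i < k")
      case True
      then show ?thesis
        using Y(3) by (intro ext_of_submodule_ext_vanishes[OF ausl X Y(1) \<phi> _ _ refl G e' im' ker]) auto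
    next
      case False
      then have "enat k \<le> enat (m - i)" by simp
      then have "enat k < grade A ?H" using gr by (rule le_less_trans)
      then have v: "free_ext_vanishes A n D k"
        using ext_trivial_below_grade ext_module_trivial_iff[OF N] by blast
      have "w \<in> transposed_boundaries A n D k" if w: "w \<in> transposed_cycles A n D k" for w
      proof -
        have wc: "w \<in> vectors A (n k)" using w by (simp add: transposed_cycles_def)
        show ?thesis
          using v w transposed_cycles_cocycle[OF exN wc] transposed_boundaries_coboundary[OF exN wc]
          by (simp add: ext_vanishes_def)
      qed
      then have all: "dG 0 ` vectors (opp_ring A) (g (Suc 0)) = vectors (opp_ring A) (g 0)"
        unfolding ker using im' by blast
      let ?O = "free_module (opp_ring A) 0"
      have OL: "left_module (opp_ring A) ?O" by (rule left_module_free[OF ring_opp_ring[OF A]])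
      have "free_resolves (opp_ring A) g dG ?O (\<lambda>x. \<zero>\<^bsub>?O\<^esub>)"
        unfolding resolves_def using G OL linear_maps_const_zero[OF OL] all by simp
      moreover have "(\<lambda>x. \<zero>\<^bsub>?O\<^esub>) ` vectors (opp_ring A) (g 0) =
          (\<lambda>x. \<zero>\<^bsub>?O\<^esub>) ` vectors (opp_ring A) 0"
        using submoduleD(2)[OF left_module_free submodule_carrier[OF left_module_free], OF ring_opp_ring[OF A] ring_opp_ring[OF A], of "g 0"]
        by auto
      ultimately show ?thesis
        using free_resolution_ext_vanishes_unique[OF _ zero_resolution(1)[OF OL], of g dG]
          zero_resolution(2)[OF OL, of k] by blast
    qed
  qed
  then have "e ` vectors A (n 0) \<subseteq> {\<zero>\<^bsub>?H\<^esub>}"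
    using resolvesD(4)[OF N(1)] by auto
  moreover have "\<zero>\<^bsub>?H\<^esub> \<in> carrier ?H"
    using submoduleD(2)[OF resolvesD(2)[OF N(1)] submodule_carrier[OF resolvesD(2)[OF N(1)]]] .
  ultimately show ?thesis unfolding trivial_module_def N(2) by blast
qed

lemma grade_last_homology_le:
  assumes "auslander_regular A" "i \<le> m" "\<not> trivial_module (homology M d i)"
  shows "grade A (homology M d i) \<le> enat (m - i)"
  using homology_zero_of_large_grade[OF assms(1,2)] assms(3) by (meson not_le)

end

theorem lemma1p2:
  fixes A :: "('a, 'r) ring_scheme"
    and M :: "nat \<Rightarrow> ('a, 'b, 'm) module_scheme"
    and d :: "nat \<Rightarrow> 'b \<Rightarrow> 'b"
    and m i :: nat
  assumes "auslander_regular A"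
    and "module_complex A M d"
    and "\<forall>q>m. trivial_module (M q)"
    and "\<forall>q\<le>m. finitely_generated A (M q)"
    and "\<forall>q\<le>m. pdim A (M q) \<le> enat (m - q)"
    and "0 < i" and "i \<le> m"
    and "\<not> trivial_module (homology M d i)"
    and "\<forall>q. i < q \<and> q \<le> m \<longrightarrow> trivial_module (homology M d q)"
  shows "grade A (homology M d i) \<le> enat (m - i) \<and> m - i < m"
proof -
  have "left_noetherian A" using assms(1) by (simp add: auslander_regular_def)
  then show ?thesis
    using grade_last_homology_le[OF _ assms(2-5,9,1,7,8)] assms(6,7) by simp
qed

end
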